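(* Let $(A_n)_{n\ge1}$ be a strictly stationary, ergodic process of random $p\times p$ nonnegative column-allowable matrices that is weakly sequentially primitive and satisfies $\mathbb E\log^+\|A_1\|<\infty$. Let $\lambda_1\ge\lambda_2$ be the first and second largest Lyapunov exponents associated with $(A_n)$, let $M_n=A_nA_{n-1}\cdots A_1$, and for $x,w\in\mathbb R^p_+$ put $x_n=M_nx$, $w_n=M_nw$. Then: (1) For all pairs $(x,w)\in\mathbb R^p_+\times\mathbb R^p_+$, except for a set of Lebesgue measure zero, it almost surely holds that $$\lim_{n\to\infty}\frac1n\log\left\|\frac{x_n}{\mathbf 1^\top x_n}-\frac{w_n}{\mathbf 1^\top w_n}\right\|_{TV}=-(\lambda_1-\lambda_2).$$ (2) For any fixed pair $(x,w)\in\mathbb R^p_+\times\mathbb R^p_+$ with strictly positive components (with no exception), the limit $$\lim_{n\to\infty}\frac1n\log\left\|\frac{x_n}{\mathbf 1^\top x_n}-\frac{w_n}{\mathbf 1^\top w_n}\right\|_{TV}$$ exists almost surely, and $$\lim_{n\to\infty}\frac1n\log\left\|\frac{x_n}{\mathbf 1^\top x_n}-\frac{w_n}{\mathbf 1^\top w_n}\right\|_{TV}\le-(\lambda_1-\lambda_2).$$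
   Context: $\mathbb R^p_+$ denotes the set of nonnegative, nonzero vectors of $\mathbb R^p$; $\mathbf 1=(1,\dots,1)^\top$; $\|\xi-\eta\|_{TV}=\frac12\sum_i|\xi_i-\eta_i|$ is the total variation distance of probability vectors; $\log 0=-\infty$. A nonnegative matrix is column-allowable if each of its columns contains a strictly positive entry. A strictly stationary process of nonnegative column-allowable matrices $(A_n)_{n\ge1}$ is weakly (forward) sequentially primitive if there is an almost surely finite stopping time $\tau$ such that each row of $M_\tau=A_\tau A_{\tau-1}\cdots A_1$ is either strictly positive or zero. Lyapunov exponents: for a realization of the sequence and $x\in\mathbb R^p$ put $\lambda(x)=\limsup_n\frac1n\log|A_n\cdots A_1x|$ and $L_\mu=\{x:\lambda(x)\le\mu\}$, a linear subspace. There are finitely many values $\mu_1>\dots>\mu_q\ge-\infty$ with $\mathbb R^p=L_{\mu_1}\supsetneq\dots\supsetneq L_{\mu_q}\supsetneq\{0\}=:L_{\mu_{q+1}}$, $\lambda(x)=\mu_r$ on $L_{\mu_r}\setminus L_{\mu_{r+1}}$. The full spectrum $\lambda_1\ge\lambda_2\ge\dots\ge\lambda_p\ge-\infty$ lists each $\mu_r$ with multiplicity $\dim L_{\mu_r}-\dim L_{\mu_{r+1}}$. Under stationarity, ergodicity and $\mathbb E\log^+\|A_1\|<\infty$, the exponents are almost surely deterministic (Oseledec).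
   Formalization: The formal theorem assumes that the first Lyapunov exponent is not minus infinity (otherwise the second is too, the difference of the two is undefined, and the limit in (2) may fail to exist) and that p is at least 2, so that a second exponent exists. *)

theory Defs
  imports "HOL-Probability.Probability"
begin

text \<open>
  A process \<open>(A\<^sub>n)\<^sub>n\<^sub>\<ge>\<^sub>1\<close> is a function \<open>A :: nat \<Rightarrow> 'w \<Rightarrow> 'b\<close>; the value \<open>A 0\<close> is
  never used.  A realization of it is the sequence \<open>\<lambda>n. A n \<omega>\<close>.
\<close>

definition trajectory :: "(nat \<Rightarrow> 'w \<Rightarrow> 'b) \<Rightarrow> 'w \<Rightarrow> nat \<Rightarrow> 'b" where
  "trajectory A \<omega> = (\<lambda>n. A (Suc n) \<omega>)"

definition sequence_law ::
    "'w measure \<Rightarrow> (nat \<Rightarrow> 'w \<Rightarrow> 'b::topological_space) \<Rightarrow> (nat \<Rightarrow> 'b) measure" where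
  "sequence_law M A = distr M (\<Pi>\<^sub>M i\<in>UNIV. borel) (trajectory A)"

definition strictly_stationary ::
    "'w measure \<Rightarrow> (nat \<Rightarrow> 'w \<Rightarrow> 'b::topological_space) \<Rightarrow> bool" where
  "strictly_stationary M A \<longleftrightarrow> sequence_law M (\<lambda>n. A (Suc n)) = sequence_law M A"

text \<open>Ergodicity of a stationary process: the left shift is ergodic for the law of the process.\<close>

definition ergodic_process ::
    "'w measure \<Rightarrow> (nat \<Rightarrow> 'w \<Rightarrow> 'b::topological_space) \<Rightarrow> bool" where
  "ergodic_process M A \<longleftrightarrow>
     (\<forall>B \<in> sets (\<Pi>\<^sub>M i\<in>(UNIV::nat set). borel).
        (\<lambda>s n. s (Suc n)) -` B = B \<longrightarrow>
        measure (sequence_law M A) B = 0 \<or> measure (sequence_law M A) B = 1)"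

text \<open>Times are extended so that a stopping time may take the value \<open>\<infinity>\<close>.\<close>

definition natural_filtration ::
    "'w measure \<Rightarrow> (nat \<Rightarrow> 'w \<Rightarrow> 'b::topological_space) \<Rightarrow> enat \<Rightarrow> 'w measure" where
  "natural_filtration M A t =
     sigma (space M) {A n -` B \<inter> space M | n B. 1 \<le> n \<and> enat n \<le> t \<and> B \<in> sets borel}"

definition nonneg_matrix :: "real^'n^'m \<Rightarrow> bool" where
  "nonneg_matrix a \<longleftrightarrow> (\<forall>i j. 0 \<le> a $ i $ j)"

definition column_allowable :: "real^'n^'m \<Rightarrow> bool" where
  "column_allowable a \<longleftrightarrow> (\<forall>j. \<exists>i. 0 < a $ i $ j)"

primrec forward_product :: "(nat \<Rightarrow> real^'p^'p) \<Rightarrow> nat \<Rightarrow> real^'p^'p" where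
  "forward_product a 0 = mat 1"
| "forward_product a (Suc n) = a (Suc n) ** forward_product a n"

definition weakly_sequentially_primitive ::
    "'w measure \<Rightarrow> (nat \<Rightarrow> 'w \<Rightarrow> real^'p^'p) \<Rightarrow> bool" where
  "weakly_sequentially_primitive M A \<longleftrightarrow>
     (\<exists>\<tau> :: 'w \<Rightarrow> enat. stopping_time (natural_filtration M A) \<tau> \<and>
        (AE \<omega> in M. \<tau> \<omega> < \<infinity>) \<and>
        (AE \<omega> in M. \<forall>i.
           (\<forall>j. 0 < forward_product (\<lambda>n. A n \<omega>) (the_enat (\<tau> \<omega>)) $ i $ j) \<or>
           (\<forall>j. forward_product (\<lambda>n. A n \<omega>) (the_enat (\<tau> \<omega>)) $ i $ j = 0)))"

text \<open>Logarithm with the convention \<open>log 0 = -\<infinity>\<close>; it is applied to nonnegative reals only.\<close>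

definition elog :: "real \<Rightarrow> ereal" where
  "elog t = (if t \<le> 0 then - \<infinity> else ereal (ln t))"

definition log_plus :: "real \<Rightarrow> real" where
  "log_plus t = (if t \<le> 1 then 0 else ln t)"

definition lyapunov_growth :: "(nat \<Rightarrow> real^'p^'p) \<Rightarrow> real^'p \<Rightarrow> ereal" where
  "lyapunov_growth a x = limsup (\<lambda>n. ereal (1 / real n) * elog (norm (forward_product a n *v x)))"

definition lyapunov_space :: "(nat \<Rightarrow> real^'p^'p) \<Rightarrow> ereal \<Rightarrow> (real^'p) set" where
  "lyapunov_space a \<mu> = {x. lyapunov_growth a x \<le> \<mu>}"

text \<open>The distinct values \<open>\<mu>\<^sub>1 > \<dots> > \<mu>\<^sub>q\<close> (list positions start at \<open>0\<close>).\<close>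

definition lyapunov_values :: "(nat \<Rightarrow> real^'p^'p) \<Rightarrow> ereal list" where
  "lyapunov_values a = rev (sorted_list_of_set (lyapunov_growth a ` (UNIV - {0})))"

text \<open>The subspace at position \<open>r\<close> of the flag, with \<open>{0}\<close> below the last one.\<close>

definition lyapunov_flag :: "(nat \<Rightarrow> real^'p^'p) \<Rightarrow> nat \<Rightarrow> (real^'p) set" where
  "lyapunov_flag a r =
     (if r < length (lyapunov_values a) then lyapunov_space a (lyapunov_values a ! r) else {0})"

definition lyapunov_spectrum :: "(nat \<Rightarrow> real^'p^'p) \<Rightarrow> ereal list" where
  "lyapunov_spectrum a =
     concat (map (\<lambda>r. replicate (dim (lyapunov_flag a r) - dim (lyapunov_flag a (Suc r)))
                                (lyapunov_values a ! r))
                 [0..<length (lyapunov_values a)])"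

text \<open>
  The \<open>k\<close>-th Lyapunov exponent (\<open>1 \<le> k \<le> p\<close>) of the process: the almost sure value of the
  \<open>k\<close>-th entry of the spectrum of a realization.  By Oseledec's theorem this value is
  deterministic for stationary ergodic processes with log-integrable norm.
\<close>

definition lyapunov_exponent :: "'w measure \<Rightarrow> (nat \<Rightarrow> 'w \<Rightarrow> real^'p^'p) \<Rightarrow> nat \<Rightarrow> ereal" where
  "lyapunov_exponent M A k =
     (THE c. AE \<omega> in M. lyapunov_spectrum (\<lambda>n. A n \<omega>) ! (k - 1) = c)"

definition nonneg_nonzero :: "(real^'p) set" where
  "nonneg_nonzero = {x. (\<forall>i. 0 \<le> x $ i) \<and> x \<noteq> 0}"

definition normalize_sum :: "real^'p \<Rightarrow> real^'p" where
  "normalize_sum x = (1 / (\<Sum>i\<in>UNIV. x $ i)) *\<^sub>R x"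

definition tv_dist :: "real^'p \<Rightarrow> real^'p \<Rightarrow> real" where
  "tv_dist \<xi> \<eta> = (1 / 2) * (\<Sum>i\<in>UNIV. \<bar>\<xi> $ i - \<eta> $ i\<bar>)"

text \<open>\<open>(1/n) log\<close> of the total variation distance between the normalized \<open>x\<^sub>n\<close> and \<open>w\<^sub>n\<close>.\<close>

definition tv_rate :: "(nat \<Rightarrow> real^'p^'p) \<Rightarrow> real^'p \<Rightarrow> real^'p \<Rightarrow> nat \<Rightarrow> ereal" where
  "tv_rate a x w n = ereal (1 / real n) *
     elog (tv_dist (normalize_sum (forward_product a n *v x))
                   (normalize_sum (forward_product a n *v w)))"

end

theory Submission
  imports Defs
begin

text \<open>
  Put \<open>x\<^sub>n \<and> w\<^sub>n = x\<^sub>n w\<^sub>n\<^sup>T - w\<^sub>n x\<^sub>n\<^sup>T\<close>, on which \<open>A\<^sub>n\<close> acts by \<open>X \<mapsto> A\<^sub>n X A\<^sub>n\<^sup>T\<close>.  The total variation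
  distance of the normalized vectors is, up to constant factors, \<open>|x\<^sub>n \<and> w\<^sub>n| / (\<one>\<^sup>Tx\<^sub>n \<cdot> \<one>\<^sup>Tw\<^sub>n)\<close>.  Weak
  primitivity makes the images of any two nonnegative nonzero vectors comparable after the stopping
  time, so both factors of the denominator grow at rate \<open>\<lambda>\<^sub>1\<close>.  The numerator has an exact rate, which
  is at most \<open>\<lambda>\<^sub>1 + \<lambda>\<^sub>2\<close>, with equality unless \<open>x \<and> w\<close> lies in a proper subspace depending on the
  realization; Fubini turns this into a Lebesgue null set of pairs.

  The exact rates come from a multiplicative ergodic theorem for one-sided, possibly singular,
  cocycles of linear maps on a Euclidean space.  By Kingman's theorem the maximal \<open>k\<close>-dimensional
  volume growth of the products has a rate \<open>\<Lambda>\<^sub>k\<close> for every \<open>k\<close>.  For a fixed realization, a frame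
  avoiding countably many thin slabs attains all \<open>\<Lambda>\<^sub>k\<close> simultaneously.  Along that frame the cocycle is
  triangular with diagonal rates \<open>\<Lambda>\<^sub>k - \<Lambda>\<^sub>k\<^sub>-\<^sub>1\<close> in decreasing order, and solving the triangular
  recursion from the slowest coordinate upwards gives every vector an exact rate.
\<close>

section \<open>Exponential rates\<close>

text \<open>The matrices may be singular, the process is one-sided and exponents may be
  \<open>-\<infinity>\<close>. Growth is therefore measured by inequalities between reals with rates
  in \<open>ereal\<close>, and rates are divided out only when they are finite. Constants and
  polynomial factors are invisible at this scale, so crude sums of volumes suffice, and slabs of
  width of order \<open>1/m^2\<close> have summable measure without costing any rate. The generic
  frame is chosen after the realization is fixed, so nothing about it has to be measurable. Two
  cocycles occur. Volumes under the matrices themselves give the exponents and bound every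
  \<open>|x_n \<and> w_n|\<close> from above. An upper bound yields no limit, however, and the
  second claim asserts a limit for each single pair. The existence of that rate comes from a second
  application of the ergodic theorem, to conjugation on the space of all matrices. Finiteness of the
  top exponent is what allows the denominator of the distance to be divided out.\<close>

definition rate_le :: "(nat \<Rightarrow> real) \<Rightarrow> ereal \<Rightarrow> bool" where
  "rate_le X c \<longleftrightarrow> (\<forall>r. c < ereal r \<longrightarrow> (\<forall>\<^sub>F n in sequentially. X n \<le> exp (r * real n)))"

text \<open>Because the comparison is with real exponents, a lower rate \<open>-\<infinity>\<close>
  is no condition, and an upper rate \<open>-\<infinity>\<close> means decay faster than every
  exponential, eventual vanishing included. Zero terms need no separate treatment.\<close>

definition rate_ge :: "(nat \<Rightarrow> real) \<Rightarrow> ereal \<Rightarrow> bool" where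
  "rate_ge X c \<longleftrightarrow> (\<forall>r. ereal r < c \<longrightarrow> (\<forall>\<^sub>F n in sequentially. exp (r * real n) \<le> X n))"

lemma rate_leD: "rate_le X c \<Longrightarrow> c < ereal r \<Longrightarrow> \<forall>\<^sub>F n in sequentially. X n \<le> exp (r * real n)"
  by (auto simp: rate_le_def)

lemma rate_geD: "rate_ge X c \<Longrightarrow> ereal r < c \<Longrightarrow> \<forall>\<^sub>F n in sequentially. exp (r * real n) \<le> X n"
  by (auto simp: rate_ge_def)

lemma eventually_const_exp_le:
  assumes "a < b"
  shows "\<forall>\<^sub>F n in sequentially. C * exp (a * real n) \<le> exp (b * real n)"
proof -
  have "\<forall>\<^sub>F n in sequentially. ln (max C 1) / (b - a) \<le> real n"
    using filterlim_real_sequentially unfolding filterlim_at_top by blast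
  then show ?thesis
  proof eventually_elim
    case (elim n)
    have "ln (max C 1) \<le> (b - a) * real n"
      using elim assms by (simp add: field_simps)
    then have "exp (ln (max C 1)) \<le> exp ((b - a) * real n)"
      by (simp only: exp_le_cancel_iff)
    then have "C \<le> exp ((b - a) * real n)" by simp
    then have "C * exp (a * real n) \<le> exp ((b - a) * real n) * exp (a * real n)"
      by (intro mult_right_mono) auto
    also have "\<dots> = exp (b * real n)"
      by (metis exp_add distrib_right diff_add_cancel)
    finally show ?case .
  qed
qed

lemma rate_le_mono:
  assumes "rate_le Y c" "c \<le> c'" "\<forall>\<^sub>F n in sequentially. X n \<le> Y n"
  shows "rate_le X c'"
  unfolding rate_le_def
proof (intro allI impI)
  fix r assume "c' < ereal r"
  then have "\<forall>\<^sub>F n in sequentially. Y n \<le> exp (r * real n)"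
    using assms by (intro rate_leD[of Y c]) auto
  with assms(3) show "\<forall>\<^sub>F n in sequentially. X n \<le> exp (r * real n)"
    by eventually_elim auto
qed

lemma rate_ge_mono:
  assumes "rate_ge Y c" "c' \<le> c" "\<forall>\<^sub>F n in sequentially. Y n \<le> X n"
  shows "rate_ge X c'"
  unfolding rate_ge_def
proof (intro allI impI)
  fix r assume "ereal r < c'"
  then have "\<forall>\<^sub>F n in sequentially. exp (r * real n) \<le> Y n"
    using assms by (intro rate_geD[of Y c]) auto
  with assms(3) show "\<forall>\<^sub>F n in sequentially. exp (r * real n) \<le> X n"
    by eventually_elim auto
qed

text \<open>This distributes slack between the two factors of a product. A summand
  \<open>-\<infinity>\<close> absorbs any remainder, so its partner may be chosen freely.\<close>

lemma ereal_add_less_split: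
  fixes a b :: ereal
  assumes "a + b < ereal r" "a \<noteq> \<infinity>" "b \<noteq> \<infinity>"
  obtains s t where "a < ereal s" "b < ereal t" "s + t = r"
proof (cases "b = -\<infinity>")
  case True
  from assms obtain s where "a < ereal s"
    using gt_ex ereal_dense2[of a \<infinity>] by auto
  then show ?thesis using True that[of s "r - s"] by simp
next
  case False
  then obtain b' where b: "b = ereal b'" using assms by (cases b) auto
  show ?thesis
  proof (cases a)
    case (real a')
    then show ?thesis using assms b that[of "a' + (r - a' - b')/2" "b' + (r - a' - b')/2"]
      by (auto simp: field_simps)
  next
    case MInf
    then show ?thesis using b that[of "r - b' - 1" "b' + 1"] by auto
  qed (use assms in auto)
qed

lemma rate_le_mult:
  assumes "rate_le X a" "rate_le Y b" "a \<noteq> \<infinity>" "b \<noteq> \<infinity>" "\<And>n. 0 \<le> X n" "\<And>n. 0 \<le> Y n"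
  shows "rate_le (\<lambda>n. X n * Y n) (a + b)"
  unfolding rate_le_def
proof (intro allI impI)
  fix r assume "a + b < ereal r"
  then obtain s t where st: "a < ereal s" "b < ereal t" "s + t = r"
    using assms by (auto elim: ereal_add_less_split)
  from rate_leD[OF assms(1) st(1)] rate_leD[OF assms(2) st(2)]
  show "\<forall>\<^sub>F n in sequentially. X n * Y n \<le> exp (r * real n)"
  proof eventually_elim
    case (elim n)
    then have "X n * Y n \<le> exp (s * n) * exp (t * n)"
      using assms by (intro mult_mono) auto
    also have "\<dots> = exp (r * n)" by (simp flip: exp_add distrib_right add: st)
    finally show ?case .
  qed
qed

lemma rate_ge_mult:
  assumes "rate_ge X a" "rate_ge Y b" "a \<noteq> \<infinity>" "b \<noteq> \<infinity>"
  shows "rate_ge (\<lambda>n. X n * Y n) (a + b)"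
  unfolding rate_ge_def
proof (intro allI impI)
  fix r assume r: "ereal r < a + b"
  obtain a' b' where ab: "a = ereal a'" "b = ereal b'"
    using r assms by (cases a; cases b) auto
  obtain s t where st: "ereal s < a" "ereal t < b" "s + t = r"
    using that[of "a' - (a' + b' - r)/2" "b' - (a' + b' - r)/2"] r ab by (auto simp: field_simps)
  from rate_geD[OF assms(1) st(1)] rate_geD[OF assms(2) st(2)]
  show "\<forall>\<^sub>F n in sequentially. exp (r * real n) \<le> X n * Y n"
  proof eventually_elim
    case (elim n)
    have "exp (r * n) = exp (s * n) * exp (t * n)"
      by (simp flip: exp_add distrib_right add: st)
    also have "\<dots> \<le> X n * Y n"
      using elim by (intro mult_mono) (auto intro: order_trans[OF exp_ge_zero])
    finally show ?case .
  qed
qed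

lemma ereal_real_between:
  fixes c :: ereal
  assumes "c < ereal r"
  obtains s where "c < ereal s" "s < r"
proof (cases c)
  case (real x)
  then show ?thesis using assms that[of "(x + r)/2"] by auto
next
  case MInf
  then show ?thesis using that[of "r - 1"] by auto
qed (use assms in auto)

lemma ereal_real_between':
  fixes c :: ereal
  assumes "ereal r < c"
  obtains s where "ereal s < c" "r < s"
proof (cases c)
  case (real x)
  then show ?thesis using assms that[of "(x + r)/2"] by auto
next
  case PInf
  then show ?thesis using that[of "r + 1"] by auto
qed (use assms in auto)

lemma rate_le_add:
  assumes "rate_le X c" "rate_le Y c"
  shows "rate_le (\<lambda>n. X n + Y n) c"
  unfolding rate_le_def
proof (intro allI impI)
  fix r assume "c < ereal r"
  then obtain s where s: "c < ereal s" "s < r" by (rule ereal_real_between)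
  from rate_leD[OF assms(1) s(1)] rate_leD[OF assms(2) s(1)]
    eventually_const_exp_le[OF s(2), where C = 2]
  show "\<forall>\<^sub>F n in sequentially. X n + Y n \<le> exp (r * real n)"
  proof eventually_elim
    case (elim n)
    then show ?case by linarith
  qed
qed

lemma rate_le_const: "rate_le (\<lambda>_. C) 0"
  unfolding rate_le_def
proof (intro allI impI)
  fix r assume "0 < ereal r"
  then have "0 < r" by simp
  from eventually_const_exp_le[OF this, where C = C]
  show "\<forall>\<^sub>F n in sequentially. C \<le> exp (r * real n)"
    by (simp only: mult_zero_left exp_zero mult_1_right)
qed

lemma rate_ge_inverse:
  assumes "rate_le X c" "\<forall>\<^sub>F n in sequentially. 0 < X n"
  shows "rate_ge (\<lambda>n. inverse (X n)) (- c)"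
  unfolding rate_ge_def
proof (intro allI impI)
  fix r assume "ereal r < - c"
  then have "c < ereal (- r)" by (metis ereal_less_uminus_reorder uminus_ereal.simps(1))
  from rate_leD[OF assms(1) this] assms(2)
  show "\<forall>\<^sub>F n in sequentially. exp (r * real n) \<le> inverse (X n)"
    by eventually_elim (simp add: exp_minus le_imp_inverse_le field_simps)
qed

lemma rate_le_inverse:
  assumes "rate_ge X c"
  shows "rate_le (\<lambda>n. inverse (X n)) (- c)"
  unfolding rate_le_def
proof (intro allI impI)
  fix r assume "- c < ereal r"
  then have "ereal (- r) < c" by (metis ereal_uminus_less_reorder uminus_ereal.simps(1))
  from rate_geD[OF assms this]
  show "\<forall>\<^sub>F n in sequentially. inverse (X n) \<le> exp (r * real n)"
  proof eventually_elim
    case (elim n)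
    then have "inverse (X n) \<le> inverse (exp (- r * n))" by (intro le_imp_inverse_le) auto
    then show ?case by (simp add: exp_minus)
  qed
qed

lemma rate_ge_const: "0 < C \<Longrightarrow> rate_ge (\<lambda>_. C) 0"
  using rate_ge_inverse[OF rate_le_const[of "inverse C"]] by simp

lemma rate_le_cmult:
  assumes "rate_le X c" "\<And>n. 0 \<le> X n"
  shows "rate_le (\<lambda>n. C * X n) c"
proof (cases "c = \<infinity>")
  case False
  have "rate_le (\<lambda>n. \<bar>C\<bar> * X n) (0 + c)"
    using False assms by (intro rate_le_mult rate_le_const) auto
  then show ?thesis
    by (rule rate_le_mono) (auto intro!: always_eventually mult_right_mono assms)
qed (auto simp: rate_le_def)

lemma rate_ge_cmult:
  assumes "rate_ge X c" "0 < C"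
  shows "rate_ge (\<lambda>n. C * X n) c"
  unfolding rate_ge_def
proof (intro allI impI)
  fix r assume "ereal r < c"
  then obtain s where s: "ereal s < c" "r < s" by (rule ereal_real_between')
  from rate_geD[OF assms(1) s(1)] eventually_const_exp_le[OF s(2), of "inverse C"]
  show "\<forall>\<^sub>F n in sequentially. exp (r * real n) \<le> C * X n"
  proof eventually_elim
    case (elim n)
    then have "inverse C * exp (r * real n) \<le> X n" by linarith
    then show ?case using assms(2) by (simp add: field_simps)
  qed
qed

lemma rate_ge_Suc:
  assumes "rate_ge X c"
  shows "rate_ge (\<lambda>n. X (Suc n)) c"
  unfolding rate_ge_def
proof (intro allI impI)
  fix r assume "ereal r < c"
  then obtain s where s: "ereal s < c" "r < s" by (rule ereal_real_between')
  from eventually_sequentially_Suc[THEN iffD2, OF rate_geD[OF assms s(1)]]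
    eventually_const_exp_le[OF s(2), of "exp (-s)"]
  show "\<forall>\<^sub>F n in sequentially. exp (r * real n) \<le> X (Suc n)"
    by eventually_elim (simp add: algebra_simps exp_add exp_minus field_simps)
qed

lemma rate_ge_le:
  assumes "rate_ge X a" "rate_le X b"
  shows "a \<le> b"
proof (rule ccontr)
  assume "\<not> a \<le> b"
  then obtain r where r: "b < ereal r" "ereal r < a" using ereal_dense2[of b a] by (auto simp: not_le)
  then obtain s where s: "b < ereal s" "s < r" using ereal_real_between by blast
  have "\<forall>\<^sub>F n in sequentially. False"
    using rate_geD[OF assms(1) r(2)] rate_leD[OF assms(2) s(1)] eventually_gt_at_top[of 0]
  proof eventually_elim
    case (elim n)
    then have "exp (r * n) \<le> exp (s * n)" by linarith
    then show ?case using s elim by simp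
  qed
  then show False by simp
qed

lemma rate_le_zero: "rate_le (\<lambda>_. 0) c"
  by (auto simp: rate_le_def)

definition has_rate :: "(nat \<Rightarrow> real) \<Rightarrow> ereal \<Rightarrow> bool" where
  "has_rate X c \<longleftrightarrow> rate_le X c \<and> rate_ge X c"

lemma has_rate_unique: "has_rate X a \<Longrightarrow> has_rate X b \<Longrightarrow> a = b"
  using rate_ge_le unfolding has_rate_def by (metis antisym)

section \<open>Rates as limits of normalized extended logarithms\<close>

lemma elog_le_iff:
  assumes "0 < n"
  shows "ereal (1 / real n) * elog u \<le> ereal r \<longleftrightarrow> u \<le> exp (r * real n)"
proof (cases "u \<le> 0")
  case True
  then show ?thesis using assms by (auto simp: elog_def intro: order_trans[OF _ exp_ge_zero])
next
  case False
  have "u \<le> exp (r * real n) \<longleftrightarrow> ln u \<le> r * real n"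
    using False by (metis exp_le_cancel_iff exp_ln not_le)
  then show ?thesis using False assms by (auto simp: elog_def field_simps)
qed

text \<open>At \<open>n = 0\<close> the prefactor is \<open>0\<close>, also against
  \<open>-\<infinity>\<close>, so both equivalences are restricted to positive indices.\<close>

lemma elog_ge_iff:
  assumes "0 < n"
  shows "ereal r \<le> ereal (1 / real n) * elog u \<longleftrightarrow> exp (r * real n) \<le> u"
proof (cases "u \<le> 0")
  case True
  then have "\<not> exp (r * real n) \<le> u" using exp_gt_zero[of "r * real n"] by linarith
  then show ?thesis using assms True by (auto simp: elog_def)
next
  case False
  have "exp (r * real n) \<le> u \<longleftrightarrow> r * real n \<le> ln u"
    using False by (metis exp_le_cancel_iff exp_ln not_le)
  then show ?thesis using False assms by (auto simp: elog_def field_simps)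
qed

lemma rate_le_iff_limsup: "rate_le X c \<longleftrightarrow> limsup (\<lambda>n. ereal (1 / real n) * elog (X n)) \<le> c"
proof
  assume L: "rate_le X c"
  show "limsup (\<lambda>n. ereal (1 / real n) * elog (X n)) \<le> c"
  proof (rule dense_ge)
    fix y assume "c < y"
    then obtain r where r: "c < ereal r" "ereal r < y" using ereal_dense2 by blast
    have "\<forall>\<^sub>F n in sequentially. ereal (1 / real n) * elog (X n) \<le> ereal r"
      using rate_leD[OF L r(1)] eventually_gt_at_top[of 0]
      by eventually_elim (simp add: elog_le_iff)
    then have "limsup (\<lambda>n. ereal (1 / real n) * elog (X n)) \<le> ereal r"
      by (rule Limsup_bounded)
    then show "limsup (\<lambda>n. ereal (1 / real n) * elog (X n)) \<le> y" using r by auto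
  qed
next
  assume L: "limsup (\<lambda>n. ereal (1 / real n) * elog (X n)) \<le> c"
  show "rate_le X c"
    unfolding rate_le_def
  proof (intro allI impI)
    fix r assume "c < ereal r"
    with L have "\<forall>\<^sub>F n in sequentially. ereal (1 / real n) * elog (X n) < ereal r"
      by (metis Limsup_lessD order_le_less_trans)
    with eventually_gt_at_top[of 0]
    show "\<forall>\<^sub>F n in sequentially. X n \<le> exp (r * real n)"
      by eventually_elim (simp add: elog_le_iff[symmetric] less_imp_le)
  qed
qed

lemma rate_ge_iff_liminf: "rate_ge X c \<longleftrightarrow> c \<le> liminf (\<lambda>n. ereal (1 / real n) * elog (X n))"
proof
  assume L: "rate_ge X c"
  show "c \<le> liminf (\<lambda>n. ereal (1 / real n) * elog (X n))"
  proof (rule dense_le)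
    fix y assume "y < c"
    then obtain r where r: "y < ereal r" "ereal r < c" using ereal_dense2 by blast
    have "\<forall>\<^sub>F n in sequentially. ereal r \<le> ereal (1 / real n) * elog (X n)"
      using rate_geD[OF L r(2)] eventually_gt_at_top[of 0]
      by eventually_elim (simp add: elog_ge_iff)
    then have "ereal r \<le> liminf (\<lambda>n. ereal (1 / real n) * elog (X n))"
      by (rule Liminf_bounded)
    then show "y \<le> liminf (\<lambda>n. ereal (1 / real n) * elog (X n))" using r by auto
  qed
next
  assume L: "c \<le> liminf (\<lambda>n. ereal (1 / real n) * elog (X n))"
  show "rate_ge X c"
    unfolding rate_ge_def
  proof (intro allI impI)
    fix r assume "ereal r < c"
    with L have "\<forall>\<^sub>F n in sequentially. ereal r < ereal (1 / real n) * elog (X n)"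
      by (metis less_LiminfD order_less_le_trans)
    with eventually_gt_at_top[of 0]
    show "\<forall>\<^sub>F n in sequentially. exp (r * real n) \<le> X n"
      by eventually_elim (simp add: elog_ge_iff[symmetric] less_imp_le)
  qed
qed

lemma has_rate_iff_tendsto:
  "has_rate X c \<longleftrightarrow> (\<lambda>n. ereal (1 / real n) * elog (X n)) \<longlonglongrightarrow> c"
proof
  assume "has_rate X c"
  then show "(\<lambda>n. ereal (1 / real n) * elog (X n)) \<longlonglongrightarrow> c"
    unfolding has_rate_def rate_le_iff_limsup rate_ge_iff_liminf
    by (intro Liminf_eq_Limsup)
       (auto intro!: antisym intro: order_trans[OF Liminf_le_Limsup] order_trans[OF _ Liminf_le_Limsup])
next
  assume "(\<lambda>n. ereal (1 / real n) * elog (X n)) \<longlonglongrightarrow> c"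
  then show "has_rate X c"
    unfolding has_rate_def rate_le_iff_limsup rate_ge_iff_liminf
    by (simp add: lim_imp_Limsup lim_imp_Liminf)
qed

text \<open>Increments of negative rate are dominated by a geometric series; its tail is a constant
  times its first term, so the distance to the limit keeps the rate of the increments.\<close>

lemma rate_le_convergent:
  fixes c :: "nat \<Rightarrow> real"
  assumes "rate_le (\<lambda>n. \<bar>c (Suc n) - c n\<bar>) \<kappa>" "\<kappa> < 0"
  obtains l where "rate_le (\<lambda>n. \<bar>c n - l\<bar>) \<kappa>"
proof -
  obtain r0 where r0: "\<kappa> < ereal r0" "r0 < 0" using ereal_real_between assms(2)
    by (metis zero_ereal_def)
  have tail: "\<forall>\<^sub>F n in sequentially. \<forall>m\<ge>n. \<bar>c m - c n\<bar> \<le> exp (r * real n) / (1 - exp r)"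
    if r: "\<kappa> < ereal r" "r < 0" for r
  proof -
    obtain N where N: "\<And>n. n \<ge> N \<Longrightarrow> \<bar>c (Suc n) - c n\<bar> \<le> exp (r * real n)"
      using rate_leD[OF assms(1) r(1)] by (auto simp: eventually_sequentially)
    have e1: "exp r < 1" using r by simp
    have "\<bar>c (n + k) - c n\<bar> \<le> exp (r * real n) * (1 - exp r ^ k) / (1 - exp r)" if n: "n \<ge> N" for n k
    proof (induction k)
      case (Suc k)
      have "\<bar>c (n + Suc k) - c n\<bar> \<le> \<bar>c (Suc (n + k)) - c (n + k)\<bar> + \<bar>c (n + k) - c n\<bar>" by simp
      also have "\<dots> \<le> exp (r * real (n + k)) + exp (r * real n) * (1 - exp r ^ k) / (1 - exp r)"
        using N[of "n + k"] n Suc by simp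
      also have "exp (r * real (n + k)) = exp (r * real n) * exp r ^ k"
        by (simp add: exp_add exp_of_nat_mult algebra_simps flip: exp_of_nat2_mult)
      also have "exp (r * real n) * exp r ^ k + exp (r * real n) * (1 - exp r ^ k) / (1 - exp r)
         = exp (r * real n) * (1 - exp r ^ Suc k) / (1 - exp r)"
        using e1 by (simp add: field_simps)
      finally show ?case .
    qed simp
    then have "\<bar>c (n + k) - c n\<bar> \<le> exp (r * real n) / (1 - exp r)" if n: "n \<ge> N" for n k
    proof -
      have "exp (r * real n) * (1 - exp r ^ k) / (1 - exp r) \<le> exp (r * real n) / (1 - exp r)"
        using e1 by (intro divide_right_mono) (auto simp: algebra_simps)
      then show ?thesis using \<open>\<And>n k. N \<le> n \<Longrightarrow> \<bar>c (n + k) - c n\<bar> \<le> _ * _ / _\<close>[OF n, of k] by linarith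
    qed
    then show ?thesis
      unfolding eventually_sequentially by (metis le_Suc_ex)
  qed
  have "Cauchy c"
    unfolding Cauchy_altdef
  proof (intro allI impI)
    fix e :: real assume "e > 0"
    have "(\<lambda>n. exp (r0 * real n) / (1 - exp r0)) \<longlonglongrightarrow> 0 / (1 - exp r0)"
    proof (intro tendsto_intros)
      show "(\<lambda>n. exp (r0 * real n)) \<longlonglongrightarrow> 0"
        using LIMSEQ_power_zero[of "exp r0"] r0 by (simp add: mult.commute flip: exp_of_nat_mult)
    qed (use r0 in auto)
    then have "\<forall>\<^sub>F n in sequentially. exp (r0 * real n) / (1 - exp r0) < e"
      using \<open>e > 0\<close> by (intro order_tendstoD) auto
    with tail[OF r0] have "\<forall>\<^sub>F n in sequentially. \<forall>m\<ge>n. \<bar>c m - c n\<bar> < e"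
      by eventually_elim force
    then obtain N where "\<forall>n\<ge>N. \<forall>m\<ge>n. \<bar>c m - c n\<bar> < e" by (auto simp: eventually_sequentially)
    then show "\<exists>M. \<forall>m\<ge>M. \<forall>n>m. dist (c m) (c n) < e"
      by (metis dist_commute dist_real_def less_imp_le)
  qed
  then obtain l where l: "c \<longlonglongrightarrow> l" using Cauchy_convergent_iff convergent_def by blast
  have "rate_le (\<lambda>n. \<bar>c n - l\<bar>) \<kappa>"
    unfolding rate_le_def
  proof (intro allI impI)
    fix r assume "\<kappa> < ereal r"
    \<comment> \<open>The given \<open>r\<close> may be nonnegative; the minimum with
      \<open>r0\<close> forces a negative exponent, for which the geometric tail bound is
      available.\<close>
    then have "\<kappa> < ereal (min r r0)" using r0 by (simp add: min_def)
    then obtain s where s: "\<kappa> < ereal s" "s < min r r0" by (rule ereal_real_between)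
    have "s < 0" using s r0 by simp
    from tail[OF s(1) this] eventually_const_exp_le[of s r "1 / (1 - exp s)"] s
    have "\<forall>\<^sub>F n in sequentially. (\<forall>m\<ge>n. \<bar>c m - c n\<bar> \<le> exp (s * real n) / (1 - exp s))
        \<and> 1 / (1 - exp s) * exp (s * real n) \<le> exp (r * real n)"
      by (intro eventually_conj) auto
    then show "\<forall>\<^sub>F n in sequentially. \<bar>c n - l\<bar> \<le> exp (r * real n)"
    proof eventually_elim
      case (elim n)
      have "(\<lambda>m. \<bar>c m - c n\<bar>) \<longlonglongrightarrow> \<bar>l - c n\<bar>" by (intro tendsto_intros l)
      moreover have "\<forall>\<^sub>F m in sequentially. \<bar>c m - c n\<bar> \<le> exp (s * real n) / (1 - exp s)"
        using elim by (auto simp: eventually_sequentially)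
      ultimately have "\<bar>l - c n\<bar> \<le> exp (s * real n) / (1 - exp s)"
        by (intro tendsto_upperbound) auto
      then show ?case using elim by (simp add: abs_minus_commute)
    qed
  qed
  then show ?thesis using that by blast
qed

section \<open>The subadditive ergodic theorem\<close>

text \<open>The full space makes invariance of a set a plain equation with its preimage. Ergodicity
  is asked for strictly invariant sets only, so invariance up to null sets has to be repaired where
  it occurs.\<close>

locale ergodic_system = prob_space P for P :: "'s measure" +
  fixes T :: "'s \<Rightarrow> 's"
  assumes space_UNIV: "space P = UNIV"
    and T_measurable [measurable]: "T \<in> measurable P P"
    and distr_T: "distr P P T = P"
    and ergodic: "\<And>B. B \<in> sets P \<Longrightarrow> T -` B = B \<Longrightarrow> prob B = 0 \<or> prob B = 1"
begin

lemma measurable_funpow_T [measurable]: "(T ^^ n) \<in> measurable P P"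
proof (induction n)
  case (Suc n)
  then show ?case using measurable_comp[OF Suc T_measurable] by simp
qed (auto simp: id_def)

lemma distr_funpow: "distr P P (T ^^ n) = P"
proof (induction n)
  case 0
  then show ?case by (simp add: id_def distr_id)
next
  case (Suc n)
  have "distr P P (T ^^ Suc n) = distr (distr P P (T ^^ n)) P T"
    by (subst distr_distr) auto
  then show ?case using Suc distr_T by (simp add: comp_def)
qed

lemma integrable_funpow:
  fixes h :: "'s \<Rightarrow> real"
  shows "integrable P h \<Longrightarrow> integrable P (\<lambda>s. h ((T ^^ n) s))"
  using integrable_distr[OF measurable_funpow_T[of n], of h] by (simp add: distr_funpow)

lemma expectation_funpow:
  fixes h :: "'s \<Rightarrow> real"
  shows "h \<in> borel_measurable P \<Longrightarrow> expectation (\<lambda>s. h ((T ^^ n) s)) = expectation h"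
  using integral_distr[OF measurable_funpow_T[of n], of h] by (simp add: distr_funpow)

text \<open>A superlevel set is contained in its preimage and has the same probability; the union of
  all its iterated preimages is strictly invariant and no more probable. One inequality for
  \<open>g\<close> is thus enough, and it is all that follows directly for limsups and
  liminfs.\<close>

lemma subinvariant_const:
  fixes g :: "'s \<Rightarrow> ereal"
  assumes g [measurable]: "g \<in> borel_measurable P" and le: "\<And>s. g s \<le> g (T s)"
  obtains c where "AE s in P. g s = c"
proof -
  have dich: "(AE s in P. t < g s) \<or> (AE s in P. \<not> t < g s)" for t
  proof -
    define C where "C = {s. t < g s}"
    have C: "C \<in> sets P"
    proof -
      have "{s \<in> space P. t < g s} \<in> sets P" by measurable
      then show ?thesis by (simp add: C_def space_UNIV)
    qed
    have Cn: "(T ^^ n) -` C \<in> sets P" for n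
      using measurable_sets[OF measurable_funpow_T C, of n] by (simp add: space_UNIV)
    have pn: "prob ((T ^^ n) -` C) = prob C" for n
    proof -
      have "prob C = measure (distr P P (T ^^ n)) C" by (simp add: distr_funpow)
      also have "\<dots> = prob ((T ^^ n) -` C)"
        by (subst measure_distr) (auto simp: C space_UNIV)
      finally show ?thesis by simp
    qed
    have sub: "(T ^^ n) -` C \<subseteq> (T ^^ Suc n) -` C" for n
      using le by (auto simp: C_def intro: order_less_le_trans)
    define B where "B = (\<Union>n. (T ^^ n) -` C)"
    have B: "B \<in> sets P" using Cn by (auto simp: B_def)
    have "T -` B = (\<Union>n. (T ^^ Suc n) -` C)"
      by (auto simp: B_def funpow_swap1)
    also have "\<dots> = B"
      unfolding B_def
    proof (intro equalityI UN_least)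
      fix n
      show "(T ^^ Suc n) -` C \<subseteq> (\<Union>n. (T ^^ n) -` C)" by (rule UN_upper) simp
      show "(T ^^ n) -` C \<subseteq> (\<Union>n. (T ^^ Suc n) -` C)"
        using sub[of n] by (rule order_trans) (rule UN_upper, simp)
    qed
    finally have inv: "T -` B = B" .
    have inc: "incseq (\<lambda>n. (T ^^ n) -` C)" using sub by (rule incseq_SucI)
    have "(\<lambda>n. prob ((T ^^ n) -` C)) \<longlonglongrightarrow> prob B"
      unfolding B_def using Cn inc by (intro finite_Lim_measure_incseq) auto
    then have "prob B = prob C" unfolding pn using LIMSEQ_unique by blast
    with ergodic[OF B inv] show ?thesis
      using prob_eq_0[OF C] prob_eq_1[OF C] by (auto simp: C_def)
  qed
  \<comment> \<open>Rational levels locate the value with a single null set. If no level is exceeded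
    almost surely, the supremum is \<open>-\<infinity>\<close>, which is then the value of
    \<open>g\<close>.\<close>
  define c where "c = Sup {ereal q | q. q \<in> \<rat> \<and> (AE s in P. ereal q < g s)}"
  have "AE s in P. \<forall>q\<in>\<rat>. if (AE s in P. ereal q < g s) then ereal q < g s else \<not> ereal q < g s"
    using dich by (subst AE_ball_countable) (auto simp: countable_rat)
  then have "AE s in P. g s = c"
  proof eventually_elim
    case (elim s)
    show ?case
    proof (rule antisym)
      show "c \<le> g s"
        unfolding c_def using elim by (intro Sup_least) (force intro: less_imp_le)
      show "g s \<le> c"
      proof (rule ccontr)
        assume "\<not> g s \<le> c"
        then obtain q where q: "c < ereal (real_of_rat q)" "ereal (real_of_rat q) < g s"
          using ereal_dense3[of c "g s"] by (auto simp: not_le)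
        then have "AE s in P. ereal (real_of_rat q) < g s" using elim by (metis Rats_of_rat)
        then have "ereal (real_of_rat q) \<le> c"
          unfolding c_def by (intro Sup_upper) auto
        with q show False by auto
      qed
    qed
  qed
  then show ?thesis using that by blast
qed

end

section \<open>Deterministic estimates for submultiplicative arrays, indexed by starting time and
  length\<close>

lemma submultiplicative_le_exp_sum:
  fixes u :: "nat \<Rightarrow> nat \<Rightarrow> real"
  assumes sub: "\<And>k m n. u k (m + n) \<le> u k m * u (k + m) n"
    and nonneg: "\<And>k n. 0 \<le> u k n" and u0: "\<And>k. u k 0 \<le> 1"
    and one: "\<And>k. u k 1 \<le> exp (h k)"
  shows "u k n \<le> exp (\<Sum>j=k..<k+n. h j)"
proof (induction n)
  case (Suc n)
  have "u k (Suc n) \<le> u k n * u (k + n) 1" using sub[of k n 1] by simp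
  also have "\<dots> \<le> exp (\<Sum>j=k..<k+n. h j) * exp (h (k + n))"
    using Suc one nonneg by (intro mult_mono) auto
  finally show ?case by (simp add: exp_add)
qed (use u0 in simp)

text \<open>Cut \<open>[k, k + n)\<close> greedily into good blocks of length at most \<open>N\<close>; single steps are taken only
  at the bad times and in the last incomplete block.\<close>

lemma submultiplicative_block_bound:
  fixes u :: "nat \<Rightarrow> nat \<Rightarrow> real"
  assumes sub: "\<And>k m n. u k (m + n) \<le> u k m * u (k + m) n"
    and nonneg: "\<And>k n. 0 \<le> u k n" and u0: "\<And>k. u k 0 \<le> 1"
    and one: "\<And>k. u k 1 \<le> exp (h k)" and h: "\<And>k. 0 \<le> h k"
    and good: "\<And>k. k \<notin> B \<Longrightarrow> \<exists>m. 1 \<le> m \<and> m \<le> N \<and> u k m \<le> exp (c * real m)"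
  shows "u k n \<le> exp (c * real n + (\<Sum>j=k..<k+n. if j \<in> B then h j + \<bar>c\<bar> else 0)
            + (\<Sum>j | k \<le> j \<and> j < k + n \<and> k + n \<le> j + N. h j + \<bar>c\<bar>))"
proof (induction n arbitrary: k rule: less_induct)
  case (less n)
  define b where "b j = (if j \<in> B then h j + \<bar>c\<bar> else 0)" for j
  define L where "L k n = {j. k \<le> j \<and> j < k + n \<and> k + n \<le> j + N}" for k n
  have b0: "0 \<le> b j" for j using h by (auto simp: b_def)
  have finL: "finite (L k n)" for k n by (rule finite_subset[of _ "{..<k+n}"]) (auto simp: L_def)
  have hc: "0 \<le> h j + \<bar>c\<bar>" for j using h[of j] by simp
  have step: "u k n \<le> exp (c * real n + sum b {k..<k+n} + (\<Sum>j\<in>L k n. h j + \<bar>c\<bar>))"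
    if m: "1 \<le> m" "m \<le> n" "u k m \<le> exp (c * real m + sum b {k..<k+m})" for m
  proof -
    have "u k n \<le> u k m * u (k + m) (n - m)" using sub[of k m "n - m"] m by simp
    also have "\<dots> \<le> exp (c * real m + sum b {k..<k+m}) *
       exp (c * real (n - m) + sum b {k+m..<k+m+(n-m)} + (\<Sum>j\<in>L (k+m) (n-m). h j + \<bar>c\<bar>))"
      using less.IH[of "n - m" "k + m"] m nonneg
      by (intro mult_mono) (auto simp: L_def b_def)
    also have "\<dots> = exp (c * real n + sum b {k..<k+n} + (\<Sum>j\<in>L (k+m) (n-m). h j + \<bar>c\<bar>))"
    proof -
      have "sum b {k..<k+n} = sum b {k..<k+m} + sum b {k+m..<k+n}"
        using m by (subst sum.atLeastLessThan_concat) auto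
      moreover have "c * real n = c * real m + c * real (n - m)" using m by (simp add: of_nat_diff algebra_simps)
      ultimately show ?thesis using m by (simp flip: exp_add)
    qed
    also have "\<dots> \<le> exp (c * real n + sum b {k..<k+n} + (\<Sum>j\<in>L k n. h j + \<bar>c\<bar>))"
    proof -
      have "(\<Sum>j\<in>L (k+m) (n-m). h j + \<bar>c\<bar>) \<le> (\<Sum>j\<in>L k n. h j + \<bar>c\<bar>)"
        using m finL hc by (intro sum_mono2) (auto simp: L_def)
      then show ?thesis by simp
    qed
    finally show ?thesis .
  qed
  have "u k n \<le> exp (c * real n + sum b {k..<k+n} + (\<Sum>j\<in>L k n. h j + \<bar>c\<bar>))"
  proof (cases "n = 0")
    case True
    moreover have "L k 0 = {}" by (auto simp: L_def)
    ultimately show ?thesis using u0[of k] by simp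
  next
    case n: False
    show ?thesis
    proof (cases "k \<in> B")
      case True
      \<comment> \<open>The main term charges \<open>c\<close> for every time, good or bad; the
        extra \<open>\<bar>c\<bar>\<close> at a bad time compensates for a negative
        \<open>c\<close>.\<close>
      have "h k \<le> c + (h k + \<bar>c\<bar>)" by simp
      then have "u k 1 \<le> exp (c * real 1 + sum b {k..<k+1})"
        using one[of k] True by (auto simp: b_def intro: order_trans)
      then show ?thesis using n by (intro step[of 1]) auto
    next
      case False
      then obtain m where m: "1 \<le> m" "m \<le> N" "u k m \<le> exp (c * real m)" using good by blast
      show ?thesis
      proof (cases "m \<le> n")
        case True
        have "0 \<le> sum b {k..<k+m}" using b0 by (intro sum_nonneg) auto
        then have "u k m \<le> exp (c * real m + sum b {k..<k+m})"
          using m(3) by (auto intro: order_trans)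
        then show ?thesis using m True by (intro step[of m]) auto
      next
        case False
        \<comment> \<open>A good block that no longer fits is longer than what remains, so all
          remaining times are among the last \<open>N\<close> and may be paid for singly.\<close>
        have Lkn: "L k n = {k..<k+n}" using False m by (auto simp: L_def)
        have "u k n \<le> exp (\<Sum>j=k..<k+n. h j)"
          using sub nonneg u0 one by (rule submultiplicative_le_exp_sum)
        also have "\<dots> \<le> exp (c * real n + sum b {k..<k+n} + (\<Sum>j\<in>L k n. h j + \<bar>c\<bar>))"
        proof -
          have "0 \<le> sum b {k..<k+n}" using b0 by (intro sum_nonneg) auto
          moreover have "(\<Sum>j\<in>L k n. h j + \<bar>c\<bar>) = (\<Sum>j=k..<k+n. h j) + \<bar>c\<bar> * real n"
            by (simp add: Lkn sum.distrib)
          moreover have "0 \<le> (c + \<bar>c\<bar>) * real n" by (intro mult_nonneg_nonneg) auto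
          ultimately show ?thesis by (simp add: algebra_simps)
        qed
        finally show ?thesis .
      qed
    qed
  qed
  then show ?case by (simp add: b_def L_def)
qed


context ergodic_system
begin

text \<open>If the almost sure limsup of the averages were at least \<open>r\<close>, almost every
  point would soon begin a block of average at least \<open>r' < r\<close>. Cutting orbits into such
  blocks bounds the sums from below by nearly \<open>r' * n\<close>, and integration contradicts
  \<open>expectation h < r'\<close>.\<close>

lemma birkhoff_upper:
  assumes [measurable]: "integrable P h" and h: "\<And>s. 0 \<le> h s" and r: "expectation h < r"
  shows "AE s in P. \<forall>\<^sub>F n in sequentially. (\<Sum>k<n. h ((T ^^ k) s)) \<le> r * real n"
proof -
  have hm [measurable]: "h \<in> borel_measurable P" using assms by auto
  define S where "S n s = (\<Sum>k<n. h ((T ^^ k) s))" for n s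
  have Sm [measurable]: "S n \<in> borel_measurable P" for n
    unfolding S_def by measurable
  have S_Suc: "S (Suc n) s = h s + S n (T s)" for n s
    unfolding S_def by (subst sum.lessThan_Suc_shift) (simp add: funpow_swap1)
  have S0: "0 \<le> S n s" for n s unfolding S_def by (intro sum_nonneg h)
  define g where "g s = limsup (\<lambda>n. ereal (S n s / real n))" for s
  have gm: "g \<in> borel_measurable P" unfolding g_def by measurable
  have "g s \<le> g (T s)" for s
  proof -
    have "(\<lambda>n. ereal (h s / real (Suc n))) \<longlonglongrightarrow> 0"
      unfolding zero_ereal_def
      by (intro tendsto_ereal LIMSEQ_Suc[of "\<lambda>n. h s / real n"] lim_const_over_n)
    then have "limsup (\<lambda>n. ereal (h s / real (Suc n)) + ereal (S n (T s) / real n)) = 0 + g (T s)"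
      unfolding g_def by (intro ereal_limsup_lim_add) auto
    moreover have "g s = limsup (\<lambda>n. ereal (S (Suc n) s / real (Suc n)))"
      unfolding g_def using limsup_shift[of "\<lambda>n. ereal (S n s / real n)"] by simp
    moreover have "limsup (\<lambda>n. ereal (S (Suc n) s / real (Suc n)))
        \<le> limsup (\<lambda>n. ereal (h s / real (Suc n)) + ereal (S n (T s) / real n))"
    proof (rule Limsup_mono)
      show "\<forall>\<^sub>F n in sequentially. ereal (S (Suc n) s / real (Suc n))
          \<le> ereal (h s / real (Suc n)) + ereal (S n (T s) / real n)"
        using eventually_gt_at_top[of 0]
      proof eventually_elim
        case (elim n)
        have "S n (T s) / real (Suc n) \<le> S n (T s) / real n"
          using elim S0 by (intro divide_left_mono) auto
        then show ?case by (simp only: S_Suc plus_ereal.simps ereal_less_eq add_divide_distrib)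
      qed
    qed
    ultimately show ?thesis by simp
  qed
  with gm obtain c where c: "AE s in P. g s = c" using subinvariant_const by blast
  show ?thesis
  proof (cases "c < ereal r")
    case True
    from c show ?thesis
    proof eventually_elim
      case (elim s)
      then have "\<forall>\<^sub>F n in sequentially. ereal (S n s / real n) < ereal r"
        using True unfolding g_def by (intro Limsup_lessD) auto
      with eventually_gt_at_top[of 0] show ?case
        by eventually_elim (simp add: S_def field_simps)
    qed
  next
    case False
    obtain r' where r': "expectation h < r'" "r' < r" using r dense by blast
    have "0 \<le> expectation h" using h by (intro integral_nonneg_AE) auto
    then have r'0: "0 < r'" using r' by simp
    define BN where "BN N = {s. \<forall>m\<in>{1..N}. S m s < r' * real m}" for N
    have BNm [measurable]: "BN N \<in> sets P" for N
    proof -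
      have "{s \<in> space P. \<forall>m\<in>{1..N}. S m s < r' * real m} \<in> sets P" by measurable
      then show ?thesis by (simp add: BN_def space_UNIV)
    qed
    have "AE s in P. s \<notin> (\<Inter>N. BN N)"
      using c
    proof eventually_elim
      case (elim s)
      have "ereal r' < limsup (\<lambda>n. ereal (S n s / real n))"
        using elim False r' order_less_le_trans[of "ereal r'" "ereal r" c]
        unfolding g_def by (auto simp: not_less)
      then have "\<not> (\<forall>\<^sub>F n in sequentially. ereal (S n s / real n) \<le> ereal r')"
        using Limsup_bounded by (metis leD)
      then obtain n where "n \<ge> 1" "r' < S n s / real n"
        by (auto simp: eventually_sequentially not_le)
      then have "s \<notin> BN n" by (auto simp: BN_def field_simps intro!: bexI[of _ n])
      then show ?case by blast
    qed
    then have "prob (\<Inter>N. BN N) = 0"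
      by (subst prob_eq_0) auto
    moreover have "decseq BN" by (auto simp: decseq_def BN_def)
    then have "(\<lambda>N. prob (BN N)) \<longlonglongrightarrow> prob (\<Inter>N. BN N)"
      using BNm by (intro finite_Lim_measure_decseq) auto
    ultimately have "(\<lambda>N. r' * prob (BN N)) \<longlonglongrightarrow> r' * 0" by (intro tendsto_intros) simp
    then have "\<forall>\<^sub>F N in sequentially. r' * prob (BN N) < r' - expectation h"
      using r' by (intro order_tendstoD) auto
    then obtain N where N: "r' * prob (BN N) < r' - expectation h"
      by (auto simp: eventually_sequentially)
    have lower: "r' * real n - r' * (\<Sum>k<n. indicator (BN N) ((T ^^ k) s)) - real N * r' \<le> S n s" for n s
    proof -
      define u where "u k n = exp (- (\<Sum>j=k..<k+n. h ((T ^^ j) s)))" for k n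
      \<comment> \<open>Negated sums turn the upper block bound into a lower one: the rate is
        \<open>- r'\<close> and single steps cost \<open>0\<close>. Hence a bad time, or one of the
        last \<open>N\<close> times, loses only \<open>r'\<close>.\<close>
      have "u 0 n \<le> exp (- r' * real n + (\<Sum>j=0..<0+n. if j \<in> {k. (T ^^ k) s \<in> BN N} then 0 + \<bar>- r'\<bar> else 0)
            + (\<Sum>j | 0 \<le> j \<and> j < 0 + n \<and> 0 + n \<le> j + N. 0 + \<bar>- r'\<bar>))"
      proof (rule submultiplicative_block_bound)
        show "u k (m + n) \<le> u k m * u (k + m) n" for k m n
          using sum.atLeastLessThan_concat[of k "k+m" "k+m+n" "\<lambda>j. h ((T ^^ j) s)"]
          by (simp add: u_def add.assoc flip: exp_add)
        show "u k 1 \<le> exp 0" for k by (simp add: u_def h)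
        fix k assume "k \<notin> {k. (T ^^ k) s \<in> BN N}"
        then obtain m where m: "m \<in> {1..N}" "r' * real m \<le> S m ((T ^^ k) s)"
          by (auto simp: BN_def not_less)
        have "S m ((T ^^ k) s) = (\<Sum>j=k..<k+m. h ((T ^^ j) s))"
          unfolding S_def by (rule sum.reindex_bij_witness[of _ "\<lambda>j. j - k" "\<lambda>j. j + k"])
            (auto simp: funpow_add)
        then have "u k m \<le> exp (- r' * real m)" using m by (simp add: u_def)
        then show "\<exists>m. 1 \<le> m \<and> m \<le> N \<and> u k m \<le> exp (- r' * real m)" using m by auto
      qed (auto simp: u_def)
      moreover have "(\<Sum>j | 0 \<le> j \<and> j < 0 + n \<and> 0 + n \<le> j + N. 0 + \<bar>- r'\<bar>) \<le> real N * r'"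
      proof -
        have "card {j. j < n \<and> n \<le> j + N} \<le> card {n - N..<n}" by (intro card_mono) auto
        then have "card {j. j < n \<and> n \<le> j + N} \<le> N" by simp
        then show ?thesis using r'0 by (simp add: mult_right_mono)
      qed
      moreover have "(\<Sum>j=0..<0+n. if j \<in> {k. (T ^^ k) s \<in> BN N} then 0 + \<bar>- r'\<bar> else 0)
          = r' * (\<Sum>k<n. indicator (BN N) ((T ^^ k) s))"
        unfolding sum_distrib_left lessThan_atLeast0 add_0
        using r'0 by (intro sum.cong) (auto simp: indicator_def)
      moreover have "u 0 n = exp (- S n s)" by (simp add: u_def S_def lessThan_atLeast0)
      ultimately show ?thesis by simp
    qed
    have bnd: "(r' - expectation h - r' * prob (BN N)) * real n \<le> real N * r'" for n
    proof -
      have i0: "integrable P (indicator (BN N) :: _ \<Rightarrow> real)"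
        by (rule integrable_const_bound[of _ 1]) auto
      have i1: "integrable P (\<lambda>s. \<Sum>k<n. indicator (BN N) ((T ^^ k) s) :: real)"
        by (intro Bochner_Integration.integrable_sum integrable_funpow i0)
      have i2: "integrable P (S n)"
        unfolding S_def by (intro Bochner_Integration.integrable_sum integrable_funpow assms)
      have "expectation (\<lambda>s. r' * real n - r' * (\<Sum>k<n. indicator (BN N) ((T ^^ k) s)) - real N * r')
          \<le> expectation (S n)"
        using lower i1 i2 by (intro integral_mono) auto
      also have "expectation (S n) = real n * expectation h"
        unfolding S_def
        by (subst Bochner_Integration.integral_sum) (auto simp: expectation_funpow intro!: integrable_funpow assms)
      also have "expectation (\<lambda>s. r' * real n - r' * (\<Sum>k<n. indicator (BN N) ((T ^^ k) s)) - real N * r')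
         = r' * real n - r' * expectation (\<lambda>s. \<Sum>k<n. indicator (BN N) ((T ^^ k) s)) - real N * r'"
        using i1 by (simp add: prob_space)
      also have "expectation (\<lambda>s. \<Sum>k<n. indicator (BN N) ((T ^^ k) s)) = real n * prob (BN N)"
        by (subst Bochner_Integration.integral_sum)
          (rule integrable_funpow[OF i0], simp add: expectation_funpow space_UNIV)
      finally show ?thesis by (simp add: algebra_simps)
    qed
    have "0 < r' - expectation h - r' * prob (BN N)" using N by simp
    then obtain n where "real N * r' < real n * (r' - expectation h - r' * prob (BN N))"
      using reals_Archimedean3 by blast
    with bnd[of n] have False by (simp only: mult.commute[of "real n"] not_less[symmetric])
    then show ?thesis ..
  qed
qed

text \<open>Above a high truncation level the remaining part of \<open>h\<close> has expectation
  below \<open>e / 2\<close>. A single term is at most the whole sum of that part plus the level, so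
  the bound for averages applies.\<close>

lemma funpow_sublinear:
  assumes "integrable P h" and h: "\<And>s. 0 \<le> h s" and e: "0 < e"
  shows "AE s in P. \<forall>\<^sub>F n in sequentially. h ((T ^^ n) s) \<le> e * real n"
proof -
  have hm [measurable]: "h \<in> borel_measurable P" using assms by auto
  define H where "H K s = (if real K < h s then h s else 0)" for K s
  have Hm [measurable]: "H K \<in> borel_measurable P" for K unfolding H_def by measurable
  have H0: "0 \<le> H K s" for K s using h by (simp add: H_def)
  have Hi: "integrable P (H K)" for K
    by (rule Bochner_Integration.integrable_bound[OF assms(1)]) (auto simp: H_def h)
  have "(\<lambda>K. expectation (H K)) \<longlonglongrightarrow> expectation (\<lambda>_. 0)"
  proof (rule integral_dominated_convergence[OF _ _ assms(1)])
    show "AE s in P. (\<lambda>K. H K s) \<longlonglongrightarrow> 0"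
    proof (rule AE_I2)
      fix s
      obtain K0 where "h s \<le> real K0" using real_arch_simple by blast
      then have "\<forall>\<^sub>F K in sequentially. H K s = 0"
        by (auto simp: H_def eventually_sequentially intro!: exI[of _ K0])
      then show "(\<lambda>K. H K s) \<longlonglongrightarrow> 0" by (rule tendsto_eventually)
    qed
  qed (auto simp: H_def h)
  then have "\<forall>\<^sub>F K in sequentially. expectation (H K) < e / 2"
    using e by (intro order_tendstoD) auto
  then obtain K where K: "expectation (H K) < e / 2" by (auto simp: eventually_sequentially)
  have "AE s in P. \<forall>\<^sub>F n in sequentially. (\<Sum>k<n. H K ((T ^^ k) s)) \<le> e / 2 * real n"
    using Hi H0 K by (rule birkhoff_upper)
  then show ?thesis
  proof eventually_elim
    case (elim s)
    have "\<forall>\<^sub>F n in sequentially. (real K + e / 2) / (e / 2) \<le> real n"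
      using filterlim_real_sequentially unfolding filterlim_at_top by blast
    with elim[THEN eventually_sequentially_Suc[THEN iffD2]] show ?case
    proof eventually_elim
      case (elim n)
      have "h ((T ^^ n) s) \<le> real K + H K ((T ^^ n) s)" using h by (auto simp: H_def)
      also have "H K ((T ^^ n) s) \<le> (\<Sum>k<Suc n. H K ((T ^^ k) s))"
        by (intro member_le_sum) (auto simp: H_def h)
      also note elim(1)
      finally have le: "h ((T ^^ n) s) \<le> real K + e / 2 * real (Suc n)" by simp
      have eq: "e / 2 * real (Suc n) = e / 2 * real n + e / 2"
        by (simp add: algebra_simps)
      have "real K + e / 2 \<le> e / 2 * real n"
        using elim(2) e by (simp only: pos_divide_le_eq[OF half_gt_zero] mult.commute)
      with le eq show ?case by linarith
    qed
  qed
qed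

text \<open>The liminf cannot decrease along the orbit, because one step costs at most the factor
  \<open>exp (h s)\<close>; hence it is almost surely constant. Blocks that nearly attain it are
  then concatenated: the cost of bad times is small on average, and the last incomplete block is
  controlled by sublinearity of \<open>h\<close> along the orbit.\<close>

lemma kingman:
  assumes um [measurable]: "\<And>n. u n \<in> borel_measurable P"
    and nonneg: "\<And>n s. 0 \<le> u n s"
    and sub: "\<And>m n s. u (m + n) s \<le> u m s * u n ((T ^^ m) s)"
    and u0: "\<And>s. u 0 s \<le> (1::real)" and u1: "\<And>s. u 1 s \<le> exp (h s)"
    and hi: "integrable P h" and h: "\<And>s. 0 \<le> h s"
  obtains \<gamma> where "\<gamma> < \<infinity>" "AE s in P. has_rate (\<lambda>n. u n s) \<gamma>"
proof -
  have hm [measurable]: "h \<in> borel_measurable P" using hi by auto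
  have sub': "u (m + n) ((T ^^ k) s) \<le> u m ((T ^^ k) s) * u n ((T ^^ (k + m)) s)" for k m n s
    using sub[of m n "(T ^^ k) s"] by (metis add.commute comp_apply funpow_add)
  define g where "g s = liminf (\<lambda>n. ereal (1 / real n) * elog (u n s))" for s
  have [measurable]: "(\<lambda>s. elog (u n s)) \<in> borel_measurable P" for n
    unfolding elog_def by measurable
  have gm: "g \<in> borel_measurable P" unfolding g_def by measurable
  have "g s \<le> g (T s)" for s
  proof -
    have "rate_ge (\<lambda>n. u n s) (g s)" by (simp add: rate_ge_iff_liminf g_def)
    then have "rate_ge (\<lambda>n. exp (- h s) * u (Suc n) s) (g s)"
      by (intro rate_ge_cmult rate_ge_Suc) auto
    then have "rate_ge (\<lambda>n. u n (T s)) (g s)"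
    proof (rule rate_ge_mono)
      show "\<forall>\<^sub>F n in sequentially. exp (- h s) * u (Suc n) s \<le> u n (T s)"
      proof (rule always_eventually, rule allI)
        fix n
        have "u (Suc n) s \<le> u 1 s * u n (T s)" using sub[of 1 n s] by simp
        also have "\<dots> \<le> exp (h s) * u n (T s)" by (intro mult_right_mono u1 nonneg)
        finally show "exp (- h s) * u (Suc n) s \<le> u n (T s)" by (simp add: exp_minus field_simps)
      qed
    qed simp
    then show ?thesis by (simp add: rate_ge_iff_liminf g_def)
  qed
  with gm obtain c where c: "AE s in P. g s = c" using subinvariant_const by blast
  have ge: "AE s in P. rate_ge (\<lambda>n. u n s) c"
    using c by eventually_elim (simp add: rate_ge_iff_liminf g_def)
  have cfin: "c < \<infinity>"
  proof -
    have "AE s in P. \<forall>\<^sub>F n in sequentially. (\<Sum>k<n. h ((T ^^ k) s)) \<le> (expectation h + 1) * real n"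
      using hi h by (intro birkhoff_upper) auto
    with ge have "AE s in P. c \<le> ereal (expectation h + 1)"
    proof eventually_elim
      case (elim s)
      have "rate_le (\<lambda>n. u n s) (ereal (expectation h + 1))"
        unfolding rate_le_def
      proof (intro allI impI)
        fix r assume r: "ereal (expectation h + 1) < ereal r"
        from elim(2) show "\<forall>\<^sub>F n in sequentially. u n s \<le> exp (r * real n)"
        proof eventually_elim
          case (elim n)
          have "u n ((T ^^ 0) s) \<le> exp (\<Sum>j=0..<0+n. h ((T ^^ j) s))"
            by (rule submultiplicative_le_exp_sum[of "\<lambda>k n. u n ((T ^^ k) s)"])
              (use sub' nonneg u0 u1 in auto)
          also have "\<dots> \<le> exp ((expectation h + 1) * real n)"
            using elim by (simp add: lessThan_atLeast0)
          also have "\<dots> \<le> exp (r * real n)" using r by (simp add: mult_right_mono)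
          finally show ?case by simp
        qed
      qed
      then show ?case using elim(1) rate_ge_le by blast
    qed
    then have "c \<le> ereal (expectation h + 1)" by (simp add: AE_const)
    then show ?thesis by (rule order_le_less_trans) simp
  qed
  have upper: "AE s in P. \<forall>\<^sub>F n in sequentially. u n s \<le> exp (r * real n)" if r: "c < ereal r" for r
  proof -
    obtain r' where r': "c < ereal r'" "r' < r" using r by (rule ereal_real_between)
    define BN where "BN N = {s. \<forall>m\<in>{1..N}. exp (r' * real m) < u m s}" for N
    have BNm [measurable]: "BN N \<in> sets P" for N
    proof -
      have "{s \<in> space P. \<forall>m\<in>{1..N}. exp (r' * real m) < u m s} \<in> sets P" by measurable
      then show ?thesis by (simp add: BN_def space_UNIV)
    qed
    define H where "H N s = indicator (BN N) s * (h s + \<bar>r'\<bar>)" for N s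
    have Hm [measurable]: "H N \<in> borel_measurable P" for N unfolding H_def by measurable
    have H0: "0 \<le> H N s" for N s using h by (simp add: H_def)
    have hr: "integrable P (\<lambda>s. h s + \<bar>r'\<bar>)" using hi by auto
    have Hi: "integrable P (H N)" for N
      by (rule Bochner_Integration.integrable_bound[OF hr]) (auto simp: H_def h indicator_def)
    have "(\<lambda>N. expectation (H N)) \<longlonglongrightarrow> expectation (\<lambda>_. 0)"
    proof (rule integral_dominated_convergence[OF _ _ hr])
      show "AE s in P. (\<lambda>N. H N s) \<longlonglongrightarrow> 0"
        using c
      proof eventually_elim
        case (elim s)
        have "\<not> (\<forall>\<^sub>F n in sequentially. ereal r' \<le> ereal (1 / real n) * elog (u n s))"
        proof
          assume "\<forall>\<^sub>F n in sequentially. ereal r' \<le> ereal (1 / real n) * elog (u n s)"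
          then have "ereal r' \<le> g s" unfolding g_def by (rule Liminf_bounded)
          then show False using elim r' by simp
        qed
        then obtain n where n: "n \<ge> 1" "\<not> ereal r' \<le> ereal (1 / real n) * elog (u n s)"
          by (auto simp: eventually_sequentially)
        then have "u n s < exp (r' * real n)" by (subst (asm) elog_ge_iff) auto
        then have "s \<notin> BN N" if "n \<le> N" for N
          using n that by (auto simp: BN_def not_less intro!: bexI[of _ n])
        then have "\<forall>\<^sub>F N in sequentially. H N s = 0"
          by (auto simp: eventually_sequentially H_def intro!: exI[of _ n])
        then show ?case by (rule tendsto_eventually)
      qed
    qed (auto simp: H_def h indicator_def)
    then have "\<forall>\<^sub>F N in sequentially. expectation (H N) < (r - r') / 2"
      using r' by (intro order_tendstoD) auto
    then obtain N where N: "expectation (H N) < (r - r') / 2" by (auto simp: eventually_sequentially)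
    \<comment> \<open>At most \<open>N\<close> times lie in the incomplete block, so together they
      cost at most half of the gap \<open>r - r'\<close>; \<open>N + 1\<close> keeps the denominator
      positive.\<close>
    define e where "e = (r - r') / (2 * real (N + 1))"
    have e: "0 < e" using r' by (simp add: e_def)
    have "AE s in P. \<forall>\<^sub>F n in sequentially. (\<Sum>k<n. H N ((T ^^ k) s)) \<le> (r - r') / 2 * real n"
      using Hi H0 N by (rule birkhoff_upper)
    moreover have "AE s in P. \<forall>\<^sub>F n in sequentially. h ((T ^^ n) s) + \<bar>r'\<bar> \<le> e * real n"
      using hr e h by (intro funpow_sublinear) auto
    ultimately show ?thesis
    proof eventually_elim
      case (elim s)
      obtain n1 where n1: "\<And>n. n \<ge> n1 \<Longrightarrow> h ((T ^^ n) s) + \<bar>r'\<bar> \<le> e * real n"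
        using elim(2) by (auto simp: eventually_sequentially)
      \<comment> \<open>From \<open>n1 + N\<close> on, all of the last \<open>N\<close> times lie
        beyond \<open>n1\<close>.\<close>
      from elim(1) eventually_ge_at_top[of "n1 + N"] show ?case
      proof eventually_elim
        case (elim n)
        define L where "L = {j. 0 \<le> j \<and> j < 0 + n \<and> 0 + n \<le> j + N}"
        have "u n ((T ^^ 0) s) \<le> exp (r' * real n
              + (\<Sum>j=0..<0+n. if j \<in> {k. (T ^^ k) s \<in> BN N} then h ((T ^^ j) s) + \<bar>r'\<bar> else 0)
              + (\<Sum>j\<in>L. h ((T ^^ j) s) + \<bar>r'\<bar>))"
          unfolding L_def
        proof (rule submultiplicative_block_bound[of "\<lambda>k n. u n ((T ^^ k) s)"])
          fix k assume "k \<notin> {k. (T ^^ k) s \<in> BN N}"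
          then show "\<exists>m. 1 \<le> m \<and> m \<le> N \<and> u m ((T ^^ k) s) \<le> exp (r' * real m)"
            by (auto simp: BN_def not_less)
        qed (use sub' nonneg u0 u1 h in auto)
        moreover have "(\<Sum>j=0..<0+n. if j \<in> {k. (T ^^ k) s \<in> BN N} then h ((T ^^ j) s) + \<bar>r'\<bar> else 0)
            \<le> (r - r') / 2 * real n"
        proof -
          have "(\<Sum>j=0..<0+n. if j \<in> {k. (T ^^ k) s \<in> BN N} then h ((T ^^ j) s) + \<bar>r'\<bar> else 0)
            = (\<Sum>k<n. H N ((T ^^ k) s))"
            unfolding H_def lessThan_atLeast0 add_0 by (intro sum.cong) (auto simp: indicator_def)
          with elim show ?thesis by simp
        qed
        moreover have "(\<Sum>j\<in>L. h ((T ^^ j) s) + \<bar>r'\<bar>) \<le> (r - r') / 2 * real n"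
        proof -
          have "(\<Sum>j\<in>L. h ((T ^^ j) s) + \<bar>r'\<bar>) \<le> (\<Sum>j\<in>L. e * real n)"
          proof (rule sum_mono)
            fix j assume "j \<in> L"
            then have "h ((T ^^ j) s) + \<bar>r'\<bar> \<le> e * real j" using elim n1 by (auto simp: L_def)
            also have "\<dots> \<le> e * real n" using e \<open>j \<in> L\<close> by (simp add: L_def)
            finally show "h ((T ^^ j) s) + \<bar>r'\<bar> \<le> e * real n" .
          qed
          also have "\<dots> = real (card L) * (e * real n)" by simp
          also have "\<dots> \<le> real (N + 1) * (e * real n)"
          proof -
            have "card L \<le> card {n - N..<n}" by (intro card_mono) (auto simp: L_def)
            then show ?thesis using e by (intro mult_right_mono) auto
          qed
          also have "\<dots> = (r - r') / 2 * real n" by (simp add: e_def field_simps)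
          finally show ?thesis .
        qed
        ultimately have "u n s \<le> exp (r' * real n + (r - r') / 2 * real n + (r - r') / 2 * real n)"
          by (smt (verit) exp_le_cancel_iff funpow_0)
        then show ?case by (simp add: algebra_simps)
      qed
    qed
  qed
  have "AE s in P. \<forall>q\<in>\<rat>. c < ereal q \<longrightarrow> (\<forall>\<^sub>F n in sequentially. u n s \<le> exp (q * real n))"
    using upper by (subst AE_ball_countable) (auto simp: countable_rat)
  with ge have "AE s in P. has_rate (\<lambda>n. u n s) c"
  proof eventually_elim
    case (elim s)
    have "rate_le (\<lambda>n. u n s) c"
      unfolding rate_le_def
    proof (intro allI impI)
      fix r assume "c < ereal r"
      then obtain q where q: "c < ereal (real_of_rat q)" "ereal (real_of_rat q) < ereal r"
        using ereal_dense3 by blast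
      then have "\<forall>\<^sub>F n in sequentially. u n s \<le> exp (real_of_rat q * real n)" using elim by simp
      then show "\<forall>\<^sub>F n in sequentially. u n s \<le> exp (r * real n)"
      proof eventually_elim
        case (elim n)
        have "exp (real_of_rat q * real n) \<le> exp (r * real n)"
          using q by (simp add: mult_right_mono)
        with elim show ?case by linarith
      qed
    qed
    then show ?case using elim by (simp add: has_rate_def)
  qed
  then show ?thesis using that cfin by blast
qed

end

section \<open>Gram-Schmidt residuals and volumes\<close>

text \<open>\<open>res us y\<close> is the component of \<open>y\<close> orthogonal to \<open>us\<close>.  If \<open>u\<close> depends on \<open>us\<close> its residual is \<open>0\<close>,
  and \<open>x / 0 = 0\<close> makes the recursion skip it.  The explicit recursion makes measurability immediate.\<close>

primrec res :: "'a::real_inner list \<Rightarrow> 'a \<Rightarrow> 'a" where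
  "res [] y = y"
| "res (u # us) y = res us y - ((res us y \<bullet> res us u) / (res us u \<bullet> res us u)) *\<^sub>R res us u"

text \<open>This is the square root of the Gram determinant. In this form the norm of a residual is
  a quotient of two volumes, which is how rates of residuals are obtained.\<close>

primrec vol :: "'a::real_inner list \<Rightarrow> real" where
  "vol [] = 1"
| "vol (y # ys) = norm (res ys y) * vol ys"

lemma linear_res: "linear (res us)"
proof (induction us)
  case (Cons u us)
  show ?case
  proof (rule linearI)
    show "res (u # us) (x + y) = res (u # us) x + res (u # us) y" for x y
      by (simp add: linear_add[OF Cons] inner_add_left add_divide_distrib scaleR_add_left)
    show "res (u # us) (c *\<^sub>R x) = c *\<^sub>R res (u # us) x" for c x
      by (simp add: linear_scale[OF Cons] scaleR_diff_right)
  qed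
qed (simp add: linear_iff)

lemma diff_res_in_span: "y - res us y \<in> span (set us)"
proof (induction us arbitrary: y)
  case (Cons u us)
  have sub: "span (set us) \<subseteq> span (set (u # us))" by (intro span_mono) auto
  have 1: "y - res us y \<in> span (set (u # us))" using Cons sub by blast
  have "u - (u - res us u) \<in> span (set (u # us))"
    by (rule span_diff[OF span_base subsetD[OF sub Cons]]) simp
  then have "res us u \<in> span (set (u # us))" by simp
  from span_add[OF 1 span_scale[OF this, of "(res us y \<bullet> res us u) / (res us u \<bullet> res us u)"]]
  show ?case by (simp add: algebra_simps)
qed (simp add: span_zero)

lemma inner_span_eq_0:
  fixes z :: "'a::real_inner"
  assumes "\<And>w. w \<in> S \<Longrightarrow> z \<bullet> w = 0" "x \<in> span S"
  shows "z \<bullet> x = 0"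
  using assms(2)
  by (induction rule: span_induct_alt) (auto simp: inner_add_right assms(1))

text \<open>In the degenerate case the skipped vector already lies in the span of the others, so
  orthogonality to it comes from the induction hypothesis.\<close>

lemma res_inner_set: "w \<in> set us \<Longrightarrow> res us y \<bullet> w = 0"
proof (induction us arbitrary: y w)
  case (Cons u us)
  let ?u = "res us u" and ?r = "res us y"
  have w: "res (u # us) y \<bullet> w = 0" if "w \<in> set us" for w
    using Cons.IH[OF that] by (simp add: inner_diff_left)
  have "res (u # us) y \<bullet> (u - ?u) = 0"
    by (rule inner_span_eq_0[OF w diff_res_in_span])
  moreover have "res (u # us) y \<bullet> ?u = 0"
    by (cases "?u = 0") (simp_all add: inner_diff_left)
  ultimately have "res (u # us) y \<bullet> u = 0" by (simp add: inner_diff_right)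
  with w Cons.prems show ?case by auto
qed simp

lemma res_inner_span: "w \<in> span (set us) \<Longrightarrow> res us y \<bullet> w = 0"
  by (rule inner_span_eq_0[OF res_inner_set])

lemma res_unique:
  assumes "y - z \<in> span (set us)" "\<And>w. w \<in> set us \<Longrightarrow> z \<bullet> w = 0"
  shows "res us y = z"
proof -
  have d: "z - res us y \<in> span (set us)"
    using span_diff[OF diff_res_in_span[of y us] assms(1)] by simp
  have "z \<bullet> (z - res us y) = 0" by (rule inner_span_eq_0[OF assms(2) d])
  moreover have "res us y \<bullet> (z - res us y) = 0" by (rule res_inner_span[OF d])
  ultimately have "(z - res us y) \<bullet> (z - res us y) = 0" by (simp add: inner_diff_left)
  then show ?thesis by simp
qed

lemma res_cong_span:
  assumes "span (set us) = span (set vs)"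
  shows "res us y = res vs y"
proof (rule res_unique)
  show "y - res vs y \<in> span (set us)" using diff_res_in_span[of y vs] assms by simp
  show "res vs y \<bullet> w = 0" if "w \<in> set us" for w
    using that assms by (metis res_inner_span span_base)
qed

lemma res_eq_0: "y \<in> span (set us) \<Longrightarrow> res us y = 0"
  by (rule res_unique) auto

lemma res_cong:
  assumes "y - y' \<in> span (set us)"
  shows "res us y = res us y'"
  using res_eq_0[OF assms] linear_diff[OF linear_res, of us y y'] by simp

lemma norm_res_le: "norm (res us y) \<le> norm y"
proof -
  have "res us y \<bullet> (y - res us y) = 0" by (rule res_inner_span[OF diff_res_in_span])
  then have "(norm (res us y + (y - res us y)))\<^sup>2 = (norm (res us y))\<^sup>2 + (norm (y - res us y))\<^sup>2"
    by (intro norm_add_Pythagorean) (simp only: orthogonal_def)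
  then have "(norm (res us y))\<^sup>2 \<le> (norm y)\<^sup>2" by simp
  then show ?thesis by (rule power2_le_imp_le) simp
qed

lemma vol_nonneg: "0 \<le> vol ys"
  by (induction ys) auto

text \<open>The right side is the squared area of a parallelogram and is symmetric in the two
  vectors; independence of \<open>vol\<close> from the order of its arguments rests on this. For
  \<open>y = 0\<close> both sides vanish.\<close>

lemma norm_proj_mult_square:
  fixes x y :: "'a::real_inner"
  shows "(norm (x - ((x \<bullet> y) / (y \<bullet> y)) *\<^sub>R y) * norm y)\<^sup>2 = (x \<bullet> x) * (y \<bullet> y) - (x \<bullet> y)\<^sup>2"
proof (cases "y = 0")
  case False
  define c where "c = (x \<bullet> y) / (y \<bullet> y)"
  have c: "c * (y \<bullet> y) = x \<bullet> y" using False by (simp add: c_def)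
  have "(x - c *\<^sub>R y) \<bullet> (x - c *\<^sub>R y) = x \<bullet> x - 2 * c * (x \<bullet> y) + c * (c * (y \<bullet> y))"
    by (simp add: inner_diff_left inner_diff_right inner_commute[of y x] algebra_simps)
  also have "\<dots> = x \<bullet> x - c * (x \<bullet> y)" unfolding c by simp
  finally have "(x - c *\<^sub>R y) \<bullet> (x - c *\<^sub>R y) * (y \<bullet> y) = (x \<bullet> x) * (y \<bullet> y) - (c * (y \<bullet> y)) * (x \<bullet> y)"
    by (simp add: left_diff_distrib)
  then show ?thesis
    unfolding power_mult_distrib power2_norm_eq_inner c
    by (simp add: c_def power2_eq_square)
qed simp

lemma norm_proj_mult_commute:
  fixes x y :: "'a::real_inner"
  shows "norm (x - ((x \<bullet> y) / (y \<bullet> y)) *\<^sub>R y) * norm y = norm (y - ((y \<bullet> x) / (x \<bullet> x)) *\<^sub>R x) * norm x"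
proof -
  have "(norm (x - ((x \<bullet> y) / (y \<bullet> y)) *\<^sub>R y) * norm y)\<^sup>2 = (norm (y - ((y \<bullet> x) / (x \<bullet> x)) *\<^sub>R x) * norm x)\<^sup>2"
    unfolding norm_proj_mult_square by (simp add: inner_commute mult.commute)
  then show ?thesis by (rule power2_eq_imp_eq) auto
qed

lemma vol_swap: "vol (a # b # ys) = vol (b # a # ys)"
  using norm_proj_mult_commute[of "res ys a" "res ys b"] by simp

text \<open>Any chosen vector can be brought to the head, where the volume is the norm of a linear
  function of it times a factor free of it.\<close>

lemma vol_move: "vol (xs @ y # zs) = vol (y # xs @ zs)"
proof (induction xs)
  case (Cons x xs)
  have s: "span (set (xs @ y # zs)) = span (set (y # xs @ zs))" by (simp add: Un_commute insert_commute)
  have "vol ((x # xs) @ y # zs) = norm (res (xs @ y # zs) x) * vol (xs @ y # zs)" by simp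
  also have "\<dots> = vol (x # y # xs @ zs)"
    using Cons res_cong_span[OF s, of x] by (simp del: res.simps)
  also have "\<dots> = vol (y # (x # xs) @ zs)" by (subst vol_swap) simp
  finally show ?case .
qed simp

lemma vol_eq_0_dup:
  assumes "\<not> distinct ys"
  shows "vol ys = 0"
proof -
  obtain as y bs cs where ys: "ys = as @ [y] @ bs @ [y] @ cs"
    using not_distinct_decomp[OF assms] by blast
  have "vol ys = vol (y # as @ bs @ y # cs)"
    unfolding ys using vol_move[of as y "bs @ y # cs"] by simp
  also have "\<dots> = 0" by (simp add: res_eq_0 span_base)
  finally show ?thesis .
qed

lemma vol_le_prod_norm: "vol ys \<le> prod_list (map norm ys)"
  by (induction ys) (auto intro!: mult_mono norm_res_le vol_nonneg)

section \<open>Volumes of images of coordinate frames\<close>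

definition blists :: "nat \<Rightarrow> 'a::euclidean_space list set" where
  "blists k = {bs. set bs \<subseteq> Basis \<and> length bs = k}"

lemma finite_blists [simp]: "finite (blists k)"
  unfolding blists_def by (rule finite_lists_length_eq) simp

lemma card_blists: "card (blists k :: 'a::euclidean_space list set) = DIM('a) ^ k"
  unfolding blists_def by (rule card_lists_length_eq) simp

lemma blists_0: "blists 0 = {[]}"
  by (auto simp: blists_def)

lemma sum_blists_Suc:
  "(\<Sum>bs\<in>blists (Suc k). F bs) = (\<Sum>b\<in>Basis. \<Sum>bs\<in>blists k. F (b # bs))"
proof -
  have eq: "blists (Suc k) = (\<lambda>(b, bs). b # bs) ` (Basis \<times> blists k)"
    unfolding blists_def by (force simp: length_Suc_conv)
  have "(\<Sum>bs\<in>blists (Suc k). F bs) = (\<Sum>(b, bs)\<in>Basis \<times> blists k. F (b # bs))"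
    unfolding eq by (subst sum.reindex) (auto simp: inj_on_def intro!: sum.cong)
  then show ?thesis by (simp add: sum.cartesian_product)
qed

text \<open>Up to constants, \<open>svol k f\<close> is the operator norm of the \<open>k\<close>-th exterior power of \<open>f\<close>.\<close>

definition svol :: "nat \<Rightarrow> ('a::euclidean_space \<Rightarrow> 'b::real_inner) \<Rightarrow> real" where
  "svol k f = (\<Sum>bs\<in>blists k. vol (map f bs))"

lemma svol_nonneg: "0 \<le> svol k f"
  unfolding svol_def by (intro sum_nonneg vol_nonneg)

lemma svol_0 [simp]: "svol 0 f = 1"
  by (simp add: svol_def blists_0)

lemma svol_1: "svol (Suc 0) f = (\<Sum>b\<in>Basis. norm (f b))"
  by (simp add: svol_def sum_blists_Suc blists_0)

lemma svol_eq_0: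
  fixes f :: "'a::euclidean_space \<Rightarrow> 'b::real_inner"
  assumes "DIM('a) < k"
  shows "svol k f = 0"
  unfolding svol_def
proof (intro sum.neutral ballI vol_eq_0_dup notI)
  fix bs :: "'a list" assume bs: "bs \<in> blists k" and "distinct (map f bs)"
  then have "distinct bs" using distinct_map by blast
  then have "card (set bs) = k" using bs distinct_card by (auto simp: blists_def)
  moreover have "card (set bs) \<le> DIM('a)" using bs by (intro card_mono) (auto simp: blists_def)
  ultimately show False using assms by simp
qed

lemma vol_head_le:
  fixes f :: "'a::euclidean_space \<Rightarrow> 'b::real_inner"
  assumes "linear f"
  shows "vol (f y # zs) \<le> norm y * (\<Sum>b\<in>Basis. vol (f b # zs))"
proof -
  have "res zs (f y) = res zs (f (\<Sum>b\<in>Basis. (y \<bullet> b) *\<^sub>R b))" by (simp add: euclidean_representation)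
  also have "\<dots> = (\<Sum>b\<in>Basis. (y \<bullet> b) *\<^sub>R res zs (f b))"
    by (simp add: linear_sum[OF assms] linear_scale[OF assms] linear_sum[OF linear_res] linear_scale[OF linear_res])
  finally have "norm (res zs (f y)) \<le> (\<Sum>b\<in>Basis. norm ((y \<bullet> b) *\<^sub>R res zs (f b)))"
    by (metis norm_sum)
  also have "\<dots> \<le> (\<Sum>b\<in>Basis. norm y * norm (res zs (f b)))"
    by (intro sum_mono) (auto intro!: mult_right_mono Basis_le_norm)
  finally have "norm (res zs (f y)) * vol zs \<le> (\<Sum>b\<in>Basis. norm y * norm (res zs (f b))) * vol zs"
    by (rule mult_right_mono[OF _ vol_nonneg])
  then show ?thesis by (simp add: sum_distrib_left sum_distrib_right mult.assoc)
qed

text \<open>The vectors are expanded in the basis one at a time. The tail \<open>zs\<close> stays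
  arbitrary in the induction because it collects the vectors still waiting to be expanded.\<close>

lemma vol_map_append_le:
  fixes f :: "'a::euclidean_space \<Rightarrow> 'b::real_inner"
  assumes "linear f"
  shows "vol (map f ys @ zs) \<le> prod_list (map norm ys) * (\<Sum>bs\<in>blists (length ys). vol (map f bs @ zs))"
proof (induction ys arbitrary: zs)
  case (Cons y ys)
  have "vol (map f (y # ys) @ zs) = vol (map f ys @ f y # zs)" by (simp add: vol_move del: vol.simps)
  also have "\<dots> \<le> prod_list (map norm ys) * (\<Sum>bs\<in>blists (length ys). vol (map f bs @ f y # zs))"
    by (rule Cons)
  also have "\<dots> \<le> prod_list (map norm ys) * (\<Sum>bs\<in>blists (length ys). norm y * (\<Sum>b\<in>Basis. vol (f b # map f bs @ zs)))"
    by (intro mult_left_mono sum_mono prod_list_nonneg)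
      (auto simp: vol_move simp del: vol.simps intro: vol_head_le assms)
  also have "\<dots> = prod_list (map norm (y # ys)) * (\<Sum>bs\<in>blists (length (y # ys)). vol (map f bs @ zs))"
    by (simp add: sum_blists_Suc sum_distrib_left[symmetric] mult.assoc mult.left_commute del: vol.simps)
      (subst sum.swap, simp)
  finally show ?case .
qed (simp add: blists_0)

primrec gram_schmidt :: "'a::real_inner list \<Rightarrow> 'a list" where
  "gram_schmidt [] = []"
| "gram_schmidt (y # ys) = res ys y # gram_schmidt ys"

lemma length_gram_schmidt [simp]: "length (gram_schmidt ys) = length ys"
  by (induction ys) auto

lemma prod_norm_gram_schmidt: "prod_list (map norm (gram_schmidt ys)) = vol ys"
  by (induction ys) auto

lemma span_gram_schmidt: "span (set (gram_schmidt ys)) = span (set ys)"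
proof (induction ys)
  case (Cons y ys)
  have 1: "y - res ys y \<in> span (set ys)" by (rule diff_res_in_span)
  have "y - (y - res ys y) \<in> span (insert y (set ys))"
    by (rule span_diff[OF span_base subsetD[OF span_mono 1]]) auto
  moreover have "(y - res ys y) + res ys y \<in> span (insert (res ys y) (set (gram_schmidt ys)))"
    using 1 unfolding Cons[symmetric]
    by (rule span_add[OF subsetD[OF span_mono] span_base, rotated]) auto
  ultimately have yr: "res ys y \<in> span (insert y (set ys))"
    "y \<in> span (insert (res ys y) (set (gram_schmidt ys)))" by simp_all
  have "set (gram_schmidt ys) \<subseteq> span (insert y (set ys))"
    using span_superset[of "set (gram_schmidt ys)"] span_mono[of "set ys" "insert y (set ys)"]
    unfolding Cons by blast
  moreover have "set ys \<subseteq> span (insert (res ys y) (set (gram_schmidt ys)))"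
    using span_superset[of "set ys"]
      span_mono[of "set (gram_schmidt ys)" "insert (res ys y) (set (gram_schmidt ys))"]
    unfolding Cons by blast
  ultimately have "span (insert (res ys y) (set (gram_schmidt ys))) = span (insert y (set ys))"
    unfolding span_eq using yr by blast
  then show ?case by simp
qed simp

lemma vol_map_gram_schmidt:
  assumes "linear f"
  shows "vol (map f (gram_schmidt ys)) = vol (map f ys)"
proof (induction ys)
  case (Cons y ys)
  have s: "span (set (map f (gram_schmidt ys))) = span (set (map f ys))"
    by (simp add: linear_span_image[OF assms] span_gram_schmidt)
  have "f (res ys y) - f y \<in> span (set (map f ys))"
    using diff_res_in_span[of y ys] linear_span_image[OF assms, of "set ys"]
    by (metis (no_types, lifting) image_eqI linear_diff[OF assms] list.set_map minus_diff_eq span_neg)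
  then have "res (map f ys) (f (res ys y)) = res (map f ys) (f y)" by (rule res_cong)
  then show ?case using Cons res_cong_span[OF s] by simp
qed simp

text \<open>Passing to Gram-Schmidt vectors preserves the volume of the image, while the product of
  norms on the right drops to the volume itself. The expansion bound thereby becomes the operator
  bound for volumes.\<close>

lemma vol_map_le_svol:
  fixes f :: "'a::euclidean_space \<Rightarrow> 'b::real_inner"
  assumes "linear f"
  shows "vol (map f ys) \<le> svol (length ys) f * vol ys"
  using vol_map_append_le[OF assms, of "gram_schmidt ys" "[]"]
  by (simp add: prod_norm_gram_schmidt vol_map_gram_schmidt[OF assms] svol_def mult.commute)

lemma norm_le_svol:
  fixes f :: "'a::euclidean_space \<Rightarrow> 'b::real_inner"
  assumes "linear f"
  shows "norm (f x) \<le> svol (Suc 0) f * norm x"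
  using vol_map_le_svol[OF assms, of "[x]"] by simp

text \<open>The constant is exactly one, as the subadditive theorem requires; this is the advantage
  over taking a maximum over bounded frames up to constants.\<close>

lemma svol_comp_le:
  fixes f :: "'b::euclidean_space \<Rightarrow> 'c::real_inner" and g :: "'a::euclidean_space \<Rightarrow> 'b"
  assumes "linear f"
  shows "svol k (f \<circ> g) \<le> svol k f * svol k g"
proof -
  have "svol k (f \<circ> g) = (\<Sum>bs\<in>blists k. vol (map f (map g bs)))" by (simp add: svol_def)
  also have "\<dots> \<le> (\<Sum>bs\<in>blists k. svol k f * vol (map g bs))"
    using vol_map_le_svol[OF assms] by (intro sum_mono) (metis (mono_tags, lifting) blists_def length_map mem_Collect_eq)
  finally show ?thesis by (simp add: svol_def sum_distrib_left)
qed

text \<open>It makes the logarithm of every \<open>k\<close>-volume integrable from above once that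
  of the norm is.\<close>

lemma svol_le_power:
  fixes f :: "'a::euclidean_space \<Rightarrow> 'b::real_inner"
  shows "svol k f \<le> (real DIM('a) * svol (Suc 0) f) ^ k"
proof -
  have "prod_list (map norm (map f bs)) \<le> svol (Suc 0) f ^ length bs" if "set bs \<subseteq> Basis" for bs
    using that
  proof (induction bs)
    case (Cons b bs)
    have "norm (f b) \<le> svol (Suc 0) f"
      unfolding svol_1 using Cons by (intro member_le_sum) auto
    then show ?case using Cons by (auto intro!: mult_mono prod_list_nonneg svol_nonneg)
  qed simp
  then have "vol (map f bs) \<le> svol (Suc 0) f ^ k" if "bs \<in> blists k" for bs
    using that vol_le_prod_norm[of "map f bs"] by (force simp: blists_def)
  then have "svol k f \<le> (\<Sum>bs\<in>(blists k :: 'a list set). svol (Suc 0) f ^ k)"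
    unfolding svol_def by (intro sum_mono) auto
  then show ?thesis by (simp add: card_blists power_mult_distrib)
qed

section \<open>Measurability of residuals and volumes\<close>

lemma borel_measurable_res [measurable (raw)]:
  fixes y :: "'s \<Rightarrow> 'a::euclidean_space"
  assumes "\<And>u. u \<in> set us \<Longrightarrow> u \<in> borel_measurable M" and "y \<in> borel_measurable M"
  shows "(\<lambda>s. res (map (\<lambda>u. u s) us) (y s)) \<in> borel_measurable M"
  using assms
proof (induction us arbitrary: y)
  case (Cons u us)
  have [measurable]: "(\<lambda>s. res (map (\<lambda>u. u s) us) (y s)) \<in> borel_measurable M"
    "(\<lambda>s. res (map (\<lambda>u. u s) us) (u s)) \<in> borel_measurable M"
    using Cons by auto
  show ?case by simp
qed simp

lemma borel_measurable_vol:
  fixes us :: "('s \<Rightarrow> 'a::euclidean_space) list"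
  assumes "\<And>u. u \<in> set us \<Longrightarrow> u \<in> borel_measurable M"
  shows "(\<lambda>s. vol (map (\<lambda>u. u s) us)) \<in> borel_measurable M"
  using assms
proof (induction us)
  case (Cons u us)
  have [measurable]: "(\<lambda>s. vol (map (\<lambda>u. u s) us)) \<in> borel_measurable M"
    "(\<lambda>s. res (map (\<lambda>u. u s) us) (u s)) \<in> borel_measurable M"
    using Cons by (auto intro!: borel_measurable_res)
  show ?case by simp
qed simp

lemma borel_measurable_svol:
  fixes f :: "'s \<Rightarrow> 'a::euclidean_space \<Rightarrow> 'b::euclidean_space"
  assumes "\<And>b. b \<in> Basis \<Longrightarrow> (\<lambda>s. f s b) \<in> borel_measurable M"
  shows "(\<lambda>s. svol k (f s)) \<in> borel_measurable M"
  unfolding svol_def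
proof (intro borel_measurable_sum)
  fix bs :: "'a list" assume "bs \<in> blists k"
  then show "(\<lambda>s. vol (map (f s) bs)) \<in> borel_measurable M"
    using borel_measurable_vol[of "map (\<lambda>b s. f s b) bs" M] assms
    by (auto simp: blists_def comp_def)
qed

text \<open>The slab \<open>S\<close> has \<open>K\<close> disjoint translates along \<open>b\<close> inside the ball of radius 2.\<close>

lemma measure_slab_le:
  fixes L :: "'a::euclidean_space \<Rightarrow> 'b::real_normed_vector"
  assumes L: "linear L" and b: "norm b \<le> 1" and K: "0 < K"
  defines "S \<equiv> {x \<in> ball 0 1. norm (L x) < norm (L b) / (2 * real K)}"
  shows "S \<in> lmeasurable" "measure lebesgue S \<le> measure lebesgue (ball 0 2 :: 'a set) / real K"
proof -
  have cont: "continuous_on UNIV L" using L by (simp add: linear_continuous_on linear_conv_bounded_linear)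
  have "open S"
  proof -
    have "S = ball 0 1 \<inter> {x. norm (L x) < norm (L b) / (2 * real K)}" by (auto simp: S_def)
    then show ?thesis using cont by (auto intro!: open_Int open_Collect_less continuous_intros)
  qed
  moreover have "bounded S" unfolding S_def by (rule bounded_subset[OF bounded_ball[of 0 1]]) auto
  ultimately show Sm: "S \<in> lmeasurable" by (rule lmeasurable_open[rotated])
  \<comment> \<open>A shift by one step moves \<open>L x\<close> by \<open>L b / K\<close>, the full
    width of the slab in that direction; the strict bound in \<open>S\<close> keeps the translates
    apart.\<close>
  define t where "t i = (real i / real K) *\<^sub>R b" for i :: nat
  have Lt: "L (t i) = (real i / real K) *\<^sub>R L b" for i
    unfolding t_def by (rule linear_scale[OF L])
  have "(+) (t i) ` S \<inter> (+) (t j) ` S = {}" if ij: "i \<noteq> j" for i j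
  proof (rule ccontr)
    assume "(+) (t i) ` S \<inter> (+) (t j) ` S \<noteq> {}"
    then obtain x y where xy: "x \<in> S" "y \<in> S" "t i + x = t j + y" by blast
    have "x - y = t j - t i" using xy(3) by (simp add: algebra_simps)
    then have "L (x - y) = L (t j - t i)" by simp
    then have eq: "norm (L x - L y) = norm (((real j - real i) / real K) *\<^sub>R L b)"
      by (simp add: linear_diff[OF L] Lt diff_divide_distrib scaleR_left_diff_distrib)
    have "norm (L x - L y) \<le> norm (L x) + norm (L y)" by (rule norm_triangle_ineq4)
    also have "\<dots> < norm (L b) / (2 * real K) + norm (L b) / (2 * real K)"
      using xy by (intro add_strict_mono) (auto simp: S_def)
    also have "\<dots> = norm (L b) / real K" by (simp add: field_simps)
    finally have lt: "\<bar>real j - real i\<bar> / real K * norm (L b) < norm (L b) / real K"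
      using eq by simp
    have "1 \<le> \<bar>real j - real i\<bar>" using ij by linarith
    then have "norm (L b) * 1 \<le> norm (L b) * \<bar>real j - real i\<bar>" by (intro mult_left_mono) auto
    then show False using lt K by (simp add: divide_less_cancel mult.commute)
  qed
  then have disj: "disjoint_family_on (\<lambda>i. (+) (t i) ` S) {..<K}"
    by (auto simp: disjoint_family_on_def)
  have Smi: "(+) (t i) ` S \<in> lmeasurable" for i
    using Sm by (rule measurable_translation)
  have "real K * measure lebesgue S = (\<Sum>i<K. measure lebesgue ((+) (t i) ` S))"
    by (simp add: measure_translation)
  also have "\<dots> = measure lebesgue (\<Union>i<K. (+) (t i) ` S)"
    by (rule measure_finite_Union[symmetric])
      (use disj fmeasurableD[OF Smi] fmeasurableD2[OF Smi] in \<open>(blast | simp only: infinity_ennreal_def)+\<close>)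
  also have "\<dots> \<le> measure lebesgue (ball 0 2 :: 'a set)"
  proof (rule measure_mono_fmeasurable)
    show "(\<Union>i<K. (+) (t i) ` S) \<subseteq> ball 0 2"
    proof
      fix z assume "z \<in> (\<Union>i<K. (+) (t i) ` S)"
      then obtain i x where i: "i < K" "x \<in> S" "z = t i + x" by auto
      have "norm (t i) \<le> 1 * 1"
        unfolding t_def norm_scaleR using i b by (intro mult_mono) auto
      moreover have "norm x < 1" using i by (auto simp: S_def)
      ultimately show "z \<in> ball 0 2" using i norm_triangle_ineq[of "t i" x] by simp
    qed
    show "(\<Union>i<K. (+) (t i) ` S) \<in> sets lebesgue"
      using Smi by (intro sets.finite_UN) (auto simp: fmeasurableD)
  qed simp
  finally show "measure lebesgue S \<le> measure lebesgue (ball 0 2 :: 'a set) / real K"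
    using K by (simp add: field_simps)
qed

text \<open>Avoiding every kernel would not suffice; a quantitative margin is needed for all maps at
  once. Slab \<open>m\<close> is cut so thin that \<open>C * (m + 1)\<^sup>2\<close> translates fit,
  and \<open>C\<close> is taken so large that the total measure stays below that of the unit
  ball.\<close>

lemma generic_vector:
  fixes L :: "nat \<Rightarrow> 'a::euclidean_space \<Rightarrow> 'b::real_normed_vector"
  assumes L: "\<And>m. linear (L m)" and b: "\<And>m. norm (b m) \<le> 1"
  obtains x c where "0 < c" "\<forall>m. c / (real m + 1)\<^sup>2 * norm (L m (b m)) \<le> norm (L m x)"
proof -
  define B1 where "B1 = measure lebesgue (ball 0 1 :: 'a set)"
  define B2 where "B2 = measure lebesgue (ball 0 2 :: 'a set)"
  have B1: "0 < B1" unfolding B1_def by (simp add: content_ball_pos)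
  have B2: "0 \<le> B2" by (simp add: B2_def)
  have sm: "summable (\<lambda>m. inverse ((real m + 1)\<^sup>2))"
    using inverse_power_summable[of 2, where 'a=real] summable_Suc_iff[of "\<lambda>n. inverse (real n ^ 2)"]
    by (simp add: add.commute)
  define Z where "Z = (\<Sum>m. inverse ((real m + 1)\<^sup>2))"
  obtain C :: nat where C: "B2 * Z / B1 < real C" using reals_Archimedean2 by blast
  have Z: "0 \<le> Z" unfolding Z_def using sm by (intro suminf_nonneg) auto
  then have C0: "0 < C" using C B1 B2
    by (metis divide_nonneg_pos mult_nonneg_nonneg not_gr0 not_less of_nat_0)
  define S where "S m = {x \<in> ball 0 1. norm (L m x) < norm (L m (b m)) / (2 * real (C * (m + 1)\<^sup>2))}" for m
  have S: "S m \<in> lmeasurable" "measure lebesgue (S m) \<le> B2 / real (C * (m + 1)\<^sup>2)" for m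
  proof -
    have "0 < C * (m + 1)\<^sup>2" using C0 by simp
    then show "S m \<in> lmeasurable" "measure lebesgue (S m) \<le> B2 / real (C * (m + 1)\<^sup>2)"
      unfolding S_def B2_def by (rule measure_slab_le[OF L b])+
  qed
  have "emeasure lebesgue (\<Union>m. S m) \<le> (\<Sum>m. emeasure lebesgue (S m))"
    using S(1) by (intro emeasure_subadditive_countably) auto
  also have "\<dots> \<le> (\<Sum>m. ennreal (B2 / C * inverse ((real m + 1)\<^sup>2)))"
  proof (rule suminf_le)
    fix m
    have "emeasure lebesgue (S m) = ennreal (measure lebesgue (S m))"
      using S(1) by (simp add: emeasure_eq_measure2)
    also have "\<dots> \<le> ennreal (B2 / C * inverse ((real m + 1)\<^sup>2))"
      using S(2)[of m] by (intro ennreal_leI) (simp add: field_simps)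
    finally show "emeasure lebesgue (S m) \<le> ennreal (B2 / C * inverse ((real m + 1)\<^sup>2))" .
  qed auto
  also have "\<dots> = ennreal (\<Sum>m. B2 / C * inverse ((real m + 1)\<^sup>2))"
    using B2 sm by (intro suminf_ennreal2 summable_mult) auto
  also have "(\<Sum>m. B2 / C * inverse ((real m + 1)\<^sup>2)) = B2 / C * Z"
    unfolding Z_def using sm by (rule suminf_mult)
  also have "ennreal (B2 / C * Z) < ennreal B1"
    using C C0 B1 B2 Z by (intro ennreal_lessI) (auto simp: field_simps)
  also have "ennreal B1 = emeasure lebesgue (ball 0 1 :: 'a set)"
    unfolding B1_def by (simp add: emeasure_eq_measure2)
  finally have "\<not> ball 0 1 \<subseteq> (\<Union>m. S m)"
    using emeasure_mono[of "ball 0 1" "\<Union>m. S m" lebesgue] S(1) by (auto simp: not_le[symmetric])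
  then obtain x where x: "x \<in> ball 0 1" "\<And>m. x \<notin> S m" by blast
  have "1 / (2 * C) / (real m + 1)\<^sup>2 * norm (L m (b m)) \<le> norm (L m x)" for m
    using x(1) x(2)[of m] by (simp add: S_def not_less field_simps)
  then show ?thesis using that[of "1 / (2 * C)" x] C0 by auto
qed

section \<open>Exact growth rates of tempered cocycles\<close>

lemma rate_ge_inverse_square: "rate_ge (\<lambda>n. 1 / (real n + 1)\<^sup>2) 0"
  unfolding rate_ge_def
proof (intro allI impI)
  fix r assume "ereal r < 0"
  \<comment> \<open>A quarter, because \<open>real n + 1\<close> is compared with a square of
    \<open>1 + s * real n\<close> and the claim contains one further square.\<close>
  define s where "s = - r / 4"
  have s: "0 < s" using \<open>ereal r < 0\<close> by (simp add: s_def)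
  have "\<forall>\<^sub>F n in sequentially. 1 / s\<^sup>2 \<le> real n"
    using filterlim_real_sequentially unfolding filterlim_at_top by blast
  then show "\<forall>\<^sub>F n in sequentially. exp (r * real n) \<le> 1 / (real n + 1)\<^sup>2"
  proof eventually_elim
    case (elim n)
    have "1 \<le> s\<^sup>2 * real n" using elim s by (simp add: field_simps)
    then have "real n \<le> s\<^sup>2 * real n * real n"
      using mult_right_mono[of 1 "s\<^sup>2 * real n" "real n"] by simp
    moreover have "0 \<le> s * (real n * 2)" using s by simp
    ultimately have "real n + 1 \<le> (1 + s * real n)\<^sup>2"
      by (simp add: power2_eq_square algebra_simps)
    also have "\<dots> \<le> (exp (s * real n))\<^sup>2" using s by (intro power_mono) auto
    finally have "(real n + 1)\<^sup>2 \<le> ((exp (s * real n))\<^sup>2)\<^sup>2" by (intro power_mono) auto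
    also have "\<dots> = exp (4 * (s * real n))" by (simp flip: exp_of_nat_mult)
    also have "4 * (s * real n) = - (r * real n)" by (simp add: s_def)
    finally have "(real n + 1)\<^sup>2 \<le> inverse (exp (r * real n))" by (simp add: exp_minus)
    then have "inverse (inverse (exp (r * real n))) \<le> inverse ((real n + 1)\<^sup>2)"
      by (rule le_imp_inverse_le) simp
    then show ?case by (simp add: inverse_eq_divide)
  qed
qed

lemma rate_le_weaken: "rate_le X c \<Longrightarrow> c \<le> c' \<Longrightarrow> rate_le X c'"
  by (erule rate_le_mono) auto

lemma has_rate_MInf: "has_rate X (- \<infinity>) \<longleftrightarrow> rate_le X (- \<infinity>)"
  by (auto simp: has_rate_def rate_ge_def)

lemma rate_ge_imp_pos: "rate_ge X (ereal a) \<Longrightarrow> \<forall>\<^sub>F n in sequentially. 0 < X n"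
  using rate_geD[of X "ereal a" "a - 1"]
  by (auto elim!: eventually_mono intro: less_le_trans[OF exp_gt_zero])

lemma sum_le_card_mult:
  fixes f :: "'i \<Rightarrow> real"
  assumes "finite A" "A \<noteq> {}"
  obtains a where "a \<in> A" "sum f A \<le> real (card A) * f a"
proof -
  have "Max (f ` A) \<in> f ` A" using assms by (intro Max_in) auto
  then obtain a where "a \<in> A" "f a = Max (f ` A)" by auto
  moreover have "sum f A \<le> real (card A) * Max (f ` A)"
    using assms by (intro sum_bounded_above) auto
  ultimately show ?thesis using that by auto
qed

text \<open>One realization, stripped of probability. The value \<open>\<Lambda> k\<close>
  corresponds to the sum of the \<open>k\<close> largest exponents; it may be
  \<open>-\<infinity>\<close>, and single steps are only subexponentially bounded.\<close>

locale tempered_cocycle =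
  fixes F g :: "nat \<Rightarrow> 'a::euclidean_space \<Rightarrow> 'a" and \<Lambda> :: "nat \<Rightarrow> ereal"
  assumes linear_F0: "linear (F 0)"
    and linear_g: "linear (g n)"
    and F_Suc: "F (Suc n) = g n \<circ> F n"
    and rate_g: "rate_le (\<lambda>n. svol (Suc 0) (g n)) 0"
    and rate_svol: "has_rate (\<lambda>n. svol k (F n)) (\<Lambda> k)"
    and \<Lambda>_less: "\<Lambda> k < \<infinity>"
begin

abbreviation fvol :: "nat \<Rightarrow> 'a list \<Rightarrow> real" where
  "fvol n ys \<equiv> vol (map (F n) ys)"

abbreviation resid :: "nat \<Rightarrow> 'a list \<Rightarrow> 'a \<Rightarrow> real" where
  "resid n ys v \<equiv> norm (res (map (F n) ys) (F n v))"


lemma linear_F: "linear (F n)"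
proof (induction n)
  case (Suc n)
  then show ?case unfolding F_Suc by (rule linear_compose[OF _ linear_g])
qed (rule linear_F0)

lemma \<Lambda>_0: "\<Lambda> 0 = 0"
proof (rule has_rate_unique[OF rate_svol])
  show "has_rate (\<lambda>n. svol 0 (F n)) 0"
    using rate_ge_const[of 1] rate_le_const[of 1] by (simp add: has_rate_def)
qed

lemma \<Lambda>_eq_MInf: "DIM('a) < k \<Longrightarrow> \<Lambda> k = - \<infinity>"
  using has_rate_unique[OF rate_svol[of k]] rate_le_zero[of "-\<infinity>"]
  by (simp add: svol_eq_0 has_rate_MInf)

lemma vol_map_F_le: "fvol n ys \<le> svol (length ys) (F n) * vol ys"
  by (rule vol_map_le_svol[OF linear_F])

lemma rate_vol_le: "rate_le (\<lambda>n. fvol n ys) (\<Lambda> (length ys))"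
proof (rule rate_le_mono)
  show "rate_le (\<lambda>n. vol ys * svol (length ys) (F n)) (\<Lambda> (length ys))"
    using rate_svol by (intro rate_le_cmult) (auto simp: has_rate_def svol_nonneg)
qed (auto intro!: always_eventually vol_map_F_le[THEN order_trans] simp: mult.commute)

lemma vol_map_F_eq_0:
  assumes "fvol n ys = 0" "n \<le> m"
  shows "vol (map (F m) ys) = 0"
  using assms(2)
proof (induction m rule: dec_induct)
  case (step m)
  have "vol (map (F (Suc m)) ys) = vol (map (g m) (map (F m) ys))" by (simp add: F_Suc)
  also have "\<dots> \<le> svol (length ys) (g m) * vol (map (F m) ys)"
    using vol_map_le_svol[OF linear_g, of m "map (F m) ys"] by simp
  finally show ?case using step vol_nonneg[of "map (F (Suc m)) ys"] by simp
qed (rule assms)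

text \<open>A volume that vanishes once vanishes forever, so a finite lower rate forces positivity
  at every time. This justifies all later divisions by volumes.\<close>

lemma vol_map_F_pos:
  assumes "rate_ge (\<lambda>n. fvol n ys) (ereal a)"
  shows "0 < fvol n ys"
proof (rule ccontr)
  assume "\<not> 0 < fvol n ys"
  then have "fvol n ys = 0" using vol_nonneg[of "map (F n) ys"] by simp
  moreover obtain m where "m \<ge> n" "0 < vol (map (F m) ys)"
    using rate_ge_imp_pos[OF assms] unfolding eventually_sequentially by (meson nat_le_linear)
  ultimately show False using vol_map_F_eq_0[of n ys m] by simp
qed

text \<open>For each time \<open>n\<close> and size \<open>k\<close>, a largest term of the sum
  names a direction \<open>b\<close> in which the remaining volume is large. A single
  \<open>x\<close> that does nearly as well as all these directions costs a factor polynomial in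
  \<open>n\<close>, hence no rate.\<close>

lemma generic_extension:
  assumes "\<And>k. length xs \<le> k \<Longrightarrow> rate_ge (\<lambda>n. \<Sum>bs\<in>blists (k - length xs). fvol n (bs @ xs)) (\<Lambda> k)"
  obtains x where "\<And>k. Suc (length xs) \<le> k \<Longrightarrow>
    rate_ge (\<lambda>n. \<Sum>bs\<in>blists (k - Suc (length xs)). fvol n (bs @ x # xs)) (\<Lambda> k)"
proof -
  define j where "j = length xs"
  define S where "S n k = (\<Sum>bs\<in>blists (k - j). fvol n (bs @ xs))" for n k
  define D where "D = DIM('a)"
  have D: "0 < D" by (simp add: D_def)
  \<comment> \<open>Pigeonhole: some term is at least the average, and the number
    \<open>D ^ (k - j)\<close> of terms does not depend on \<open>n\<close>.\<close>
  define Q where "Q n k p \<longleftrightarrow> fst p \<in> Basis \<and> snd p \<in> blists (k - Suc j) \<and>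
      S n k \<le> real (D ^ (k - j)) * fvol n (fst p # snd p @ xs)" for n k p
  have Q: "\<exists>p. Q n k p" if k: "Suc j \<le> k" for n k
  proof -
    obtain bs where bs: "bs \<in> blists (k - j)"
      "S n k \<le> real (card (blists (k - j) :: 'a list set)) * fvol n (bs @ xs)"
      unfolding S_def
    proof (rule sum_le_card_mult[of "blists (k - j) :: 'a list set"])
      have "card (blists (k - j) :: 'a list set) \<noteq> 0" by (simp add: card_blists)
      then show "(blists (k - j) :: 'a list set) \<noteq> {}" by (metis card.empty)
    qed auto
    obtain b bs' where "bs = b # bs'" using bs(1) k by (cases bs) (auto simp: blists_def)
    with bs(1) bs(2)[unfolded card_blists, folded D_def] k show ?thesis
      by (intro exI[of _ "(b, bs')"]) (auto simp: blists_def Q_def)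
  qed
  define p where "p n k = (SOME q. Q n k q)" for n k
  have p: "fst (p n k) \<in> Basis \<and> snd (p n k) \<in> blists (k - Suc j) \<and>
      S n k \<le> real (D ^ (k - j)) * fvol n (fst (p n k) # snd (p n k) @ xs)"
    if "Suc j \<le> k" for n k
  proof -
    have "Q n k (p n k)" unfolding p_def by (rule someI_ex[OF Q[OF that]])
    then show ?thesis unfolding Q_def .
  qed
  define Y where "Y n k = map (F n) (snd (p n k) @ xs)" for n k
  \<comment> \<open>For sizes that do not occur the direction \<open>0\<close> makes the required
    inequality trivial.\<close>
  define b where "b n k = (if Suc j \<le> k then fst (p n k) else 0)" for n k
  define L where "L n k x = vol (Y n k) *\<^sub>R res (Y n k) (F n x)" for n k x
  have linL: "linear (L n k)" for n k
    unfolding L_def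
    by (rule linear_compose_scale_right[OF linear_compose[OF linear_F linear_res, unfolded comp_def]])
  have nL: "norm (L n k x) = fvol n (snd (p n k) @ x # xs)" for n k x
    by (simp add: L_def Y_def vol_move vol_nonneg)
  have nb: "norm (b n k) \<le> 1" for n k
    using p[of k n] by (simp add: b_def)
  \<comment> \<open>Time and size are coded in one index \<open>m = n * (D + 1) + k\<close>, so
    \<open>m + 1\<close> is at most \<open>D + 1\<close> times \<open>n + 1\<close>. Sizes above
    \<open>D\<close> need no index, their rate being \<open>-\<infinity>\<close>.\<close>
  obtain x c where c: "0 < c" and
    x: "\<forall>m. c / (real m + 1)\<^sup>2 * norm (L (m div (D+1)) (m mod (D+1)) (b (m div (D+1)) (m mod (D+1))))
        \<le> norm (L (m div (D+1)) (m mod (D+1)) x)"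
    using generic_vector[of "\<lambda>m. L (m div (D+1)) (m mod (D+1))" "\<lambda>m. b (m div (D+1)) (m mod (D+1))"]
      linL nb by metis
  have main: "rate_ge (\<lambda>n. \<Sum>bs\<in>blists (k - Suc j). fvol n (bs @ x # xs)) (\<Lambda> k)"
    if k: "Suc j \<le> k" for k
  proof (cases "k \<le> D")
    case False
    then show ?thesis using \<Lambda>_eq_MInf[of k] by (simp add: D_def rate_ge_def)
  next
    case True
    define C where "C = c / (real (D + 1))\<^sup>2 / real (D ^ (k - j))"
    have C: "0 < C" using c D by (simp add: C_def)
    have "rate_ge (\<lambda>n. C * (1 / (real n + 1)\<^sup>2 * S n k)) (0 + \<Lambda> k)"
    proof (intro rate_ge_cmult rate_ge_mult rate_ge_inverse_square C)
      show "rate_ge (\<lambda>n. S n k) (\<Lambda> k)" unfolding S_def j_def using k by (intro assms) (simp add: j_def)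
    qed (use \<Lambda>_less[of k] in auto)
    then show ?thesis
    proof (rule rate_ge_mono)
      show "\<forall>\<^sub>F n in sequentially. C * (1 / (real n + 1)\<^sup>2 * S n k)
          \<le> (\<Sum>bs\<in>blists (k - Suc j). fvol n (bs @ x # xs))"
      proof (rule always_eventually, rule allI)
        fix n
        define m where "m = n * (D + 1) + k"
        have "(n * N + k) div N = n" "(n * N + k) mod N = k" if "k < N" for N using that by simp_all
        from this[of "D + 1"] have m: "m div (D + 1) = n" "m mod (D + 1) = k"
          using True by (simp_all only: m_def less_Suc_eq_le Suc_eq_plus1[symmetric])
        have "m + 1 \<le> (n + 1) * (D + 1)" using True by (simp add: m_def)
        then have "real (m + 1) \<le> real ((n + 1) * (D + 1))" by (rule of_nat_mono)
        then have "real m + 1 \<le> (real n + 1) * real (D + 1)"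
          by (simp only: of_nat_add of_nat_mult of_nat_1)
        then have m1: "(real m + 1)\<^sup>2 \<le> ((real n + 1) * real (D + 1))\<^sup>2" by (intro power_mono) auto
        have Sle: "S n k / real (D ^ (k - j)) \<le> norm (L n k (b n k))"
        proof -
          have "norm (L n k (b n k)) = fvol n (fst (p n k) # snd (p n k) @ xs)"
            using k by (simp add: nL b_def vol_move)
          then have "S n k \<le> norm (L n k (b n k)) * real (D ^ (k - j))"
            using p[OF k, of n] by (simp only: mult.commute)
          moreover have "0 < real (D ^ (k - j))" using D by simp
          ultimately show ?thesis by (simp only: pos_divide_le_eq)
        qed
        have "c / ((real n + 1) * real (D + 1))\<^sup>2 * (S n k / real (D ^ (k - j)))
            \<le> c / (real m + 1)\<^sup>2 * norm (L n k (b n k))"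
        proof (rule mult_mono[OF _ Sle])
          have "0 < (real n + 1) * real (D + 1)" by (intro mult_pos_pos) auto
          then show "c / ((real n + 1) * real (D + 1))\<^sup>2 \<le> c / (real m + 1)\<^sup>2"
            using c by (intro divide_left_mono[OF m1] mult_pos_pos zero_less_power) auto
          have "0 \<le> S n k" unfolding S_def by (intro sum_nonneg vol_nonneg)
          then show "0 \<le> S n k / real (D ^ (k - j))" by (rule divide_nonneg_nonneg) simp
          show "0 \<le> c / (real m + 1)\<^sup>2" using c by (intro divide_nonneg_nonneg) auto
        qed
        also have "\<dots> \<le> norm (L n k x)" using x[rule_format, of m] unfolding m .
        also have "\<dots> = fvol n (snd (p n k) @ x # xs)" by (rule nL)
        also have "\<dots> \<le> (\<Sum>bs\<in>blists (k - Suc j). fvol n (bs @ x # xs))"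
          using p[OF k, of n] by (intro member_le_sum) (auto simp: vol_nonneg)
        finally have bound: "c / ((real n + 1) * real (D + 1))\<^sup>2 * (S n k / real (D ^ (k - j)))
            \<le> (\<Sum>bs\<in>blists (k - Suc j). fvol n (bs @ x # xs))" .
        have rearrange: "u / v / w * (1 / y * z) = u / (y * v) * (z / w)" for u v w y z :: real
          by simp
        show "C * (1 / (real n + 1)\<^sup>2 * S n k)
            \<le> (\<Sum>bs\<in>blists (k - Suc j). fvol n (bs @ x # xs))"
          using bound unfolding C_def power_mult_distrib rearrange .
      qed
    qed simp
  qed
  then show ?thesis using that unfolding j_def by blast
qed

text \<open>The induction keeps the lower bounds for all larger sizes \<open>k\<close>, since later
  extensions depend on them. New vectors are put in front, so the nested subframes are the suffixes
  of \<open>xs\<close>.\<close>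

lemma generic_frame:
  obtains xs where "length xs = j" "\<forall>i\<le>j. has_rate (\<lambda>n. fvol n (drop (j - i) xs)) (\<Lambda> i)"
proof -
  have "\<exists>xs. length xs = j
      \<and> (\<forall>k\<ge>j. rate_ge (\<lambda>n. \<Sum>bs\<in>blists (k - j). fvol n (bs @ xs)) (\<Lambda> k))
      \<and> (\<forall>i\<le>j. rate_ge (\<lambda>n. fvol n (drop (j - i) xs)) (\<Lambda> i))"
  proof (induction j)
    case 0
    then show ?case using rate_svol rate_ge_const[of 1] by (auto simp: svol_def has_rate_def \<Lambda>_0)
  next
    case (Suc j)
    then obtain xs where xs: "length xs = j"
      "\<And>k. k \<ge> j \<Longrightarrow> rate_ge (\<lambda>n. \<Sum>bs\<in>blists (k - j). fvol n (bs @ xs)) (\<Lambda> k)"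
      "\<And>i. i \<le> j \<Longrightarrow> rate_ge (\<lambda>n. fvol n (drop (j - i) xs)) (\<Lambda> i)" by blast
    obtain x where x: "\<And>k. Suc j \<le> k \<Longrightarrow>
        rate_ge (\<lambda>n. \<Sum>bs\<in>blists (k - Suc j). fvol n (bs @ x # xs)) (\<Lambda> k)"
      using generic_extension[of xs] xs by auto
    have "rate_ge (\<lambda>n. fvol n (drop (Suc j - i) (x # xs))) (\<Lambda> i)" if "i \<le> Suc j" for i
    proof (cases "i = Suc j")
      case True
      then show ?thesis using x[of "Suc j"] by (simp add: blists_0 del: vol.simps)
    next
      case False
      then show ?thesis using xs(3)[of i] that by (simp add: Suc_diff_le)
    qed
    then show ?case using xs x by (intro exI[of _ "x # xs"]) auto
  qed
  then obtain xs where xs: "length xs = j"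
      "\<And>i. i \<le> j \<Longrightarrow> rate_ge (\<lambda>n. fvol n (drop (j - i) xs)) (\<Lambda> i)" by blast
  have "has_rate (\<lambda>n. fvol n (drop (j - i) xs)) (\<Lambda> i)" if "i \<le> j" for i
    using xs rate_vol_le[of "drop (j - i) xs"] that by (simp add: has_rate_def)
  with xs(1) that show ?thesis by blast
qed

text \<open>The residual is the quotient of the volumes with and without \<open>v\<close>;
  finiteness of \<open>a\<close> allows the division.\<close>

lemma rate_res_le:
  assumes "has_rate (\<lambda>n. fvol n ys) (ereal a)"
  shows "rate_le (\<lambda>n. resid n ys v) (\<Lambda> (Suc (length ys)) - ereal a)"
proof -
  have pos: "0 < fvol n ys" for n
    using assms by (intro vol_map_F_pos) (auto simp: has_rate_def)
  have "rate_le (\<lambda>n. fvol n (v # ys) * inverse (fvol n ys))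
      (\<Lambda> (length (v # ys)) + - ereal a)"
    using assms \<Lambda>_less[of "Suc (length ys)"] rate_vol_le[of "v # ys"]
    by (intro rate_le_mult rate_le_inverse) (auto simp: has_rate_def vol_nonneg simp del: vol.simps)
  then show ?thesis
  proof (rule rate_le_mono)
    show "\<forall>\<^sub>F n in sequentially. resid n ys v
        \<le> fvol n (v # ys) * inverse (fvol n ys)"
    proof (rule always_eventually, rule allI)
      fix n
      have "fvol n ys \<noteq> 0" using pos[of n] by simp
      then show "resid n ys v
          \<le> fvol n (v # ys) * inverse (fvol n ys)"
        by (simp add: mult.assoc)
    qed
  qed (simp add: minus_ereal_def)
qed

text \<open>The coefficient \<open>c n\<close> of the residual of \<open>F n v\<close> along the residual of \<open>F n x\<close> is driven only
  by the part of \<open>F n v\<close> orthogonal to both, which is what makes it converge when that part grows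
  more slowly.\<close>

lemma coefficient_recursion:
  assumes pos: "\<And>n. 0 < fvol n (x # ys)"
  defines "d \<equiv> \<lambda>n. resid n ys x"
  obtains c :: "nat \<Rightarrow> real" where
    "\<And>n. \<bar>c (Suc n) - c n\<bar> \<le> svol (Suc 0) (g n) * resid n (x # ys) v * inverse (d (Suc n))"
    "\<And>n a. resid n (x # ys) v \<le> resid n ys (v - a *\<^sub>R x)"
    "\<And>n a. \<bar>c n - a\<bar> * d n \<le> resid n ys (v - a *\<^sub>R x)"
    "\<And>n a. resid n ys (v - a *\<^sub>R x)
        \<le> resid n (x # ys) v + \<bar>c n - a\<bar> * d n"
proof -
  define R where "R n = res (map (F n) ys)" for n
  define z where "z n = R n (F n x)" for n
  define r where "r n = R n (F n v)" for n
  define c where "c n = (r n \<bullet> z n) / (z n \<bullet> z n)" for n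
  define e where "e n = res (map (F n) (x # ys)) (F n v)" for n
  have d: "d n = norm (z n)" for n by (simp add: d_def z_def R_def)
  have z0: "z n \<noteq> 0" for n using pos[of n] by (auto simp: z_def R_def)
  have linR: "linear (R n)" for n unfolding R_def by (rule linear_res)
  have e: "r n = c n *\<^sub>R z n + e n" for n
    by (simp add: e_def c_def r_def z_def R_def)
  have orth: "z n \<bullet> e n = 0" for n
    using z0[of n] by (simp add: e_def c_def r_def z_def R_def inner_diff_right inner_commute)
  \<comment> \<open>\<open>g n\<close> carries the span of the old images of \<open>ys\<close> into
    the span of the new ones, so only the residual of \<open>F n y\<close> matters for the next
    residual. Linear independence of the images is preserved by positivity of the volumes.\<close>
  have step: "R (Suc n) (F (Suc n) y) = R (Suc n) (g n (R n (F n y)))" for n y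
    unfolding R_def
  proof (rule res_cong)
    have "F n y - res (map (F n) ys) (F n y) \<in> span (set (map (F n) ys))" by (rule diff_res_in_span)
    then have "g n (F n y - res (map (F n) ys) (F n y)) \<in> g n ` span (set (map (F n) ys))" by blast
    then show "F (Suc n) y - g n (res (map (F n) ys) (F n y)) \<in> span (set (map (F (Suc n)) ys))"
      by (simp add: linear_span_image[OF linear_g, symmetric] F_Suc linear_diff[OF linear_g] image_comp)
  qed
  have r_Suc: "r (Suc n) = c n *\<^sub>R z (Suc n) + R (Suc n) (g n (e n))" for n
    unfolding r_def z_def step
    unfolding r_def[symmetric] z_def[symmetric] e[of n]
    by (simp add: linear_add[OF linear_g] linear_scale[OF linear_g] linear_add[OF linR] linear_scale[OF linR])
  have "\<bar>c (Suc n) - c n\<bar> \<le> svol (Suc 0) (g n) * norm (e n) * inverse (d (Suc n))" for n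
  proof -
    let ?z = "z (Suc n)" and ?w = "R (Suc n) (g n (e n))"
    have "?z \<bullet> ?z \<noteq> 0" using z0 by simp
    then have "c (Suc n) - c n = (?w \<bullet> ?z) / (?z \<bullet> ?z)"
      by (simp add: c_def[of "Suc n"] r_Suc inner_add_left add_divide_distrib)
    then have "\<bar>c (Suc n) - c n\<bar> = \<bar>?w \<bullet> ?z\<bar> / (norm ?z * norm ?z)"
      by (simp add: abs_divide flip: power2_norm_eq_inner power2_eq_square)
    also have "\<dots> \<le> (norm ?w * norm ?z) / (norm ?z * norm ?z)"
      by (intro divide_right_mono Cauchy_Schwarz_ineq2) auto
    also have "\<dots> = norm ?w * inverse (d (Suc n))" using z0[of "Suc n"] by (simp add: d divide_inverse)
    also have "\<dots> \<le> svol (Suc 0) (g n) * norm (e n) * inverse (d (Suc n))"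
    proof (rule mult_right_mono)
      have "norm ?w \<le> norm (g n (e n))" unfolding R_def by (rule norm_res_le)
      also have "\<dots> \<le> svol (Suc 0) (g n) * norm (e n)" by (rule norm_le_svol[OF linear_g])
      finally show "norm ?w \<le> svol (Suc 0) (g n) * norm (e n)" .
    qed (simp add: d)
    finally show ?thesis .
  qed
  moreover have dec: "R n (F n (v - a *\<^sub>R x)) = (c n - a) *\<^sub>R z n + e n" for n a
  proof -
    have "R n (F n (v - a *\<^sub>R x)) = r n - a *\<^sub>R z n"
      by (simp add: r_def z_def linear_diff[OF linear_F] linear_scale[OF linear_F]
          linear_diff[OF linR] linear_scale[OF linR])
    then show ?thesis by (simp add: e scaleR_diff_left)
  qed
  have sq: "(norm (R n (F n (v - a *\<^sub>R x))))\<^sup>2 = (\<bar>c n - a\<bar> * d n)\<^sup>2 + (norm (e n))\<^sup>2" for n a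
    unfolding dec
    by (subst norm_add_Pythagorean) (simp_all add: orthogonal_def orth d power_mult_distrib)
  have "norm (e n) \<le> norm (R n (F n (v - a *\<^sub>R x)))" for n a
    by (rule power2_le_imp_le) (simp_all add: sq)
  moreover have "\<bar>c n - a\<bar> * d n \<le> norm (R n (F n (v - a *\<^sub>R x)))" for n a
    by (rule power2_le_imp_le) (simp_all add: sq)
  moreover have "norm (R n (F n (v - a *\<^sub>R x))) \<le> norm (e n) + \<bar>c n - a\<bar> * d n" for n a
    unfolding dec using norm_triangle_ineq[of "(c n - a) *\<^sub>R z n" "e n"] by (simp add: d)
  ultimately show ?thesis unfolding e_def R_def by (rule that)
qed

lemma \<Lambda>_real: "\<Lambda> k \<noteq> - \<infinity> \<Longrightarrow> \<exists>a. \<Lambda> k = ereal a"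
  using \<Lambda>_less[of k] by (cases "\<Lambda> k") auto

text \<open>The coordinate along \<open>x\<close> grows at \<open>b - a\<close>. If
  \<open>\<rho>\<close> is smaller, the coefficient converges to some \<open>l\<close> at rate
  \<open>\<rho> - (b - a)\<close>, so subtracting \<open>l *\<^sub>R x\<close> leaves rate
  \<open>\<rho>\<close>. Without the subtraction the rate is \<open>b - a\<close> when
  \<open>l \<noteq> 0\<close>. If \<open>\<rho>\<close> equals \<open>b - a\<close>, upper and lower
  bounds already meet.\<close>

lemma residual_rate_step:
  assumes ys: "has_rate (\<lambda>n. fvol n ys) (ereal a)"
    and xys: "has_rate (\<lambda>n. fvol n (x # ys)) (ereal b)"
    and \<Lambda>b: "\<Lambda> (Suc (length ys)) = ereal b"
    and \<rho>: "has_rate (\<lambda>n. resid n (x # ys) v) \<rho>"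
  shows "\<rho> \<le> ereal (b - a)"
    and "\<rho> < ereal (b - a) \<Longrightarrow> \<exists>l. has_rate (\<lambda>n. resid n ys (v - l *\<^sub>R x)) \<rho>"
    and "\<exists>\<rho>'. has_rate (\<lambda>n. resid n ys v) \<rho>'"
proof -
  define d where "d n = resid n ys x" for n
  define q where "q n = resid n (x # ys) v" for n
  have pos: "0 < fvol n (x # ys)" for n
    using xys vol_map_F_pos unfolding has_rate_def by blast
  have ypos: "0 < fvol n ys" for n
    using ys vol_map_F_pos unfolding has_rate_def by blast
  have dpos: "0 < d n" for n
    using pos[of n] ypos[of n] by (simp add: d_def zero_less_mult_iff)
  have d_le: "rate_le d (ereal (b - a))"
    using rate_res_le[OF ys, of x] unfolding \<Lambda>b d_def by simp
  have d_ge: "rate_ge d (ereal (b - a))"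
  proof -
    have "rate_ge (\<lambda>n. fvol n (x # ys) * inverse (fvol n ys)) (ereal b + - ereal a)"
      using xys ys ypos by (intro rate_ge_mult rate_ge_inverse) (auto simp: has_rate_def simp del: vol.simps)
    moreover have "fvol n (x # ys) * inverse (fvol n ys) = d n" for n
      using ypos[of n] by (simp add: d_def mult.assoc)
    ultimately show ?thesis by simp
  qed
  obtain c where c: "\<And>n. \<bar>c (Suc n) - c n\<bar> \<le> svol (Suc 0) (g n) * q n * inverse (d (Suc n))"
    and lower1: "\<And>n a. q n \<le> resid n ys (v - a *\<^sub>R x)"
    and lower2: "\<And>n a. \<bar>c n - a\<bar> * d n \<le> resid n ys (v - a *\<^sub>R x)"
    and upper: "\<And>n a. resid n ys (v - a *\<^sub>R x) \<le> q n + \<bar>c n - a\<bar> * d n"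
    using coefficient_recursion[OF pos, of v] unfolding d_def q_def by blast
  have r_le: "rate_le (\<lambda>n. resid n ys v) (ereal (b - a))"
    using rate_res_le[OF ys, of v] unfolding \<Lambda>b by simp
  have q_le: "q n \<le> resid n ys v" for n using lower1[of n 0] by simp
  have "has_rate q \<rho>" unfolding q_def[abs_def] by (rule \<rho>)
  then have q_rate: "rate_le q \<rho>" "rate_ge q \<rho>" unfolding has_rate_def by simp_all
  have q0: "0 \<le> q n" for n by (simp add: q_def)
  have ge_\<rho>: "rate_ge (\<lambda>n. resid n ys v) \<rho>"
    by (rule rate_ge_mono[OF q_rate(2)]) (auto intro: q_le always_eventually)
  then show \<rho>_le: "\<rho> \<le> ereal (b - a)" using r_le by (rule rate_ge_le)
  have conv: "\<exists>l. rate_le (\<lambda>n. \<bar>c n - l\<bar>) (\<rho> - ereal (b - a)) \<and>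
      has_rate (\<lambda>n. resid n ys (v - l *\<^sub>R x)) \<rho>" if less: "\<rho> < ereal (b - a)"
  proof -
    have "rate_le (\<lambda>n. svol (Suc 0) (g n) * q n * inverse (d (Suc n))) (0 + \<rho> + - ereal (b - a))"
      using \<rho>_le dpos less_imp_le[OF dpos]
      by (intro rate_le_mult rate_g q_rate rate_le_inverse rate_ge_Suc d_ge)
        (auto simp: svol_nonneg q0)
    then have "rate_le (\<lambda>n. \<bar>c (Suc n) - c n\<bar>) (\<rho> - ereal (b - a))"
      by (rule rate_le_mono) (auto simp: minus_ereal_def intro!: always_eventually c)
    moreover have neg: "\<rho> - ereal (b - a) < 0" using less by (cases \<rho>) auto
    ultimately obtain l where l: "rate_le (\<lambda>n. \<bar>c n - l\<bar>) (\<rho> - ereal (b - a))"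
      by (rule rate_le_convergent)
    have "rate_le (\<lambda>n. \<bar>c n - l\<bar> * d n) (\<rho> - ereal (b - a) + ereal (b - a))"
      using l d_le neg less_imp_le[OF dpos] by (intro rate_le_mult) auto
    moreover have "\<rho> - ereal (b - a) + ereal (b - a) = \<rho>" using less by (cases \<rho>) auto
    ultimately have "rate_le (\<lambda>n. q n + \<bar>c n - l\<bar> * d n) \<rho>"
      using q_rate by (intro rate_le_add) auto
    then have "rate_le (\<lambda>n. resid n ys (v - l *\<^sub>R x)) \<rho>"
      by (rule rate_le_mono) (auto intro: upper always_eventually)
    moreover have "rate_ge (\<lambda>n. resid n ys (v - l *\<^sub>R x)) \<rho>"
      by (rule rate_ge_mono[OF q_rate(2)]) (auto intro: lower1 always_eventually)
    ultimately show ?thesis using l by (auto simp: has_rate_def)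
  qed
  then show "\<rho> < ereal (b - a) \<Longrightarrow> \<exists>l. has_rate (\<lambda>n. resid n ys (v - l *\<^sub>R x)) \<rho>"
    by blast
  show "\<exists>\<rho>'. has_rate (\<lambda>n. resid n ys v) \<rho>'"
  proof (cases "\<rho> < ereal (b - a)")
    case False
    then have "has_rate (\<lambda>n. resid n ys v) \<rho>"
      using \<rho>_le ge_\<rho> r_le by (auto simp: has_rate_def)
    then show ?thesis by blast
  next
    case less: True
    then obtain l where l: "rate_le (\<lambda>n. \<bar>c n - l\<bar>) (\<rho> - ereal (b - a))"
      "has_rate (\<lambda>n. resid n ys (v - l *\<^sub>R x)) \<rho>" using conv by blast
    show ?thesis
    proof (cases "l = 0")
      case True
      then show ?thesis using l by auto
    next
      case False
      have "\<rho> - ereal (b - a) < ereal 0" using less by (cases \<rho>) auto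
      then obtain s where s: "\<rho> - ereal (b - a) < ereal s" "s < 0" by (rule ereal_real_between)
      have "\<forall>\<^sub>F n in sequentially. \<bar>l\<bar> / 2 \<le> \<bar>c n\<bar>"
        using rate_leD[OF l(1) s(1)] eventually_const_exp_le[OF s(2), of "2 / \<bar>l\<bar>"]
      proof eventually_elim
        case (elim n)
        have "exp (s * real n) \<le> \<bar>l\<bar> / 2" using elim(2) False by (simp add: field_simps)
        then show ?case using elim(1) by linarith
      qed
      then have "\<forall>\<^sub>F n in sequentially. \<bar>l\<bar> / 2 * d n \<le> resid n ys v"
      proof eventually_elim
        case (elim n)
        have "\<bar>l\<bar> / 2 * d n \<le> \<bar>c n\<bar> * d n" using elim dpos[of n] by (intro mult_right_mono) auto
        also have "\<dots> \<le> resid n ys v" using lower2[of n 0] by simp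
        finally show ?case .
      qed
      then have "rate_ge (\<lambda>n. resid n ys v) (ereal (b - a))"
        using False by (intro rate_ge_mono[OF rate_ge_cmult[OF d_ge, of "\<bar>l\<bar> / 2"]]) auto
      then show ?thesis using r_le by (auto simp: has_rate_def)
    qed
  qed
qed

text \<open>Beyond the \<open>k\<close> finite rates every residual decays superexponentially, which
  is an exact rate. From there the frame vectors are removed one by one.\<close>

lemma residual_has_rate:
  assumes xs: "length xs = j" "\<forall>i\<le>j. has_rate (\<lambda>n. fvol n (drop (j - i) xs)) (\<Lambda> i)"
    and fin: "\<forall>i\<le>k. \<Lambda> i \<noteq> - \<infinity>" and Suc: "\<Lambda> (Suc k) = - \<infinity>"
    and "i \<le> k" "k \<le> j"
  shows "\<exists>\<rho>. has_rate (\<lambda>n. resid n (drop (j - i) xs) v) \<rho>"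
  using \<open>i \<le> k\<close>
proof (induction i arbitrary: v rule: inc_induct)
  case base
  obtain a where a: "\<Lambda> k = ereal a" using fin \<Lambda>_real by blast
  have "has_rate (\<lambda>n. fvol n (drop (j - k) xs)) (ereal a)" using xs(2)[rule_format, OF \<open>k \<le> j\<close>] a by simp
  from rate_res_le[OF this, of v] have "rate_le (\<lambda>n. resid n (drop (j - k) xs) v) (- \<infinity>)"
    using xs(1) \<open>k \<le> j\<close> Suc by simp
  then show ?case using has_rate_MInf by blast
next
  case (step i)
  have "\<Lambda> i \<noteq> - \<infinity>" "\<Lambda> (Suc i) \<noteq> - \<infinity>" using fin step.hyps by auto
  then obtain a b where ab: "\<Lambda> i = ereal a" "\<Lambda> (Suc i) = ereal b" using \<Lambda>_real by blast
  have i: "i < j" using step.hyps \<open>k \<le> j\<close> by simp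
  define x where "x = xs ! (j - Suc i)"
  have dr: "drop (j - Suc i) xs = x # drop (j - i) xs"
    using i xs(1) Cons_nth_drop_Suc[of "j - Suc i" xs] by (simp add: x_def Suc_diff_Suc)
  obtain \<rho> where "has_rate (\<lambda>n. resid n (drop (j - Suc i) xs) v) \<rho>"
    using step.IH by blast
  then show ?case
    using residual_rate_step(3)[of "drop (j - i) xs" a x b v \<rho>] xs(2)[rule_format, of i] xs(2)[rule_format, of "Suc i"] i xs(1) ab
    unfolding dr by simp
qed

lemma \<Lambda>_cutoff:
  obtains k where "\<forall>i\<le>k. \<Lambda> i \<noteq> - \<infinity>" "\<Lambda> (Suc k) = - \<infinity>" "k \<le> DIM('a)"
proof -
  define m where "m = (LEAST k. \<Lambda> k = - \<infinity>)"
  have ex: "\<Lambda> (Suc DIM('a)) = - \<infinity>" by (rule \<Lambda>_eq_MInf) simp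
  then have m: "\<Lambda> m = - \<infinity>" "m \<le> Suc DIM('a)" unfolding m_def by (auto intro: LeastI Least_le)
  have "m \<noteq> 0"
  proof
    assume "m = 0"
    then show False using m(1) \<Lambda>_0 by simp
  qed
  then obtain k where k: "m = Suc k" by (cases m) auto
  show ?thesis
  proof (rule that[of k])
    show "\<forall>i\<le>k. \<Lambda> i \<noteq> - \<infinity>"
    proof (intro allI impI)
      fix i assume "i \<le> k"
      then have "i < (LEAST k. \<Lambda> k = - \<infinity>)" using k by (simp add: m_def)
      then show "\<Lambda> i \<noteq> - \<infinity>" by (rule not_less_Least)
    qed
  qed (use m k in auto)
qed

text \<open>This is the case of an empty frame, where the residual is the vector itself.\<close>

theorem has_rate_norm_F: "\<exists>\<rho>. has_rate (\<lambda>n. norm (F n v)) \<rho>"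
proof -
  obtain k where k: "\<forall>i\<le>k. \<Lambda> i \<noteq> - \<infinity>" "\<Lambda> (Suc k) = - \<infinity>" "k \<le> DIM('a)"
    by (rule \<Lambda>_cutoff)
  obtain xs where xs: "length xs = DIM('a)"
    "\<forall>i\<le>DIM('a). has_rate (\<lambda>n. fvol n (drop (DIM('a) - i) xs)) (\<Lambda> i)"
    by (rule generic_frame)
  show ?thesis using residual_has_rate[OF xs k(1) k(2) _ k(3), of 0 v] xs(1) by simp
qed

lemma rate_le_norm_F: "rate_le (\<lambda>n. norm (F n v)) (\<Lambda> 1)"
  using rate_vol_le[of "[v]"] by simp

text \<open>The first two frame vectors decide between two pictures. With a gap, every vector is a
  multiple of \<open>x\<close> plus a vector of rate at most the second exponent; without one, all
  nonzero combinations of \<open>x\<close> and \<open>y\<close> grow at the top rate.\<close>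

lemma top_exponents:
  assumes "DIM('a) \<ge> 2" and \<Lambda>1: "\<Lambda> 1 \<noteq> - \<infinity>"
  obtains x where "has_rate (\<lambda>n. norm (F n x)) (\<Lambda> 1)"
    and "\<Lambda> 2 - \<Lambda> 1 \<le> \<Lambda> 1"
    and "\<Lambda> 2 - \<Lambda> 1 < \<Lambda> 1 \<longrightarrow> (\<forall>v. \<exists>l. rate_le (\<lambda>n. norm (F n (v - l *\<^sub>R x))) (\<Lambda> 2 - \<Lambda> 1))"
    and "\<Lambda> 2 - \<Lambda> 1 < \<Lambda> 1 \<longrightarrow> (\<exists>v. v \<noteq> 0 \<and> has_rate (\<lambda>n. norm (F n v)) (\<Lambda> 2 - \<Lambda> 1))"
    and "\<Lambda> 2 - \<Lambda> 1 = \<Lambda> 1 \<longrightarrow>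
      (\<exists>y. \<forall>\<alpha> \<beta>. \<alpha> \<noteq> 0 \<or> \<beta> \<noteq> 0 \<longrightarrow> has_rate (\<lambda>n. norm (F n (\<alpha> *\<^sub>R x + \<beta> *\<^sub>R y))) (\<Lambda> 1))"
    and "\<exists>y. has_rate (\<lambda>n. vol [F n y, F n x]) (\<Lambda> 2)"
proof -
  define D where "D = DIM('a)"
  obtain k where k: "\<forall>i\<le>k. \<Lambda> i \<noteq> - \<infinity>" "\<Lambda> (Suc k) = - \<infinity>" "k \<le> D"
    unfolding D_def by (rule \<Lambda>_cutoff)
  have k1: "1 \<le> k"
  proof (rule ccontr)
    assume "\<not> 1 \<le> k"
    then have "k = 0" by simp
    then show False using k(2) \<Lambda>1 by simp
  qed
  obtain xs where xs: "length xs = D"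
    "\<forall>i\<le>D. has_rate (\<lambda>n. fvol n (drop (D - i) xs)) (\<Lambda> i)"
    by (rule generic_frame)
  have D: "2 \<le> D" using assms by (simp add: D_def)
  define x where "x = xs ! (D - 1)"
  define y where "y = xs ! (D - 2)"
  have dx: "drop (D - 1) xs = [x]"
    using Cons_nth_drop_Suc[of "D - 1" xs] D xs(1) by (simp add: x_def)
  have dy: "drop (D - 2) xs = [y, x]"
    using Cons_nth_drop_Suc[of "D - 2" xs] D xs(1) dx by (simp add: y_def Suc_diff_Suc numeral_2_eq_2)
  have x: "has_rate (\<lambda>n. norm (F n x)) (\<Lambda> 1)" using xs(2)[rule_format, of 1, unfolded dx] D by simp
  have yx: "has_rate (\<lambda>n. fvol n [y, x]) (\<Lambda> 2)" using xs(2)[rule_format, of 2, unfolded dy] D by (simp del: vol.simps)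
  obtain a where a: "\<Lambda> 1 = ereal a" using \<Lambda>_real \<Lambda>1 by blast
  have vx: "has_rate (\<lambda>n. fvol n [x]) (ereal a)" using x a by simp
  have v0: "has_rate (\<lambda>n. fvol n []) (ereal 0)"
    using rate_svol[of 0] \<Lambda>_0 by (simp add: zero_ereal_def)
  have rr: "\<exists>\<rho>. has_rate (\<lambda>n. resid n [x] v) \<rho>" for v
    using residual_has_rate[OF xs k(1) k(2) k1 k(3), of v] unfolding dx by simp
  have rle: "rate_le (\<lambda>n. resid n [x] v) (\<Lambda> 2 - \<Lambda> 1)" for v
    using rate_res_le[OF vx, of v] a by (simp add: numeral_2_eq_2)
  have step: "\<exists>l. has_rate (\<lambda>n. norm (F n (v - l *\<^sub>R x))) \<rho>"
    if "has_rate (\<lambda>n. resid n [x] v) \<rho>" "\<rho> < \<Lambda> 1" for v \<rho>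
    using residual_rate_step(2)[OF v0 vx _ that(1)] that(2) a by simp
  have yr: "has_rate (\<lambda>n. resid n [x] y) (\<Lambda> 2 - \<Lambda> 1)"
  proof -
    have xp: "0 < norm (F n x)" for n
      using vol_map_F_pos[of "[x]" a n] vx by (simp add: has_rate_def)
    have "rate_ge (\<lambda>n. fvol n [y, x] * inverse (norm (F n x))) (\<Lambda> 2 + - \<Lambda> 1)"
      using yx x xp a \<Lambda>_less[of 2] by (intro rate_ge_mult rate_ge_inverse) (auto simp: has_rate_def simp del: vol.simps)
    moreover have "(\<lambda>n. fvol n [y, x] * inverse (norm (F n x))) = (\<lambda>n. resid n [x] y)"
    proof
      fix n
      have "norm (F n x) * inverse (norm (F n x)) = 1" using xp[of n] by simp
      then show "fvol n [y, x] * inverse (norm (F n x)) = resid n [x] y"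
        by (simp add: mult.assoc)
    qed
    ultimately show ?thesis using rle[of y] unfolding has_rate_def minus_ereal_def by metis
  qed
  have le: "\<Lambda> 2 - \<Lambda> 1 \<le> \<Lambda> 1"
    using residual_rate_step(1)[OF v0 vx _ yr] a by simp
  show ?thesis
  proof (rule that[of x]; (intro impI)?)
    assume less: "\<Lambda> 2 - \<Lambda> 1 < \<Lambda> 1"
    show approx: "\<forall>v. \<exists>l. rate_le (\<lambda>n. norm (F n (v - l *\<^sub>R x))) (\<Lambda> 2 - \<Lambda> 1)"
    proof
      fix v
      obtain \<rho> where \<rho>: "has_rate (\<lambda>n. resid n [x] v) \<rho>" using rr by blast
      then have \<rho>_le: "\<rho> \<le> \<Lambda> 2 - \<Lambda> 1" using rle[of v] rate_ge_le unfolding has_rate_def by blast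
      then obtain l where "has_rate (\<lambda>n. norm (F n (v - l *\<^sub>R x))) \<rho>"
        using step[OF \<rho> order_le_less_trans[OF \<rho>_le less]] by blast
      then show "\<exists>l. rate_le (\<lambda>n. norm (F n (v - l *\<^sub>R x))) (\<Lambda> 2 - \<Lambda> 1)"
        unfolding has_rate_def using rate_le_weaken[OF _ \<rho>_le] by blast
    qed
    show "\<exists>v. v \<noteq> 0 \<and> has_rate (\<lambda>n. norm (F n v)) (\<Lambda> 2 - \<Lambda> 1)"
    proof (cases "\<Lambda> 2 = - \<infinity>")
      case True
      \<comment> \<open>When the second rate is \<open>-\<infinity>\<close>, the vector
        \<open>y\<close> corrected by a multiple of \<open>x\<close> might be zero. A vector off the
        line of \<open>x\<close> stays nonzero, and the lower bound on its rate is void.\<close>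
      have "\<not> (UNIV :: 'a set) \<subseteq> span {x}"
      proof
        assume "(UNIV :: 'a set) \<subseteq> span {x}"
        then have "DIM('a) \<le> card {x}" using dim_le_card[of UNIV "{x}"] by (simp add: dim_UNIV)
        then show False using assms by simp
      qed
      then obtain v where v: "v \<notin> span {x}" by blast
      obtain l where l: "rate_le (\<lambda>n. norm (F n (v - l *\<^sub>R x))) (\<Lambda> 2 - \<Lambda> 1)"
        using approx by blast
      have "v - l *\<^sub>R x \<noteq> 0" using v by (metis eq_iff_diff_eq_0 insertI1 span_base span_scale)
      moreover have "has_rate (\<lambda>n. norm (F n (v - l *\<^sub>R x))) (\<Lambda> 2 - \<Lambda> 1)"
        using l True a by (simp add: has_rate_MInf)
      ultimately show ?thesis by blast
    next
      case False
      obtain l where l: "has_rate (\<lambda>n. norm (F n (y - l *\<^sub>R x))) (\<Lambda> 2 - \<Lambda> 1)"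
        using step[OF yr less] by blast
      have "y - l *\<^sub>R x \<noteq> 0"
      proof
        assume "y - l *\<^sub>R x = 0"
        then have "has_rate (\<lambda>n. 0) (\<Lambda> 2 - \<Lambda> 1)" using l by (simp add: linear_0[OF linear_F])
        then have "\<Lambda> 2 - \<Lambda> 1 = - \<infinity>"
          using has_rate_unique rate_le_zero has_rate_MInf by blast
        then show False using False a by (cases "\<Lambda> 2") auto
      qed
      then show ?thesis using l by blast
    qed
  next
    assume eq: "\<Lambda> 2 - \<Lambda> 1 = \<Lambda> 1"
    have "has_rate (\<lambda>n. norm (F n (\<alpha> *\<^sub>R x + \<beta> *\<^sub>R y))) (\<Lambda> 1)" if ab: "\<alpha> \<noteq> 0 \<or> \<beta> \<noteq> 0" for \<alpha> \<beta>
    proof -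
      have "rate_ge (\<lambda>n. norm (F n (\<alpha> *\<^sub>R x + \<beta> *\<^sub>R y))) (\<Lambda> 1)"
      proof (cases "\<beta> = 0")
        case True
        then show ?thesis using ab x rate_ge_cmult[of "\<lambda>n. norm (F n x)" "\<Lambda> 1" "\<bar>\<alpha>\<bar>"]
          by (simp add: has_rate_def linear_scale[OF linear_F])
      next
        case False
        have "rate_ge (\<lambda>n. \<bar>\<beta>\<bar> * resid n [x] y) (\<Lambda> 1)"
          using yr False unfolding eq has_rate_def by (intro rate_ge_cmult) auto
        then show ?thesis
        proof (rule rate_ge_mono)
          show "\<forall>\<^sub>F n in sequentially. \<bar>\<beta>\<bar> * resid n [x] y
              \<le> norm (F n (\<alpha> *\<^sub>R x + \<beta> *\<^sub>R y))"
          proof (rule always_eventually, rule allI)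
            fix n
            have "res (map (F n) [x]) (F n (\<alpha> *\<^sub>R x + \<beta> *\<^sub>R y)) = res (map (F n) [x]) (\<beta> *\<^sub>R F n y)"
              by (rule res_cong)
                (simp add: linear_add[OF linear_F] linear_scale[OF linear_F] span_scale span_base)
            then have "\<bar>\<beta>\<bar> * resid n [x] y
                = resid n [x] (\<alpha> *\<^sub>R x + \<beta> *\<^sub>R y)"
              by (simp only: linear_scale[OF linear_res] norm_scaleR)
            also have "\<dots> \<le> norm (F n (\<alpha> *\<^sub>R x + \<beta> *\<^sub>R y))" by (rule norm_res_le)
            finally show "\<bar>\<beta>\<bar> * resid n [x] y \<le> \<dots>" .
          qed
        qed simp
      qed
      then show ?thesis using rate_le_norm_F by (simp add: has_rate_def)
    qed
    then show "\<exists>y. \<forall>\<alpha> \<beta>. \<alpha> \<noteq> 0 \<or> \<beta> \<noteq> 0 \<longrightarrow> has_rate (\<lambda>n. norm (F n (\<alpha> *\<^sub>R x + \<beta> *\<^sub>R y))) (\<Lambda> 1)"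
      by blast
  next
    show "\<exists>y. has_rate (\<lambda>n. vol [F n y, F n x]) (\<Lambda> 2)" using yx by (auto simp del: vol.simps)
  qed (use x le in auto)
qed

end

section \<open>The Lyapunov spectrum of a realization\<close>

lemma lyapunov_space_iff:
  "x \<in> lyapunov_space a \<mu> \<longleftrightarrow> rate_le (\<lambda>n. norm (forward_product a n *v x)) \<mu>"
  by (simp add: lyapunov_space_def lyapunov_growth_def rate_le_iff_limsup)

lemma lyapunov_growth_eq:
  assumes "has_rate (\<lambda>n. norm (forward_product a n *v x)) \<mu>"
  shows "lyapunov_growth a x = \<mu>"
  using assms unfolding has_rate_iff_tendsto lyapunov_growth_def
  by (intro lim_imp_Limsup) auto

lemma subspace_lyapunov_space: "subspace (lyapunov_space a \<mu>)"
proof (rule subspaceI)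
  show "0 \<in> lyapunov_space a \<mu>" by (simp add: lyapunov_space_iff rate_le_zero)
  fix x y assume "x \<in> lyapunov_space a \<mu>" "y \<in> lyapunov_space a \<mu>"
  then have "rate_le (\<lambda>n. norm (forward_product a n *v x) + norm (forward_product a n *v y)) \<mu>"
    by (intro rate_le_add) (auto simp: lyapunov_space_iff)
  then show "x + y \<in> lyapunov_space a \<mu>"
    unfolding lyapunov_space_iff
    by (rule rate_le_mono) (auto intro!: always_eventually norm_triangle_ineq simp: matrix_vector_right_distrib)
next
  fix c x assume "x \<in> lyapunov_space a \<mu>"
  then have "rate_le (\<lambda>n. \<bar>c\<bar> * norm (forward_product a n *v x)) \<mu>"
    by (intro rate_le_cmult) (auto simp: lyapunov_space_iff)
  then show "c *\<^sub>R x \<in> lyapunov_space a \<mu>"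
    by (simp add: lyapunov_space_iff matrix_vector_mult_scaleR)
qed

lemma lyapunov_space_mono: "\<mu> \<le> \<nu> \<Longrightarrow> lyapunov_space a \<mu> \<subseteq> lyapunov_space a \<nu>"
  by (auto simp: lyapunov_space_def)

lemma dim_lyapunov_space_less:
  assumes "\<mu> < lyapunov_growth a x" "lyapunov_growth a x \<le> \<nu>"
  shows "dim (lyapunov_space a \<mu>) < dim (lyapunov_space a \<nu>)"
proof (rule ccontr)
  assume "\<not> ?thesis"
  then have "lyapunov_space a \<mu> = lyapunov_space a \<nu>"
    using assms by (intro subspace_dim_equal subspace_lyapunov_space lyapunov_space_mono) auto
  moreover have "x \<in> lyapunov_space a \<nu>" "x \<notin> lyapunov_space a \<mu>"
    using assms by (auto simp: lyapunov_space_def)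
  ultimately show False by simp
qed

text \<open>Distinct growth values have Lyapunov spaces of distinct dimensions. This holds for every
  sequence of matrices, since limsups alone already make these sets subspaces.\<close>

lemma finite_lyapunov_growth:
  fixes a :: "nat \<Rightarrow> real^'p^'p"
  shows "finite (lyapunov_growth a ` (UNIV - {0}))"
proof (rule inj_on_finite)
  let ?V = "lyapunov_growth a ` (UNIV - {0})"
  show "inj_on (\<lambda>\<mu>. dim (lyapunov_space a \<mu>)) ?V"
  proof (rule linorder_inj_onI)
    fix \<mu> \<nu> assume "\<mu> < \<nu>" "\<nu> \<in> ?V"
    then obtain x where "\<nu> = lyapunov_growth a x" by auto
    then show "dim (lyapunov_space a \<mu>) \<noteq> dim (lyapunov_space a \<nu>)"
      using dim_lyapunov_space_less[of \<mu> a x \<nu>] \<open>\<mu> < \<nu>\<close> by simp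
  qed auto
  show "(\<lambda>\<mu>. dim (lyapunov_space a \<mu>)) ` ?V \<subseteq> {..CARD('p)}"
    by (auto intro: order_trans[OF dim_subset_UNIV])
qed simp

lemma set_lyapunov_values: "set (lyapunov_values a) = lyapunov_growth a ` (UNIV - {0})"
  by (simp add: lyapunov_values_def finite_lyapunov_growth)

lemma sorted_lyapunov_values: "sorted_wrt (>) (lyapunov_values a)"
  by (simp add: lyapunov_values_def sorted_wrt_rev)

lemma lyapunov_values_hd:
  assumes "x \<noteq> 0" "\<And>y. lyapunov_growth a y \<le> lyapunov_growth a x"
  obtains vs where "lyapunov_values a = lyapunov_growth a x # vs"
proof -
  have x: "lyapunov_growth a x \<in> set (lyapunov_values a)"
    using assms by (auto simp: set_lyapunov_values)
  then obtain v vs where v: "lyapunov_values a = v # vs" by (cases "lyapunov_values a") auto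
  have "v \<in> set (lyapunov_values a)" using v by simp
  then have "v \<le> lyapunov_growth a x" using assms(2) by (auto simp: set_lyapunov_values)
  moreover have "lyapunov_growth a x \<le> v"
    using x sorted_lyapunov_values[of a] v by (auto simp: less_imp_le)
  ultimately show ?thesis using that v by auto
qed

lemma lyapunov_flag_Suc_psubset:
  assumes "r < length (lyapunov_values a)"
  shows "dim (lyapunov_flag a (Suc r)) < dim (lyapunov_flag a r)"
proof -
  have "lyapunov_values a ! r \<in> lyapunov_growth a ` (UNIV - {0})"
    using assms by (simp flip: set_lyapunov_values)
  then obtain x where x: "x \<noteq> 0" "lyapunov_growth a x = lyapunov_values a ! r"
    by (metis DiffE imageE singletonI)
  show ?thesis
  proof (cases "Suc r < length (lyapunov_values a)")
    case True
    then have "lyapunov_values a ! Suc r < lyapunov_values a ! r"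
      using sorted_wrt_nth_less[OF sorted_lyapunov_values, of r "Suc r" a] by simp
    then show ?thesis
      using True assms x dim_lyapunov_space_less[of "lyapunov_values a ! Suc r" a x]
      by (simp add: lyapunov_flag_def)
  next
    case False
    have "x \<in> lyapunov_flag a r" using x assms by (simp add: lyapunov_flag_def lyapunov_space_def)
    then have "dim (lyapunov_flag a r) \<noteq> 0" using x by (auto simp: dim_eq_0)
    moreover have "dim (lyapunov_flag a (Suc r)) = 0" using False by (simp add: lyapunov_flag_def)
    ultimately show ?thesis by linarith
  qed
qed

text \<open>The second entry lies in the first block if that has multiplicity at least two, and
  otherwise heads the rest; this form serves both cases.\<close>

lemma lyapunov_spectrum_Cons:
  assumes "lyapunov_values a = v # vs"
  obtains ws where "lyapunov_spectrum a =
    replicate (dim (lyapunov_flag a 0) - dim (lyapunov_flag a 1)) v @ ws"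
    and "vs \<noteq> [] \<longrightarrow> ws \<noteq> [] \<and> ws ! 0 = vs ! 0"
proof -
  define f where "f r = replicate (dim (lyapunov_flag a r) - dim (lyapunov_flag a (Suc r))) (lyapunov_values a ! r)" for r
  have "0 < length (lyapunov_values a)" using assms by simp
  from upt_conv_Cons[OF this] have "[0..<length (lyapunov_values a)] = 0 # [1..<length (lyapunov_values a)]"
    by (simp only: One_nat_def)
  then have "lyapunov_spectrum a = f 0 @ concat (map f [1..<length (lyapunov_values a)])"
    by (simp add: lyapunov_spectrum_def f_def[abs_def])
  moreover have "concat (map f [1..<length (lyapunov_values a)]) \<noteq> [] \<and>
      concat (map f [1..<length (lyapunov_values a)]) ! 0 = vs ! 0" if "vs \<noteq> []"
  proof -
    have 1: "1 < length (lyapunov_values a)" using assms that by simp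
    note upt_conv_Cons[OF 1]
    moreover obtain k where "dim (lyapunov_flag a 1) - dim (lyapunov_flag a (Suc 1)) = Suc k"
      using lyapunov_flag_Suc_psubset[OF 1] by (metis Suc_diff_Suc)
    then have "f 1 = vs ! 0 # replicate k (vs ! 0)" using assms by (simp add: f_def)
    ultimately show ?thesis by simp
  qed
  moreover have "f 0 = replicate (dim (lyapunov_flag a 0) - dim (lyapunov_flag a 1)) v"
    using assms by (simp add: f_def)
  ultimately show ?thesis
    using that[of "concat (map f [1..<length (lyapunov_values a)])"] by (simp only: imp_conjL) blast
qed

section \<open>The first two exponents of a realization in terms of volume rates\<close>

locale matrix_cocycle =
  fixes a :: "nat \<Rightarrow> real^'p^'p" and \<Lambda> :: "nat \<Rightarrow> ereal"
  assumes cocycle: "tempered_cocycle (\<lambda>n. (*v) (forward_product a n)) (\<lambda>n. (*v) (a (Suc n))) \<Lambda>"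
begin

sublocale tempered_cocycle "\<lambda>n. (*v) (forward_product a n)" "\<lambda>n. (*v) (a (Suc n))" \<Lambda>
  by (rule cocycle)

abbreviation fp :: "nat \<Rightarrow> real^'p^'p" where
  "fp \<equiv> forward_product a"

lemma has_rate_lyapunov_growth: "has_rate (\<lambda>n. norm (fp n *v x)) (lyapunov_growth a x)"
  using has_rate_norm_F[of x] lyapunov_growth_eq by metis

lemma lyapunov_growth_le: "lyapunov_growth a x \<le> \<Lambda> 1"
  using has_rate_lyapunov_growth[of x] rate_le_norm_F[of x] rate_ge_le unfolding has_rate_def by blast

lemma lyapunov_growth_le_iff:
  "lyapunov_growth a x \<le> c \<longleftrightarrow> rate_le (\<lambda>n. norm (fp n *v x)) c"
  by (simp add: lyapunov_growth_def rate_le_iff_limsup)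

context
  assumes card: "CARD('p) \<ge> 2"
begin

lemma lyapunov_values_Cons:
  obtains vs where "lyapunov_values a = \<Lambda> 1 # vs"
proof -
  have "\<exists>x\<noteq>0. lyapunov_growth a x = \<Lambda> 1"
  proof (cases "\<Lambda> 1 = - \<infinity>")
    case True
    \<comment> \<open>Every growth value is now \<open>-\<infinity>\<close>, so any nonzero vector
      attains the top one.\<close>
    then have "lyapunov_growth a (axis undefined 1) = \<Lambda> 1"
      using lyapunov_growth_le[of "axis undefined 1"] by simp
    moreover have "axis undefined (1::real) \<noteq> (0 :: real^'p)" by (simp add: axis_eq_0_iff)
    ultimately show ?thesis by blast
  next
    case False
    obtain x where x: "has_rate (\<lambda>n. norm (fp n *v x)) (\<Lambda> 1)"
      using card by (auto intro: top_exponents[OF _ False])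
    have "x \<noteq> 0"
    proof
      assume "x = 0"
      then have "has_rate (\<lambda>n. 0) (\<Lambda> 1)" using x by simp
      then show False using has_rate_unique rate_le_zero has_rate_MInf False by metis
    qed
    then show ?thesis using lyapunov_growth_eq[OF x] by blast
  qed
  then obtain x where "x \<noteq> 0" "lyapunov_growth a x = \<Lambda> 1" by blast
  then show ?thesis using lyapunov_values_hd[of x a] lyapunov_growth_le that by metis
qed

lemma lyapunov_flag_0: "lyapunov_flag a 0 = UNIV"
  by (rule lyapunov_values_Cons) (auto simp: lyapunov_flag_def lyapunov_space_def lyapunov_growth_le simp del: One_nat_def)

lemma lyapunov_spectrum_0: "lyapunov_spectrum a ! 0 = \<Lambda> 1"
proof -
  obtain vs where vs: "lyapunov_values a = \<Lambda> 1 # vs" by (rule lyapunov_values_Cons)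
  obtain ws where "lyapunov_spectrum a =
      replicate (dim (lyapunov_flag a 0) - dim (lyapunov_flag a 1)) (\<Lambda> 1) @ ws"
    by (rule lyapunov_spectrum_Cons[OF vs])
  moreover have "dim (lyapunov_flag a 1) < dim (lyapunov_flag a 0)"
    using lyapunov_flag_Suc_psubset[of 0 a] vs by simp
  ultimately show ?thesis by (simp add: nth_append)
qed

text \<open>Without a gap, a plane of top growth meets the next flag space only in \<open>0\<close>,
  so the top multiplicity is at least two. With a gap, that flag space together with
  \<open>x\<close> spans everything, so the multiplicity is one and the next value is the second
  entry.\<close>

lemma lyapunov_spectrum_1:
  assumes \<Lambda>1: "\<Lambda> 1 \<noteq> - \<infinity>"
  shows "lyapunov_spectrum a ! 1 = \<Lambda> 2 - \<Lambda> 1"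
proof -
  have D: "DIM(real^'p) \<ge> 2" using card by simp
  obtain x where x: "has_rate (\<lambda>n. norm (fp n *v x)) (\<Lambda> 1)"
    and le: "\<Lambda> 2 - \<Lambda> 1 \<le> \<Lambda> 1"
    and gap: "\<Lambda> 2 - \<Lambda> 1 < \<Lambda> 1 \<longrightarrow> (\<forall>v. \<exists>l. rate_le (\<lambda>n. norm (fp n *v (v - l *\<^sub>R x))) (\<Lambda> 2 - \<Lambda> 1))"
    and second: "\<Lambda> 2 - \<Lambda> 1 < \<Lambda> 1 \<longrightarrow> (\<exists>v. v \<noteq> 0 \<and> has_rate (\<lambda>n. norm (fp n *v v)) (\<Lambda> 2 - \<Lambda> 1))"
    and double: "\<Lambda> 2 - \<Lambda> 1 = \<Lambda> 1 \<longrightarrow>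
      (\<exists>y. \<forall>\<alpha> \<beta>. \<alpha> \<noteq> 0 \<or> \<beta> \<noteq> 0 \<longrightarrow> has_rate (\<lambda>n. norm (fp n *v (\<alpha> *\<^sub>R x + \<beta> *\<^sub>R y))) (\<Lambda> 1))"
    by (rule top_exponents[OF D \<Lambda>1])
  have gx: "lyapunov_growth a x = \<Lambda> 1" by (rule lyapunov_growth_eq[OF x])
  have not0: "z \<noteq> 0" if "lyapunov_growth a z = \<Lambda> 1" for z
  proof
    assume "z = 0"
    then have "rate_le (\<lambda>n. norm (fp n *v z)) (- \<infinity>)" by (simp add: rate_le_zero)
    then show False using that \<Lambda>1 lyapunov_growth_le_iff[of z "- \<infinity>"] by simp
  qed
  obtain vs where vs: "lyapunov_values a = \<Lambda> 1 # vs" by (rule lyapunov_values_Cons)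
  obtain ws where ws: "lyapunov_spectrum a =
      replicate (CARD('p) - dim (lyapunov_flag a 1)) (\<Lambda> 1) @ ws"
    "vs \<noteq> [] \<longrightarrow> ws \<noteq> [] \<and> ws ! 0 = vs ! 0"
    by (rule lyapunov_spectrum_Cons[OF vs]) (simp add: lyapunov_flag_0)
  have flag1_less: "dim (lyapunov_flag a 1) < CARD('p)"
    using lyapunov_flag_Suc_psubset[of 0 a] vs lyapunov_flag_0 by simp
  have flag1: "lyapunov_growth a z < \<Lambda> 1" if "z \<in> lyapunov_flag a 1" "z \<noteq> 0" for z
  proof (cases vs)
    case Nil
    then show ?thesis using that vs by (simp add: lyapunov_flag_def)
  next
    case (Cons v vs')
    then have "v < \<Lambda> 1" using sorted_lyapunov_values[of a] vs by simp
    then show ?thesis using that vs Cons by (auto simp: lyapunov_flag_def lyapunov_space_def)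
  qed
  show ?thesis
  proof (cases "\<Lambda> 2 - \<Lambda> 1 = \<Lambda> 1")
    case True
    then obtain y where y: "\<And>\<alpha> \<beta>. \<alpha> \<noteq> 0 \<or> \<beta> \<noteq> 0 \<Longrightarrow> lyapunov_growth a (\<alpha> *\<^sub>R x + \<beta> *\<^sub>R y) = \<Lambda> 1"
      using double by (blast intro: lyapunov_growth_eq)
    have combo: "\<alpha> *\<^sub>R x + \<beta> *\<^sub>R y \<noteq> 0" if "\<alpha> \<noteq> 0 \<or> \<beta> \<noteq> 0" for \<alpha> \<beta> by (rule not0[OF y[OF that]])
    have ind: "independent {x, y}" "x \<noteq> y"
    proof -
      have "y \<noteq> 0" using combo[of 0 1] by simp
      moreover have "x \<notin> span {y}"
      proof
        assume "x \<in> span {y}"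
        then obtain k where "x = k *\<^sub>R y" by (auto simp: span_singleton)
        then show False using combo[of 1 "-k"] by simp
      qed
      ultimately show "independent {x, y}" "x \<noteq> y"
        using span_base[of y "{y}"] by (auto simp: independent_insert)
    qed
    have sub: "subspace (lyapunov_flag a 1)"
      by (simp add: lyapunov_flag_def subspace_lyapunov_space)
    have "lyapunov_flag a 1 \<inter> span {x, y} \<subseteq> {0}"
    proof
      fix z assume z: "z \<in> lyapunov_flag a 1 \<inter> span {x, y}"
      then obtain \<alpha> \<beta> where ab: "z = \<alpha> *\<^sub>R x + \<beta> *\<^sub>R y"
        by (auto simp: span_insert span_singleton algebra_simps)
      show "z \<in> {0}"
      proof (rule ccontr)
        assume "z \<notin> {0}"
        then have "\<alpha> \<noteq> 0 \<or> \<beta> \<noteq> 0" using ab by auto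
        then show False using y flag1[of z] z ab \<open>z \<notin> {0}\<close> by auto
      qed
    qed
    then have "dim (lyapunov_flag a 1 \<inter> span {x, y}) = 0" by (simp add: dim_eq_0)
    then have "dim {u + v |u v. u \<in> lyapunov_flag a 1 \<and> v \<in> span {x, y}} = dim (lyapunov_flag a 1) + dim (span {x, y})"
      using dim_sums_Int[OF sub subspace_span, of "{x, y}"] by linarith
    moreover have "dim (span {x, y}) = 2" using ind by (simp add: dim_eq_card_independent)
    moreover have "dim {u + v |u v. u \<in> lyapunov_flag a 1 \<and> v \<in> span {x, y}} \<le> CARD('p)"
      using dim_subset_UNIV[of "{u + v |u v. u \<in> lyapunov_flag a 1 \<and> v \<in> span {x, y}}"] by simp
    ultimately have "1 < CARD('p) - dim (lyapunov_flag a 1)" by simp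
    then show ?thesis using ws(1) True by (simp add: nth_append)
  next
    case False
    then have less: "\<Lambda> 2 - \<Lambda> 1 < \<Lambda> 1" using le by simp
    \<comment> \<open>No value lies strictly between the two: a nonzero coefficient of
      \<open>x\<close> would put \<open>x\<close> itself into a space of growth below
      \<open>\<Lambda> 1\<close>.\<close>
    have dom: "lyapunov_growth a v \<le> \<Lambda> 2 - \<Lambda> 1" if v: "lyapunov_growth a v < \<Lambda> 1" for v
    proof -
      obtain l where l: "lyapunov_growth a (v - l *\<^sub>R x) \<le> \<Lambda> 2 - \<Lambda> 1"
        using gap less lyapunov_growth_le_iff by blast
      have "l = 0"
      proof (rule ccontr)
        assume "l \<noteq> 0"
        define m where "m = max (lyapunov_growth a v) (\<Lambda> 2 - \<Lambda> 1)"
        have "v \<in> lyapunov_space a m" "v - l *\<^sub>R x \<in> lyapunov_space a m"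
          using l by (auto simp: m_def lyapunov_space_def le_max_iff_disj)
        then have "v - (v - l *\<^sub>R x) \<in> lyapunov_space a m"
          by (rule subspace_diff[OF subspace_lyapunov_space])
        then have "inverse l *\<^sub>R (v - (v - l *\<^sub>R x)) \<in> lyapunov_space a m"
          by (rule subspace_scale[OF subspace_lyapunov_space])
        then have "x \<in> lyapunov_space a m" using \<open>l \<noteq> 0\<close> by simp
        then have "\<Lambda> 1 \<le> m" using gx by (simp add: lyapunov_space_def)
        moreover have "m < \<Lambda> 1" unfolding m_def using v less by (rule max_less_iff_conj[THEN iffD2, OF conjI])
        ultimately show False by simp
      qed
      then show ?thesis using l by simp
    qed
    obtain v where v: "v \<noteq> 0" "lyapunov_growth a v = \<Lambda> 2 - \<Lambda> 1"
      using second less lyapunov_growth_eq by blast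
    have "\<Lambda> 2 - \<Lambda> 1 \<in> set (lyapunov_values a)" using v by (auto simp: set_lyapunov_values intro!: image_eqI)
    then have in_vs: "\<Lambda> 2 - \<Lambda> 1 \<in> set vs" using vs less by auto
    then obtain u us where us: "vs = u # us" by (cases vs) auto
    have srt: "u < \<Lambda> 1" "\<And>w. w \<in> set us \<Longrightarrow> w < u" using sorted_lyapunov_values[of a] vs us by auto
    have "u \<in> set (lyapunov_values a)" using vs us by simp
    then have "u \<le> \<Lambda> 2 - \<Lambda> 1" using dom srt by (auto simp: set_lyapunov_values)
    then have u: "u = \<Lambda> 2 - \<Lambda> 1" using in_vs us srt by force
    have flag1_eq: "lyapunov_flag a 1 = lyapunov_space a (\<Lambda> 2 - \<Lambda> 1)"
      using vs us u by (simp add: lyapunov_flag_def)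
    have "UNIV \<subseteq> span (insert x (lyapunov_flag a 1))"
    proof
      fix w
      obtain l where "lyapunov_growth a (w - l *\<^sub>R x) \<le> \<Lambda> 2 - \<Lambda> 1"
        using gap less lyapunov_growth_le_iff by blast
      then have "w - l *\<^sub>R x \<in> lyapunov_flag a 1" unfolding flag1_eq by (simp add: lyapunov_space_def)
      then have "(w - l *\<^sub>R x) + l *\<^sub>R x \<in> span (insert x (lyapunov_flag a 1))"
        by (intro span_add span_scale span_base) auto
      then show "w \<in> span (insert x (lyapunov_flag a 1))" by simp
    qed
    then have "CARD('p) \<le> dim (insert x (lyapunov_flag a 1))"
      using dim_subset[of UNIV "span (insert x (lyapunov_flag a 1))"] by (simp add: dim_span)
    then have "CARD('p) \<le> dim (lyapunov_flag a 1) + 1"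
      by (auto simp: dim_insert split: if_splits)
    then have "CARD('p) - dim (lyapunov_flag a 1) = 1" using flag1_less by simp
    then show ?thesis using ws us u by (simp add: nth_append)
  qed
qed

end

end

section \<open>Cocycles over a stationary process\<close>

primrec iterate_cocycle :: "('s \<Rightarrow> 'a \<Rightarrow> 'a) \<Rightarrow> ('s \<Rightarrow> 's) \<Rightarrow> nat \<Rightarrow> 's \<Rightarrow> 'a \<Rightarrow> 'a" where
  "iterate_cocycle \<Phi> T 0 s = id"
| "iterate_cocycle \<Phi> T (Suc n) s = \<Phi> ((T ^^ n) s) \<circ> iterate_cocycle \<Phi> T n s"

lemma iterate_cocycle_add:
  "iterate_cocycle \<Phi> T (m + n) s = iterate_cocycle \<Phi> T n ((T ^^ m) s) \<circ> iterate_cocycle \<Phi> T m s"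
proof (induction n)
  case (Suc n)
  have "(T ^^ n) ((T ^^ m) s) = (T ^^ (m + n)) s" by (metis add.commute comp_apply funpow_add)
  then show ?case using Suc by (simp add: comp_assoc)
qed simp

context ergodic_system
begin

text \<open>The subadditive theorem is applied to each volume size separately; countably many null
  sets are discarded, and sublinearity of \<open>h\<close> along the orbit gives
  temperedness.\<close>

theorem AE_tempered_cocycle:
  fixes \<Phi> :: "'s \<Rightarrow> 'a::euclidean_space \<Rightarrow> 'a"
  assumes lin: "\<And>s. linear (\<Phi> s)" and meas: "\<And>b. (\<lambda>s. \<Phi> s b) \<in> borel_measurable P"
    and h: "\<And>s. svol (Suc 0) (\<Phi> s) \<le> exp (h s)" "\<And>s. 0 \<le> h s" and hi: "integrable P h"
  obtains \<Lambda> where "AE s in P. tempered_cocycle (\<lambda>n. iterate_cocycle \<Phi> T n s) (\<lambda>n. \<Phi> ((T ^^ n) s)) \<Lambda>"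
proof -
  define F where "F n s = iterate_cocycle \<Phi> T n s" for n s
  have linF: "linear (F n s)" for n s
  proof (induction n)
    case 0
    then show ?case by (simp add: F_def id_def linear_iff)
  next
    case (Suc n)
    then show ?case unfolding F_def iterate_cocycle.simps by (intro linear_compose lin)
  qed
  have measF: "(\<lambda>s. F n s b) \<in> borel_measurable P" for n b
  proof (induction n)
    case (Suc n)
    have "F (Suc n) s b = (\<Sum>c\<in>Basis. (F n s b \<bullet> c) *\<^sub>R \<Phi> ((T ^^ n) s) c)" for s
    proof -
      have "F (Suc n) s b = \<Phi> ((T ^^ n) s) (F n s b)" by (simp add: F_def)
      also have "\<dots> = \<Phi> ((T ^^ n) s) (\<Sum>c\<in>Basis. (F n s b \<bullet> c) *\<^sub>R c)"
        by (simp add: euclidean_representation)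
      finally show ?thesis by (simp add: linear_sum[OF lin] linear_scale[OF lin])
    qed
    moreover have "(\<lambda>s. \<Phi> ((T ^^ n) s) c) \<in> borel_measurable P" for c
      by (rule measurable_compose[OF measurable_funpow_T meas])
    ultimately show ?case using Suc by (simp add: borel_measurable_sum borel_measurable_scaleR borel_measurable_inner)
  qed (simp add: F_def)
  have "\<exists>\<gamma><\<infinity>. AE s in P. has_rate (\<lambda>n. svol k (F n s)) \<gamma>" for k
  proof -
    define h' where "h' s = real k * (ln (real DIM('a)) + h s)" for s
    have "0 \<le> ln (real DIM('a))" by (intro ln_ge_zero) (simp add: Suc_le_eq)
    then have h'0: "0 \<le> h' s" for s using h(2)[of s] by (simp add: h'_def)
    have h'i: "integrable P h'" unfolding h'_def using hi by auto
    \<comment> \<open>At time \<open>0\<close> the sum of volumes counts the distinct basis lists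
      and may exceed one; replacing it by \<open>1\<close> meets the hypothesis on
      \<open>u 0\<close> and leaves the rate unchanged.\<close>
    define u where "u n s = (if n = 0 then 1 else svol k (F n s))" for n s
    have um: "u n \<in> borel_measurable P" for n
      unfolding u_def[abs_def] using borel_measurable_svol[of "F n" P k] measF by (cases "n = 0") auto
    have u0: "u 0 s \<le> 1" and un: "0 \<le> u n s" for n s by (simp_all add: u_def svol_nonneg)
    have u1: "u 1 s \<le> exp (h' s)" for s
    proof -
      have "u 1 s = svol k (\<Phi> s)" by (simp add: u_def F_def)
      also have "\<dots> \<le> (real DIM('a) * svol (Suc 0) (\<Phi> s)) ^ k" by (rule svol_le_power)
      also have "\<dots> \<le> (real DIM('a) * exp (h s)) ^ k"
        using h(1) by (intro power_mono mult_left_mono mult_nonneg_nonneg svol_nonneg) auto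
      also have "real DIM('a) * exp (h s) = exp (ln (real DIM('a)) + h s)" by (simp add: exp_add)
      also have "\<dots> ^ k = exp (h' s)" by (simp add: h'_def exp_of_nat_mult)
      finally show ?thesis .
    qed
    have usub: "u (m + n) s \<le> u m s * u n ((T ^^ m) s)" for m n s
      using svol_comp_le[OF linF, of k n "(T ^^ m) s" "F m s"]
      by (simp add: u_def F_def iterate_cocycle_add mult.commute)
    obtain \<gamma> where \<gamma>: "\<gamma> < \<infinity>" "AE s in P. has_rate (\<lambda>n. u n s) \<gamma>"
      by (rule kingman[OF um un usub u0 u1 h'i h'0])
    from \<gamma>(2) have "AE s in P. has_rate (\<lambda>n. svol k (F n s)) \<gamma>"
    proof eventually_elim
      case (elim s)
      have "\<forall>\<^sub>F n in sequentially. u n s = svol k (F n s)"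
        using eventually_gt_at_top[of 0] by eventually_elim (simp add: u_def)
      then have "\<forall>\<^sub>F n in sequentially. u n s \<le> svol k (F n s)" "\<forall>\<^sub>F n in sequentially. svol k (F n s) \<le> u n s"
        by (auto elim: eventually_mono)
      with elim show ?case
        unfolding has_rate_def by (blast intro: rate_le_mono[OF _ order_refl] rate_ge_mono[OF _ order_refl])
    qed
    with \<gamma>(1) show ?thesis by blast
  qed
  then obtain \<Lambda> where \<Lambda>: "\<And>k. \<Lambda> k < \<infinity>" "\<And>k. AE s in P. has_rate (\<lambda>n. svol k (F n s)) (\<Lambda> k)"
    by metis
  have "AE s in P. \<forall>k. has_rate (\<lambda>n. svol k (F n s)) (\<Lambda> k)"
    using \<Lambda>(2) by (simp add: AE_all_countable)
  \<comment> \<open>The slopes \<open>inverse (real (Suc m))\<close> reduce all positive ones to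
    countably many.\<close>
  moreover have "AE s in P. \<forall>m. \<forall>\<^sub>F n in sequentially. h ((T ^^ n) s) \<le> inverse (real (Suc m)) * real n"
    unfolding AE_all_countable using funpow_sublinear[OF hi h(2)] by simp
  ultimately have "AE s in P. tempered_cocycle (\<lambda>n. F n s) (\<lambda>n. \<Phi> ((T ^^ n) s)) \<Lambda>"
  proof eventually_elim
    case (elim s)
    show ?case
    proof (rule tempered_cocycle.intro)
      show "linear (F 0 s)" by (rule linF)
      show "linear (\<Phi> ((T ^^ n) s))" for n by (rule lin)
      show "F (Suc n) s = \<Phi> ((T ^^ n) s) \<circ> F n s" for n by (simp add: F_def)
      show "rate_le (\<lambda>n. svol (Suc 0) (\<Phi> ((T ^^ n) s))) 0"
        unfolding rate_le_def
      proof (intro allI impI)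
        fix r assume "0 < ereal r"
        then obtain m where m: "inverse (real (Suc m)) < r" using reals_Archimedean[of r] by auto
        have "\<forall>\<^sub>F n in sequentially. h ((T ^^ n) s) \<le> inverse (real (Suc m)) * real n" using elim by blast
        then show "\<forall>\<^sub>F n in sequentially. svol (Suc 0) (\<Phi> ((T ^^ n) s)) \<le> exp (r * real n)"
        proof eventually_elim
          case (elim n)
          have "inverse (real (Suc m)) * real n \<le> r * real n" using m by (intro mult_right_mono) auto
          then have "exp (h ((T ^^ n) s)) \<le> exp (r * real n)" using elim by simp
          then show ?case using h(1) order_trans by blast
        qed
      qed
      show "has_rate (\<lambda>n. svol k (F n s)) (\<Lambda> k)" for k using elim by blast
      show "\<Lambda> k < \<infinity>" for k by (rule \<Lambda>)
    qed
  qed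
  then show ?thesis using that unfolding F_def by blast
qed

end

section \<open>Measurability and norm estimates for matrices\<close>

lemma borel_measurable_vec_iff:
  fixes f :: "'z \<Rightarrow> 'a::euclidean_space ^ 'n"
  shows "f \<in> borel_measurable N \<longleftrightarrow> (\<forall>i. (\<lambda>z. f z $ i) \<in> borel_measurable N)"
proof
  assume f: "f \<in> borel_measurable N"
  show "\<forall>i. (\<lambda>z. f z $ i) \<in> borel_measurable N"
  proof
    fix i
    show "(\<lambda>z. f z $ i) \<in> borel_measurable N"
      by (rule measurable_compose[OF f borel_measurable_continuous_onI]) (intro continuous_intros)
  qed
next
  assume "\<forall>i. (\<lambda>z. f z $ i) \<in> borel_measurable N"
  then have "(\<lambda>z. f z $ i) \<in> borel_measurable N" for i by blast
  then show "f \<in> borel_measurable N"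
    by (subst borel_measurable_euclidean_space) (auto simp: Basis_vec_def inner_axis intro: borel_measurable_inner)
qed

lemma borel_measurable_matrix_vector_mult:
  fixes f :: "'z \<Rightarrow> real^'n^'m"
  assumes "f \<in> borel_measurable N" "x \<in> borel_measurable N"
  shows "(\<lambda>z. f z *v x z) \<in> borel_measurable N"
  using assms
  by (simp add: borel_measurable_vec_iff matrix_vector_mult_def borel_measurable_sum borel_measurable_times)

lemma borel_measurable_matrix_mult:
  fixes f :: "'z \<Rightarrow> real^'n^'m" and g :: "'z \<Rightarrow> real^'k^'n"
  assumes "f \<in> borel_measurable N" "g \<in> borel_measurable N"
  shows "(\<lambda>z. f z ** g z) \<in> borel_measurable N"
  using assms
  by (simp add: borel_measurable_vec_iff matrix_matrix_mult_def borel_measurable_sum borel_measurable_times)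

lemma borel_measurable_transpose:
  fixes f :: "'z \<Rightarrow> real^'n^'m"
  assumes "f \<in> borel_measurable N"
  shows "(\<lambda>z. transpose (f z)) \<in> borel_measurable N"
  using assms by (simp add: borel_measurable_vec_iff transpose_def)

lemma norm_matrix_le_sum:
  fixes A :: "real^'n^'m"
  shows "norm A \<le> (\<Sum>i\<in>UNIV. \<Sum>j\<in>UNIV. \<bar>A $ i $ j\<bar>)"
proof -
  have "norm A \<le> (\<Sum>i\<in>UNIV. norm (A $ i))" unfolding norm_vec_def by (rule L2_set_le_sum) simp
  also have "\<dots> \<le> (\<Sum>i\<in>UNIV. \<Sum>j\<in>UNIV. \<bar>A $ i $ j\<bar>)" by (intro sum_mono norm_le_l1_cart)
  finally show ?thesis .
qed

lemma abs_matrix_component_le: "\<bar>(A :: real^'n^'m) $ i $ j\<bar> \<le> norm A"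
  using component_le_norm_cart[of "A $ i" j] Finite_Cartesian_Product.norm_nth_le[of A i] by linarith

lemma norm_matrix_mult_le:
  fixes A :: "real^'n^'m" and B :: "real^'k^'n"
  shows "norm (A ** B) \<le> real (CARD('m) * CARD('k) * CARD('n)) * (norm A * norm B)"
proof -
  have c: "\<bar>(A ** B) $ i $ j\<bar> \<le> real CARD('n) * (norm A * norm B)" for i j
  proof -
    have "\<bar>(A ** B) $ i $ j\<bar> \<le> (\<Sum>k\<in>UNIV. \<bar>A $ i $ k * B $ k $ j\<bar>)"
      by (simp add: matrix_matrix_mult_def sum_abs)
    also have "\<dots> \<le> (\<Sum>k\<in>(UNIV :: 'n set). norm A * norm B)"
      unfolding abs_mult by (intro sum_mono mult_mono abs_matrix_component_le) auto
    finally show ?thesis by simp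
  qed
  have "norm (A ** B) \<le> (\<Sum>i\<in>UNIV. \<Sum>j\<in>UNIV. \<bar>(A ** B) $ i $ j\<bar>)" by (rule norm_matrix_le_sum)
  also have "\<dots> \<le> (\<Sum>i\<in>(UNIV :: 'm set). \<Sum>j\<in>(UNIV :: 'k set). real CARD('n) * (norm A * norm B))"
    by (intro sum_mono c)
  finally show ?thesis by (simp add: mult_ac)
qed

lemma norm_matrix_vector_mult_le:
  fixes A :: "real^'n^'m"
  shows "norm (A *v x) \<le> real (CARD('m) * CARD('n)) * (norm A * norm x)"
proof -
  have c: "\<bar>(A *v x) $ i\<bar> \<le> real CARD('n) * (norm A * norm x)" for i
  proof -
    have "\<bar>(A *v x) $ i\<bar> \<le> (\<Sum>k\<in>UNIV. \<bar>A $ i $ k * x $ k\<bar>)"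
      by (simp add: matrix_vector_mult_def sum_abs)
    also have "\<dots> \<le> (\<Sum>k\<in>(UNIV :: 'n set). norm A * norm x)"
      unfolding abs_mult by (intro sum_mono mult_mono abs_matrix_component_le component_le_norm_cart) auto
    finally show ?thesis by simp
  qed
  have "norm (A *v x) \<le> (\<Sum>i\<in>UNIV. \<bar>(A *v x) $ i\<bar>)" by (rule norm_le_l1_cart)
  also have "\<dots> \<le> (\<Sum>i\<in>(UNIV :: 'm set). real CARD('n) * (norm A * norm x))"
    by (intro sum_mono c)
  finally show ?thesis by (simp add: mult_ac)
qed

lemma exp_log_plus: "exp (log_plus t) = max 1 t"
  by (auto simp: log_plus_def max_def)

lemma log_plus_nonneg: "0 \<le> log_plus t"
  by (auto simp: log_plus_def)

text \<open>The square covers conjugation, which is quadratic in the matrix, as well as the linear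
  action on vectors; the maximum with one keeps the majorant valid for small matrices.\<close>

lemma svol_1_le_exp:
  fixes \<Phi> :: "'a::euclidean_space \<Rightarrow> 'b::real_inner"
  assumes "\<And>b. norm b = 1 \<Longrightarrow> norm (\<Phi> b) \<le> K * (max 1 t)\<^sup>2" and "1 \<le> K"
  shows "svol (Suc 0) \<Phi> \<le> exp (ln (real DIM('a) * K) + 2 * log_plus t)"
proof -
  have "svol (Suc 0) \<Phi> \<le> (\<Sum>b\<in>(Basis :: 'a set). K * (max 1 t)\<^sup>2)"
    unfolding svol_1 by (intro sum_mono assms) auto
  also have "\<dots> = (real DIM('a) * K) * (exp (log_plus t))\<^sup>2" by (simp add: exp_log_plus)
  also have "\<dots> = exp (ln (real DIM('a) * K)) * exp (2 * log_plus t)"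
    using assms(2) by (simp add: exp_double)
  finally show ?thesis by (simp add: exp_add)
qed

text \<open>On antisymmetric matrices this is the second exterior power of \<open>A\<close>; acting
  on all matrices keeps the underlying space a Euclidean type.\<close>

definition conjugation :: "real^'p^'p \<Rightarrow> real^'p^'p \<Rightarrow> real^'p^'p" where
  "conjugation A X = A ** X ** transpose A"

lemma linear_conjugation: "linear (conjugation A)"
  unfolding conjugation_def
  by (rule linearI)
    (simp_all add: vec_eq_iff matrix_matrix_mult_def transpose_def sum.distrib sum_distrib_left
      algebra_simps)

lemma conjugation_mult: "conjugation (A ** B) X = conjugation A (conjugation B X)"
  by (simp add: conjugation_def matrix_transpose_mul matrix_mul_assoc)

lemma norm_transpose: "norm (transpose (A :: real^'n^'m)) \<le> real (CARD('n) * CARD('m)) * norm A"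
proof -
  have "norm (transpose A) \<le> (\<Sum>i\<in>UNIV. \<Sum>j\<in>UNIV. \<bar>transpose A $ i $ j\<bar>)" by (rule norm_matrix_le_sum)
  also have "\<dots> \<le> (\<Sum>i\<in>(UNIV :: 'n set). \<Sum>j\<in>(UNIV :: 'm set). norm A)"
    by (intro sum_mono) (simp add: transpose_def abs_matrix_component_le)
  finally show ?thesis by simp
qed

lemma norm_conjugation_le:
  obtains K where "1 \<le> K" "\<And>(A :: real^'p^'p) X. norm (conjugation A X) \<le> K * ((norm A)\<^sup>2 * norm X)"
proof
  let ?p = "real CARD('p)"
  have "1 \<le> CARD('p)" by (simp add: Suc_le_eq)
  then have p: "1 \<le> ?p" by linarith
  \<comment> \<open>The exponent is \<open>3 + 3 + 2\<close>: two matrix products and one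
    transposition in crude entrywise bounds.\<close>
  then show "1 \<le> ?p ^ 8" by (rule one_le_power)
  fix A X :: "real^'p^'p"
  have "norm (conjugation A X) \<le> ?p ^ 3 * (norm (A ** X) * norm (transpose A))"
    unfolding conjugation_def using norm_matrix_mult_le[of "A ** X" "transpose A"]
    by (simp add: power3_eq_cube)
  also have "\<dots> \<le> ?p ^ 3 * ((?p ^ 3 * (norm A * norm X)) * (?p ^ 2 * norm A))"
    using norm_matrix_mult_le[of A X] norm_transpose[of A]
    by (intro mult_left_mono mult_mono) (auto simp: power3_eq_cube power2_eq_square)
  also have "\<dots> = ?p ^ 8 * ((norm A)\<^sup>2 * norm X)" by (simp add: eval_nat_numeral)
  finally show "norm (conjugation A X) \<le> ?p ^ 8 * ((norm A)\<^sup>2 * norm X)" .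
qed

section \<open>The shift on sequence space and transfer to the process\<close>

definition shift :: "(nat \<Rightarrow> 'b) \<Rightarrow> nat \<Rightarrow> 'b" where
  "shift s = (\<lambda>n. s (Suc n))"

lemma funpow_shift: "(shift ^^ n) s = (\<lambda>k. s (k + n))"
  by (induction n) (auto simp: shift_def)

lemma shift_measurable:
  "shift \<in> measurable (\<Pi>\<^sub>M i\<in>UNIV. borel) (\<Pi>\<^sub>M i\<in>UNIV. (borel :: 'b::topological_space measure))"
  unfolding shift_def by (rule measurable_PiM_single') (auto simp: space_PiM)

lemma trajectory_measurable:
  assumes "\<And>n. n \<ge> 1 \<Longrightarrow> A n \<in> borel_measurable M"
  shows "trajectory A \<in> measurable M (\<Pi>\<^sub>M i\<in>UNIV. borel)"
  unfolding trajectory_def using assms by (intro measurable_PiM_single') (auto simp: space_PiM)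

text \<open>The original probability space carries no transformation; stationarity and ergodicity
  are statements about the law, so the ergodic theorems are run there and pulled back along
  \<open>trajectory\<close>.\<close>

lemma ergodic_system_sequence_law:
  fixes A :: "nat \<Rightarrow> 'w \<Rightarrow> 'b::topological_space"
  assumes "prob_space M" and A: "\<And>n. n \<ge> 1 \<Longrightarrow> A n \<in> borel_measurable M"
    and stat: "strictly_stationary M A" and erg: "ergodic_process M A"
  shows "ergodic_system (sequence_law M A) shift"
proof -
  interpret prob_space M by fact
  let ?N = "\<Pi>\<^sub>M i\<in>(UNIV :: nat set). (borel :: 'b measure)"
  have tr: "trajectory A \<in> measurable M ?N" by (rule trajectory_measurable[OF A])
  interpret P: prob_space "sequence_law M A"
    unfolding sequence_law_def by (rule prob_space_distr[OF tr])
  show ?thesis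
  proof
    show "space (sequence_law M A) = UNIV" by (simp add: sequence_law_def space_PiM)
    show "shift \<in> measurable (sequence_law M A) (sequence_law M A)"
      unfolding sequence_law_def using shift_measurable by simp
    have "distr (sequence_law M A) (sequence_law M A) shift = distr (distr M ?N (trajectory A)) ?N shift"
      by (rule distr_cong) (auto simp: sequence_law_def)
    also have "\<dots> = distr M ?N (shift \<circ> trajectory A)"
      by (rule distr_distr[OF shift_measurable tr])
    also have "shift \<circ> trajectory A = trajectory (\<lambda>n. A (Suc n))"
      by (auto simp: shift_def trajectory_def)
    also have "distr M ?N \<dots> = sequence_law M A"
      using stat by (simp add: strictly_stationary_def sequence_law_def)
    finally show "distr (sequence_law M A) (sequence_law M A) shift = sequence_law M A" .
    fix B assume "B \<in> sets (sequence_law M A)" "shift -` B = B"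
    then show "P.prob B = 0 \<or> P.prob B = 1"
      using erg by (auto simp: ergodic_process_def sequence_law_def shift_def[abs_def])
  qed
qed

text \<open>Coordinate \<open>0\<close> of a trajectory is \<open>A 1\<close>, so the factor added
  at step \<open>n\<close> is \<open>A (Suc n)\<close>, as in
  \<open>forward_product\<close>.\<close>

lemma iterate_cocycle_matrix:
  "iterate_cocycle (\<lambda>s. (*v) (s 0)) shift n (trajectory A \<omega>) = (*v) (forward_product (\<lambda>n. A n \<omega>) n)"
  by (induction n)
    (auto simp: funpow_shift trajectory_def matrix_vector_mul_assoc[symmetric] fun_eq_iff)

lemma iterate_cocycle_conjugation:
  "iterate_cocycle (\<lambda>s. conjugation (s 0)) shift n (trajectory A \<omega>) = conjugation (forward_product (\<lambda>n. A n \<omega>) n)"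
proof (induction n)
  case 0
  then show ?case by (auto simp: conjugation_def fun_eq_iff)
next
  case (Suc n)
  then show ?case by (auto simp: funpow_shift trajectory_def conjugation_mult fun_eq_iff)
qed

theorem AE_tempered_process:
  fixes M :: "'w measure" and A :: "nat \<Rightarrow> 'w \<Rightarrow> real^'p^'p"
  assumes M: "prob_space M" and A: "\<And>n. n \<ge> 1 \<Longrightarrow> A n \<in> borel_measurable M"
    and stat: "strictly_stationary M A" and erg: "ergodic_process M A"
    and int: "integrable M (\<lambda>\<omega>. log_plus (norm (A 1 \<omega>)))"
  obtains \<Lambda> \<Gamma> where "AE \<omega> in M. matrix_cocycle (\<lambda>n. A n \<omega>) \<Lambda>"
    and "AE \<omega> in M. tempered_cocycle (\<lambda>n. conjugation (forward_product (\<lambda>n. A n \<omega>) n))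
          (\<lambda>n. conjugation (A (Suc n) \<omega>)) \<Gamma>"
proof -
  let ?P = "sequence_law M A"
  interpret ergodic_system ?P shift by (rule ergodic_system_sequence_law[OF M A stat erg])
  have tr: "trajectory A \<in> measurable M (\<Pi>\<^sub>M i\<in>UNIV. borel)" by (rule trajectory_measurable[OF A])
  have coord: "(\<lambda>s. s 0) \<in> borel_measurable ?P"
    unfolding sequence_law_def by simp
  have lp: "(log_plus :: real \<Rightarrow> real) \<in> borel_measurable borel"
    unfolding log_plus_def[abs_def] by measurable
  have hi: "integrable ?P (\<lambda>s. c + 2 * log_plus (norm (s 0)))" for c
  proof -
    have "(\<lambda>s. log_plus (norm (s 0))) \<in> borel_measurable ?P"
      by (rule measurable_compose[OF measurable_compose[OF coord borel_measurable_norm] lp])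
    then have "integrable ?P (\<lambda>s. log_plus (norm (s 0)))"
      using int unfolding sequence_law_def
      by (subst integrable_distr_eq[OF tr]) (auto simp: trajectory_def)
    then show ?thesis by auto
  qed
  have transfer: "AE \<omega> in M. Q (trajectory A \<omega>)" if "AE s in ?P. Q s" for Q
    using that unfolding sequence_law_def by (rule AE_distrD[OF tr])
  have h0: "0 \<le> ln (real d * K) + 2 * log_plus t" if "1 \<le> K" "0 < d" for d :: nat and K t
  proof -
    have "1 * 1 \<le> real d * K" using that by (intro mult_mono) auto
    then show ?thesis using log_plus_nonneg[of t] by simp
  qed
  define K1 where "K1 = real (CARD('p) * CARD('p))"
  have K1: "1 \<le> K1"
  proof -
    have "1 \<le> CARD('p) * CARD('p)" by (simp add: Suc_le_eq)
    then show ?thesis unfolding K1_def by linarith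
  qed
  have sq: "t \<le> (max 1 t)\<^sup>2" if "0 \<le> t" for t :: real
    using that by (auto simp: max_def power2_eq_square intro: mult_right_mono[of 1 t t, simplified])
  obtain \<Lambda> where "AE s in ?P. tempered_cocycle (\<lambda>n. iterate_cocycle (\<lambda>s. (*v) (s 0)) shift n s)
      (\<lambda>n. (*v) ((shift ^^ n) s 0)) \<Lambda>"
  proof (rule AE_tempered_cocycle)
    show "linear ((*v) (s 0))" for s :: "nat \<Rightarrow> real^'p^'p" by (rule matrix_vector_mul_linear)
    show "(\<lambda>s. s 0 *v b) \<in> borel_measurable ?P" for b
      using coord by (intro borel_measurable_matrix_vector_mult) auto
    show "svol (Suc 0) ((*v) (s 0)) \<le> exp (ln (real DIM(real^'p) * K1) + 2 * log_plus (norm (s 0)))"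
      for s :: "nat \<Rightarrow> real^'p^'p"
    proof (rule svol_1_le_exp[OF _ K1])
      fix b :: "real^'p" assume "norm b = 1"
      then have "norm (s 0 *v b) \<le> K1 * norm (s 0)"
        using norm_matrix_vector_mult_le[of "s 0" b] by (simp add: K1_def)
      also have "\<dots> \<le> K1 * (max 1 (norm (s 0)))\<^sup>2" using K1 by (intro mult_left_mono sq) auto
      finally show "norm (s 0 *v b) \<le> K1 * (max 1 (norm (s 0)))\<^sup>2" .
    qed
    show "0 \<le> ln (real DIM(real^'p) * K1) + 2 * log_plus (norm (s 0))" for s :: "nat \<Rightarrow> real^'p^'p"
      using K1 by (intro h0) auto
  qed (rule hi)
  from transfer[OF this] have 1: "AE \<omega> in M. matrix_cocycle (\<lambda>n. A n \<omega>) \<Lambda>"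
    unfolding iterate_cocycle_matrix matrix_cocycle_def
    by (simp add: funpow_shift trajectory_def)
  obtain K2 where K2: "1 \<le> K2" "\<And>(A :: real^'p^'p) X. norm (conjugation A X) \<le> K2 * ((norm A)\<^sup>2 * norm X)"
    using norm_conjugation_le by blast
  obtain \<Gamma> where "AE s in ?P. tempered_cocycle (\<lambda>n. iterate_cocycle (\<lambda>s. conjugation (s 0)) shift n s)
      (\<lambda>n. conjugation ((shift ^^ n) s 0)) \<Gamma>"
  proof (rule AE_tempered_cocycle)
    show "linear (conjugation (s 0))" for s :: "nat \<Rightarrow> real^'p^'p" by (rule linear_conjugation)
    show "(\<lambda>s. conjugation (s 0) b) \<in> borel_measurable ?P" for b
      unfolding conjugation_def using coord
      by (intro borel_measurable_matrix_mult borel_measurable_transpose) auto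
    show "svol (Suc 0) (conjugation (s 0)) \<le> exp (ln (real DIM(real^'p^'p) * K2) + 2 * log_plus (norm (s 0)))"
      for s :: "nat \<Rightarrow> real^'p^'p"
    proof (rule svol_1_le_exp[OF _ K2(1)])
      fix b :: "real^'p^'p" assume "norm b = 1"
      then have "norm (conjugation (s 0) b) \<le> K2 * (norm (s 0))\<^sup>2"
        using K2(2)[of "s 0" b] by simp
      also have "\<dots> \<le> K2 * (max 1 (norm (s 0)))\<^sup>2" using K2(1) by (intro mult_left_mono power_mono) auto
      finally show "norm (conjugation (s 0) b) \<le> K2 * (max 1 (norm (s 0)))\<^sup>2" .
    qed
    show "0 \<le> ln (real DIM(real^'p^'p) * K2) + 2 * log_plus (norm (s 0))" for s :: "nat \<Rightarrow> real^'p^'p"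
      using K2(1) by (intro h0) auto
  qed (rule hi)
  from transfer[OF this] have 2: "AE \<omega> in M. tempered_cocycle (\<lambda>n. conjugation (forward_product (\<lambda>n. A n \<omega>) n))
          (\<lambda>n. conjugation (A (Suc n) \<omega>)) \<Gamma>"
    unfolding iterate_cocycle_conjugation by (simp add: funpow_shift trajectory_def)
  show ?thesis using 1 2 by (rule that)
qed

section \<open>Total variation distance and wedge products\<close>

text \<open>For sum-normalized \<open>x\<close> and \<open>w\<close>, \<open>x\<^sub>i w\<^sub>j - w\<^sub>i x\<^sub>j = (x\<^sub>i - w\<^sub>i) w\<^sub>j - w\<^sub>i (x\<^sub>j - w\<^sub>j)\<close>, and summing over
  \<open>j\<close> gives back \<open>x\<^sub>i - w\<^sub>i\<close>; so total variation distance and wedge product are comparable.\<close>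

definition wedge :: "real^'p \<Rightarrow> real^'p \<Rightarrow> real^'p^'p" where
  "wedge x w = (\<chi> i j. x $ i * w $ j - w $ i * x $ j)"

lemma wedge_nth: "wedge x w $ i $ j = x $ i * w $ j - w $ i * x $ j"
  by (simp add: wedge_def)

lemma linear_wedge: "linear (wedge x)"
  by (rule linearI) (simp_all add: vec_eq_iff wedge_nth algebra_simps)

lemma wedge_swap: "wedge x w = - wedge w x"
  by (simp add: vec_eq_iff wedge_nth)

lemma conjugation_wedge:
  fixes A :: "real^'p^'p"
  shows "conjugation A (wedge x w) = wedge (A *v x) (A *v w)"
proof -
  have prod: "(\<Sum>l\<in>UNIV. \<Sum>k\<in>UNIV. f k * g l) = sum f UNIV * sum g UNIV" for f g :: "'p \<Rightarrow> real"
    unfolding sum_product by (rule sum.swap)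
  have "conjugation A (wedge x w) $ i $ j = wedge (A *v x) (A *v w) $ i $ j" for i j
  proof -
    have "conjugation A (wedge x w) $ i $ j
        = (\<Sum>l\<in>UNIV. \<Sum>k\<in>UNIV. A $ i $ k * (x $ k * w $ l - w $ k * x $ l) * A $ j $ l)"
      by (simp add: conjugation_def matrix_matrix_mult_def transpose_def wedge_nth sum_distrib_right)
    also have "\<dots> = (\<Sum>l\<in>UNIV. \<Sum>k\<in>UNIV. (A $ i $ k * x $ k) * (A $ j $ l * w $ l) - (A $ i $ k * w $ k) * (A $ j $ l * x $ l))"
      by (intro sum.cong refl) (simp add: algebra_simps)
    also have "\<dots> = wedge (A *v x) (A *v w) $ i $ j"
      unfolding sum_subtractf prod by (simp add: wedge_nth matrix_vector_mult_def mult.commute)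
    finally show ?thesis .
  qed
  then show ?thesis by (simp add: vec_eq_iff)
qed

text \<open>Lagrange's identity. Each minor occurs twice in the antisymmetric matrix, whence the
  factor \<open>sqrt 2\<close>.\<close>

lemma norm_wedge: "norm (wedge x w) = sqrt 2 * vol [x, w]"
proof -
  have vol: "(vol [x, w])\<^sup>2 = (x \<bullet> x) * (w \<bullet> w) - (x \<bullet> w)\<^sup>2"
    using norm_proj_mult_square[of x w] by simp
  have "(norm (wedge x w))\<^sup>2 = (\<Sum>i\<in>UNIV. \<Sum>j\<in>UNIV. (x $ i * w $ j - w $ i * x $ j)\<^sup>2)"
    unfolding power2_norm_eq_inner inner_vec_def by (simp add: wedge_nth power2_eq_square)
  also have "\<dots> = (\<Sum>i\<in>UNIV. \<Sum>j\<in>UNIV. (x $ i * x $ i) * (w $ j * w $ j) + (w $ i * w $ i) * (x $ j * x $ j)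
      - 2 * ((x $ i * w $ i) * (x $ j * w $ j)))"
    by (intro sum.cong refl) (simp add: power2_eq_square algebra_simps)
  also have "\<dots> = (x \<bullet> x) * (w \<bullet> w) + (w \<bullet> w) * (x \<bullet> x) - 2 * ((x \<bullet> w) * (x \<bullet> w))"
    unfolding sum_subtractf sum.distrib inner_vec_def inner_real_def sum_product
    by (simp add: sum_distrib_left)
  also have "\<dots> = (sqrt 2 * vol [x, w])\<^sup>2"
    unfolding power_mult_distrib vol by (simp add: power2_eq_square)
  finally show ?thesis by (rule power2_eq_imp_eq) (auto intro: vol_nonneg mult_nonneg_nonneg simp del: vol.simps)
qed

lemma sum_abs_wedge_le: "(\<Sum>i\<in>UNIV. \<Sum>j\<in>UNIV. \<bar>wedge x w $ i $ j\<bar>) \<le> real (CARD('p) * CARD('p)) * norm (wedge x (w :: real^'p))"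
proof -
  have "(\<Sum>i\<in>UNIV. \<Sum>j\<in>UNIV. \<bar>wedge x w $ i $ j\<bar>) \<le> (\<Sum>i\<in>(UNIV::'p set). \<Sum>j\<in>(UNIV::'p set). norm (wedge x w))"
    by (intro sum_mono abs_matrix_component_le)
  then show ?thesis by simp
qed

lemma tv_dist_le_wedge:
  fixes x w :: "real^'p"
  assumes s: "0 < (\<Sum>i\<in>UNIV. x $ i)" and t: "0 < (\<Sum>i\<in>UNIV. w $ i)"
  shows "tv_dist (normalize_sum x) (normalize_sum w) \<le> real (CARD('p) * CARD('p)) *
    (norm (wedge x w) * (inverse (\<Sum>i\<in>UNIV. x $ i) * inverse (\<Sum>i\<in>UNIV. w $ i)))"
proof -
  define S T where "S = (\<Sum>i\<in>UNIV. x $ i)" and "T = (\<Sum>i\<in>UNIV. w $ i)"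
  have pos: "0 < S" "0 < T" using assms by (simp_all add: S_def T_def)
  have comp: "\<bar>normalize_sum x $ i - normalize_sum w $ i\<bar> \<le> (\<Sum>j\<in>UNIV. \<bar>wedge x w $ i $ j\<bar>) * (inverse S * inverse T)" for i
  proof -
    have "normalize_sum x $ i - normalize_sum w $ i = (x $ i * T - w $ i * S) * (inverse S * inverse T)"
      using pos by (simp add: normalize_sum_def S_def[symmetric] T_def[symmetric] field_simps)
    also have "x $ i * T - w $ i * S = (\<Sum>j\<in>UNIV. wedge x w $ i $ j)"
      by (simp add: S_def T_def wedge_nth sum_distrib_left sum_subtractf)
    finally have "\<bar>normalize_sum x $ i - normalize_sum w $ i\<bar> = \<bar>\<Sum>j\<in>UNIV. wedge x w $ i $ j\<bar> * (inverse S * inverse T)"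
      using pos by (simp add: abs_mult)
    also have "\<dots> \<le> (\<Sum>j\<in>UNIV. \<bar>wedge x w $ i $ j\<bar>) * (inverse S * inverse T)"
      using pos by (intro mult_right_mono sum_abs) auto
    finally show ?thesis .
  qed
  have "tv_dist (normalize_sum x) (normalize_sum w) \<le> (\<Sum>i\<in>UNIV. \<bar>normalize_sum x $ i - normalize_sum w $ i\<bar>)"
    unfolding tv_dist_def using sum_nonneg[of UNIV "\<lambda>i. \<bar>normalize_sum x $ i - normalize_sum w $ i\<bar>"] by simp
  also have "\<dots> \<le> (\<Sum>i\<in>UNIV. (\<Sum>j\<in>UNIV. \<bar>wedge x w $ i $ j\<bar>) * (inverse S * inverse T))"
    by (intro sum_mono comp)
  also have "\<dots> = (\<Sum>i\<in>UNIV. \<Sum>j\<in>UNIV. \<bar>wedge x w $ i $ j\<bar>) * (inverse S * inverse T)"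
    by (simp add: sum_distrib_right)
  also have "\<dots> \<le> (real (CARD('p) * CARD('p)) * norm (wedge x w)) * (inverse S * inverse T)"
    using pos by (intro mult_right_mono sum_abs_wedge_le) auto
  finally show ?thesis by (simp add: S_def T_def mult.assoc)
qed

lemma wedge_le_tv_dist:
  fixes x w :: "real^'p"
  assumes s: "0 < (\<Sum>i\<in>UNIV. x $ i)" and t: "0 < (\<Sum>i\<in>UNIV. w $ i)" and w: "\<And>i. 0 \<le> w $ i"
  shows "norm (wedge x w) * (inverse (\<Sum>i\<in>UNIV. x $ i) * inverse (\<Sum>i\<in>UNIV. w $ i))
    \<le> 4 * real CARD('p) * tv_dist (normalize_sum x) (normalize_sum w)"
proof -
  define S T where "S = (\<Sum>i\<in>UNIV. x $ i)" and "T = (\<Sum>i\<in>UNIV. w $ i)"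
  have pos: "0 < S" "0 < T" using assms by (simp_all add: S_def T_def)
  define \<xi> \<eta> where "\<xi> = normalize_sum x" and "\<eta> = normalize_sum w"
  define d where "d i = \<bar>\<xi> $ i - \<eta> $ i\<bar>" for i
  have \<eta>: "0 \<le> \<eta> $ i" "\<eta> $ i \<le> 1" for i
  proof -
    have "w $ i \<le> T" unfolding T_def using w by (intro member_le_sum) auto
    then show "0 \<le> \<eta> $ i" "\<eta> $ i \<le> 1" using w[of i] pos
      by (simp_all add: \<eta>_def normalize_sum_def T_def[symmetric])
  qed
  have comp: "\<bar>wedge x w $ i $ j\<bar> * (inverse S * inverse T) \<le> d i + d j" for i j
  proof -
    have "wedge x w $ i $ j * (inverse S * inverse T) = \<xi> $ i * \<eta> $ j - \<eta> $ i * \<xi> $ j"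
      using pos by (simp add: wedge_nth \<xi>_def \<eta>_def normalize_sum_def S_def[symmetric] T_def[symmetric] field_simps)
    also have "\<dots> = (\<xi> $ i - \<eta> $ i) * \<eta> $ j - \<eta> $ i * (\<xi> $ j - \<eta> $ j)" by (simp add: algebra_simps)
    finally have "\<bar>wedge x w $ i $ j\<bar> * (inverse S * inverse T) = \<bar>(\<xi> $ i - \<eta> $ i) * \<eta> $ j - \<eta> $ i * (\<xi> $ j - \<eta> $ j)\<bar>"
      using pos by (metis abs_mult abs_of_pos mult_pos_pos positive_imp_inverse_positive)
    also have "\<dots> \<le> \<bar>(\<xi> $ i - \<eta> $ i) * \<eta> $ j\<bar> + \<bar>\<eta> $ i * (\<xi> $ j - \<eta> $ j)\<bar>" by (rule abs_triangle_ineq4)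
    also have "\<dots> = d i * \<eta> $ j + \<eta> $ i * d j" using \<eta> by (simp add: abs_mult d_def)
    also have "\<dots> \<le> d i * 1 + 1 * d j" using \<eta> by (intro add_mono mult_mono) (auto simp: d_def)
    finally show ?thesis by simp
  qed
  have "norm (wedge x w) * (inverse S * inverse T) \<le> (\<Sum>i\<in>UNIV. \<Sum>j\<in>UNIV. \<bar>wedge x w $ i $ j\<bar>) * (inverse S * inverse T)"
    using pos by (intro mult_right_mono norm_matrix_le_sum) auto
  also have "\<dots> = (\<Sum>i\<in>UNIV. \<Sum>j\<in>UNIV. \<bar>wedge x w $ i $ j\<bar> * (inverse S * inverse T))"
    by (simp add: sum_distrib_right)
  also have "\<dots> \<le> (\<Sum>i\<in>(UNIV :: 'p set). \<Sum>j\<in>(UNIV :: 'p set). d i + d j)" by (intro sum_mono comp)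
  \<comment> \<open>The constant of the lemma is assembled here: \<open>2 * p\<close> from summing
    \<open>d i + d j\<close> over all pairs, and another \<open>2\<close> from the half in the total
    variation distance.\<close>
  also have "\<dots> = 2 * real CARD('p) * (\<Sum>i\<in>UNIV. d i)" by (simp add: sum.distrib sum_distrib_left mult.assoc)
  also have "(\<Sum>i\<in>UNIV. d i) = 2 * tv_dist \<xi> \<eta>" by (simp add: tv_dist_def d_def)
  finally show ?thesis by (simp add: S_def T_def \<xi>_def \<eta>_def)
qed

section \<open>Nonnegative matrices and the common top growth rate\<close>

lemma sum_pos_nonneg_nonzero:
  assumes "x \<in> nonneg_nonzero"
  shows "0 < (\<Sum>i\<in>UNIV. x $ i)"
proof -
  have nn: "\<And>i. 0 \<le> x $ i" using assms by (simp add: nonneg_nonzero_def)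
  obtain i where "x $ i \<noteq> 0" using assms by (auto simp: nonneg_nonzero_def vec_eq_iff)
  then have "0 < x $ i" using nn[of i] by simp
  also have "\<dots> \<le> (\<Sum>i\<in>UNIV. x $ i)" using nn by (intro member_le_sum) auto
  finally show ?thesis .
qed

lemma matrix_vector_mult_mono:
  assumes "nonneg_matrix A" "\<And>j. x $ j \<le> y $ j"
  shows "(A *v x) $ i \<le> (A *v y) $ i"
  using assms by (auto simp: matrix_vector_mult_def nonneg_matrix_def intro!: sum_mono mult_left_mono)

lemma matrix_vector_mult_nonneg_nonzero:
  assumes A: "nonneg_matrix A" "column_allowable A" and x: "x \<in> nonneg_nonzero"
  shows "A *v x \<in> nonneg_nonzero"
proof -
  have nn: "\<And>i. 0 \<le> x $ i" using x by (simp add: nonneg_nonzero_def)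
  have A0: "\<And>i j. 0 \<le> A $ i $ j" using A by (simp add: nonneg_matrix_def)
  obtain j where "x $ j \<noteq> 0" using x by (auto simp: nonneg_nonzero_def vec_eq_iff)
  then have xj: "0 < x $ j" using nn[of j] by simp
  obtain i where Aij: "0 < A $ i $ j" using A(2) by (auto simp: column_allowable_def)
  have "0 < A $ i $ j * x $ j" using xj Aij by simp
  also have "\<dots> \<le> (A *v x) $ i"
    unfolding matrix_vector_mult_def using nn A0 by (auto intro!: member_le_sum mult_nonneg_nonneg)
  finally have "A *v x \<noteq> 0" by auto
  moreover have "0 \<le> (A *v x) $ i" for i
    using nn A0 by (auto simp: matrix_vector_mult_def intro!: sum_nonneg mult_nonneg_nonneg)
  ultimately show ?thesis by (simp add: nonneg_nonzero_def)
qed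

text \<open>For one realization the stopping time is merely a number \<open>N\<close>. A finite
  \<open>\<Lambda> 1\<close> is what permits dividing by the growing coordinate sums.\<close>

locale primitive_cocycle = matrix_cocycle a \<Lambda>
  for a :: "nat \<Rightarrow> real^'p^'p" and \<Lambda> +
  fixes \<Gamma> :: "nat \<Rightarrow> ereal"
  assumes conj: "tempered_cocycle (\<lambda>n. conjugation (forward_product a n)) (\<lambda>n. conjugation (a (Suc n))) \<Gamma>"
    and nonneg: "n \<ge> 1 \<Longrightarrow> nonneg_matrix (a n)" and allow: "n \<ge> 1 \<Longrightarrow> column_allowable (a n)"
    and primitive: "\<exists>N. \<forall>i. (\<forall>j. 0 < forward_product a N $ i $ j) \<or> (\<forall>j. forward_product a N $ i $ j = 0)"
    and \<Lambda>1: "\<Lambda> 1 \<noteq> - \<infinity>" and card: "CARD('p) \<ge> 2"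
begin

sublocale conj: tempered_cocycle "\<lambda>n. conjugation (forward_product a n)" "\<lambda>n. conjugation (a (Suc n))" \<Gamma>
  by (rule conj)

abbreviation cnorm :: "nat \<Rightarrow> real^'p^'p \<Rightarrow> real" where
  "cnorm n X \<equiv> norm (conjugation (fp n) X)"

lemma forward_product_nonneg_nonzero:
  assumes "x \<in> nonneg_nonzero"
  shows "fp n *v x \<in> nonneg_nonzero"
proof (induction n)
  case (Suc n)
  then have "a (Suc n) *v (fp n *v x) \<in> nonneg_nonzero"
    using nonneg[of "Suc n"] allow[of "Suc n"] by (simp add: matrix_vector_mult_nonneg_nonzero)
  then show ?case by (simp add: matrix_vector_mul_assoc)
qed (simp add: assms)

lemma forward_product_mono:
  assumes "\<And>j. (fp m *v x) $ j \<le> (fp m *v y) $ j" "m \<le> n"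
  shows "(fp n *v x) $ i \<le> (fp n *v y) $ i"
  using assms(2)
proof (induction n arbitrary: i rule: dec_induct)
  case (step n)
  have "(a (Suc n) *v (fp n *v x)) $ i \<le> (a (Suc n) *v (fp n *v y)) $ i"
    by (rule matrix_vector_mult_mono[OF nonneg step.IH]) simp
  then show ?case by (simp add: matrix_vector_mul_assoc)
qed (rule assms(1))

text \<open>A time at which every row is positive or zero makes the images of all nonnegative nonzero
  vectors comparable from then on, so they all grow at the top rate.\<close>

lemma forward_product_comparable:
  assumes x: "x \<in> nonneg_nonzero" and y: "y \<in> nonneg_nonzero"
  obtains C N where "0 \<le> C" "\<forall>n\<ge>N. \<forall>i. (fp n *v y) $ i \<le> C * (fp n *v x) $ i"
proof -
  obtain N where N: "\<And>i. (\<forall>j. 0 < fp N $ i $ j) \<or> (\<forall>j. fp N $ i $ j = 0)"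
    using primitive by blast
  let ?M = "fp N"
  \<comment> \<open>A zero row contributes \<open>0 / 0 = 0\<close>; since all quotients are
    nonnegative, their sum dominates each of them.\<close>
  define C where "C = (\<Sum>i\<in>UNIV. (?M *v y) $ i / (?M *v x) $ i)"
  have pos: "0 \<le> (?M *v z) $ i" if "z \<in> nonneg_nonzero" for z i
    using forward_product_nonneg_nonzero[OF that, of N] by (simp add: nonneg_nonzero_def)
  have C0: "0 \<le> C" unfolding C_def using pos x y by (intro sum_nonneg divide_nonneg_nonneg) auto
  have le: "(?M *v y) $ i \<le> (?M *v (C *\<^sub>R x)) $ i" for i
  proof (cases "\<forall>j. ?M $ i $ j = 0")
    case True
    then show ?thesis by (simp add: matrix_vector_mult_def)
  next
    case False
    then have row: "\<And>j. 0 < ?M $ i $ j" using N[of i] by blast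
    have xn: "\<And>j. 0 \<le> x $ j" using x by (simp add: nonneg_nonzero_def)
    obtain j where "x $ j \<noteq> 0" using x by (auto simp: nonneg_nonzero_def vec_eq_iff)
    then have "0 < x $ j" using xn[of j] by simp
    then have "0 < ?M $ i $ j * x $ j" using row[of j] by simp
    also have "\<dots> \<le> (?M *v x) $ i"
      unfolding matrix_vector_mult_def using xn less_imp_le[OF row]
      by (auto intro!: member_le_sum mult_nonneg_nonneg)
    finally have p: "0 < (?M *v x) $ i" .
    have "(?M *v y) $ i / (?M *v x) $ i \<le> C"
      unfolding C_def using pos x y by (intro member_le_sum divide_nonneg_nonneg) auto
    then show ?thesis using p by (simp add: matrix_vector_mult_scaleR pos_divide_le_eq)
  qed
  have "(fp n *v y) $ i \<le> C * (fp n *v x) $ i" if "N \<le> n" for n i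
    using forward_product_mono[OF le that, of i] by (simp add: matrix_vector_mult_scaleR)
  with C0 that show ?thesis by blast
qed

text \<open>A vector \<open>y\<close> attaining the top rate may have mixed signs. It is bounded
  entrywise by \<open>norm y\<close> times the all-ones vector \<open>e\<close>, whose image is
  eventually dominated by a multiple of the image of \<open>x\<close>.\<close>

lemma sum_forward_product_rate:
  assumes x: "x \<in> nonneg_nonzero"
  shows "has_rate (\<lambda>n. \<Sum>i\<in>UNIV. (fp n *v x) $ i) (\<Lambda> 1)"
proof -
  let ?s = "\<lambda>n. \<Sum>i\<in>UNIV. (fp n *v x) $ i"
  have "rate_le (\<lambda>n. real CARD('p) * norm (fp n *v x)) (\<Lambda> 1)"
    by (intro rate_le_cmult rate_le_norm_F) auto
  then have le: "rate_le ?s (\<Lambda> 1)"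
  proof (rule rate_le_mono)
    show "\<forall>\<^sub>F n in sequentially. ?s n \<le> real CARD('p) * norm (fp n *v x)"
    proof (rule always_eventually, rule allI)
      fix n
      have "?s n \<le> (\<Sum>i\<in>(UNIV :: 'p set). norm (fp n *v x))"
        by (intro sum_mono order_trans[OF abs_ge_self component_le_norm_cart])
      then show "?s n \<le> real CARD('p) * norm (fp n *v x)" by simp
    qed
  qed simp
  define e :: "real^'p" where "e = (\<chi> i. 1)"
  have e: "e \<in> nonneg_nonzero" by (simp add: nonneg_nonzero_def e_def vec_eq_iff)
  obtain C N where C: "0 \<le> C"
    "\<forall>n\<ge>N. \<forall>i. (fp n *v e) $ i \<le> C * (fp n *v x) $ i"
    by (rule forward_product_comparable[OF x e])
  have D: "DIM(real^'p) \<ge> 2" using card by simp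
  obtain y where y: "has_rate (\<lambda>n. norm (fp n *v y)) (\<Lambda> 1)"
    by (rule top_exponents[OF D \<Lambda>1])
  define K where "K = 2 * (norm y + 1) * (C + 1)"
  have K: "0 < K" using C(1) unfolding K_def by (intro mult_pos_pos add_nonneg_pos) auto
  have ge': "norm (fp n *v y) \<le> K * ?s n" if "N \<le> n" for n
  proof -
    let ?M = "fp n"
    have x0: "0 \<le> (?M *v x) $ i" for i
      using forward_product_nonneg_nonzero[OF x, of n] by (simp add: nonneg_nonzero_def)
    have b1: "\<bar>(?M *v y) $ i\<bar> \<le> norm y * (?M *v e) $ i" for i
    proof -
      have y_le: "\<bar>y $ j\<bar> \<le> norm y" for j by (rule component_le_norm_cart)
      have "(?M *v y) $ i \<le> (?M *v (norm y *\<^sub>R e)) $ i"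
        by (rule forward_product_mono[of 0]) (use y_le in \<open>simp_all add: e_def abs_le_iff\<close>)
      moreover have "(?M *v (- y)) $ i \<le> (?M *v (norm y *\<^sub>R e)) $ i"
        by (rule forward_product_mono[of 0]) (use y_le in \<open>simp_all add: e_def abs_le_iff\<close>)
      moreover have "(?M *v (- y)) $ i = - (?M *v y) $ i"
        by (simp add: linear_neg[OF linear_F])
      ultimately show ?thesis by (simp add: abs_le_iff matrix_vector_mult_scaleR)
    qed
    have b2: "norm y * (?M *v e) $ i \<le> norm y * (C * (?M *v x) $ i)" for i
      by (rule mult_left_mono[OF C(2)[rule_format, OF that]]) simp
    have "\<bar>(?M *v y) $ i\<bar> \<le> norm y * C * (?M *v x) $ i" for i
      using order_trans[OF b1 b2] by (simp only: mult.assoc)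
    then have "(\<Sum>i\<in>UNIV. \<bar>(?M *v y) $ i\<bar>) \<le> (\<Sum>i\<in>UNIV. norm y * C * (?M *v x) $ i)"
      by (intro sum_mono)
    then have "norm (?M *v y) \<le> norm y * C * ?s n"
      using norm_le_l1_cart[of "?M *v y"] by (simp add: sum_distrib_left)
    also have "\<dots> \<le> K * ?s n"
    proof (rule mult_right_mono)
      have "norm y * C \<le> (norm y + 1) * (C + 1)" using C(1) by (intro mult_mono) auto
      moreover have "0 \<le> (norm y + 1) * (C + 1)" using C(1) by (intro mult_nonneg_nonneg) auto
      ultimately show "norm y * C \<le> K" unfolding K_def by linarith
    qed (intro sum_nonneg x0)
    finally show ?thesis .
  qed
  have "rate_ge (\<lambda>n. inverse K * norm (fp n *v y)) (\<Lambda> 1)"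
    using y K by (intro rate_ge_cmult) (auto simp: has_rate_def)
  then have "rate_ge ?s (\<Lambda> 1)"
  proof (rule rate_ge_mono)
    show "\<forall>\<^sub>F n in sequentially. inverse K * norm (fp n *v y) \<le> ?s n"
      using eventually_ge_at_top[of N]
    proof eventually_elim
      case (elim n)
      have "inverse K * norm (fp n *v y) \<le> inverse K * (K * ?s n)"
        using ge'[OF elim] K by (intro mult_left_mono) auto
      then show ?case using K by (simp add: mult.assoc[symmetric])
    qed
  qed simp
  with le show ?thesis by (simp add: has_rate_def)
qed

text \<open>The bound comes from areas under the matrix cocycle and so refers to
  \<open>\<Lambda>\<close>, the quantity tied to the Lyapunov exponents.\<close>

lemma wedge_rate_le: "rate_le (\<lambda>n. cnorm n (wedge x w)) (\<Lambda> 2)"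
proof -
  have "rate_le (\<lambda>n. vol (map ((*v) (fp n)) [x, w])) (\<Lambda> 2)"
    using rate_vol_le[of "[x, w]"] by (simp add: numeral_2_eq_2 del: vol.simps)
  then have "rate_le (\<lambda>n. sqrt 2 * vol (map ((*v) (fp n)) [x, w])) (\<Lambda> 2)"
    by (rule rate_le_cmult) (rule vol_nonneg)
  then show ?thesis by (simp add: conjugation_wedge norm_wedge del: vol.simps)
qed

text \<open>Distance and normalized wedge are comparable up to constants, and each coordinate sum
  contributes exactly \<open>- \<Lambda> 1\<close>. The rate \<open>\<rho>\<close> may be
  \<open>-\<infinity>\<close>.\<close>

lemma tv_rate_tendsto:
  assumes x: "x \<in> nonneg_nonzero" and w: "w \<in> nonneg_nonzero"
    and \<rho>: "has_rate (\<lambda>n. cnorm n (wedge x w)) \<rho>"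
  shows "tv_rate a x w \<longlonglongrightarrow> \<rho> - \<Lambda> 1 - \<Lambda> 1"
proof -
  let ?s = "\<lambda>n. \<Sum>i\<in>UNIV. (fp n *v x) $ i"
  let ?t = "\<lambda>n. \<Sum>i\<in>UNIV. (fp n *v w) $ i"
  let ?tv = "\<lambda>n. tv_dist (normalize_sum (fp n *v x)) (normalize_sum (fp n *v w))"
  let ?W = "\<lambda>n. norm (wedge (fp n *v x) (fp n *v w))"
  obtain l where l: "\<Lambda> 1 = ereal l" using \<Lambda>_real \<Lambda>1 by blast
  have s0: "0 < ?s n" and t0: "0 < ?t n" for n
    using x w by (auto intro!: sum_pos_nonneg_nonzero forward_product_nonneg_nonzero)
  have W: "has_rate ?W \<rho>" using \<rho> by (simp add: conjugation_wedge)
  have \<rho>_fin: "\<rho> \<noteq> \<infinity>"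
  proof -
    have "\<rho> \<le> \<Lambda> 2" using \<rho> wedge_rate_le rate_ge_le unfolding has_rate_def by blast
    then show ?thesis using \<Lambda>_less[of 2] by auto
  qed
  have s: "rate_le (\<lambda>n. inverse (?s n)) (- \<Lambda> 1)" "rate_ge (\<lambda>n. inverse (?s n)) (- \<Lambda> 1)"
    using sum_forward_product_rate[OF x] s0
    by (auto simp: has_rate_def intro!: rate_le_inverse rate_ge_inverse)
  have t: "rate_le (\<lambda>n. inverse (?t n)) (- \<Lambda> 1)" "rate_ge (\<lambda>n. inverse (?t n)) (- \<Lambda> 1)"
    using sum_forward_product_rate[OF w] t0
    by (auto simp: has_rate_def intro!: rate_le_inverse rate_ge_inverse)
  have eq: "\<rho> + (- \<Lambda> 1 + - \<Lambda> 1) = \<rho> - \<Lambda> 1 - \<Lambda> 1" using l by (cases \<rho>) auto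
  have le: "rate_le (\<lambda>n. ?W n * (inverse (?s n) * inverse (?t n))) (\<rho> - \<Lambda> 1 - \<Lambda> 1)"
    unfolding eq[symmetric] using W s t \<rho>_fin l less_imp_le[OF s0] less_imp_le[OF t0]
    by (intro rate_le_mult) (auto simp: has_rate_def)
  have ge: "rate_ge (\<lambda>n. ?W n * (inverse (?s n) * inverse (?t n))) (\<rho> - \<Lambda> 1 - \<Lambda> 1)"
    unfolding eq[symmetric] using W s t \<rho>_fin l
    by (intro rate_ge_mult) (auto simp: has_rate_def)
  have "rate_le (\<lambda>n. real (CARD('p) * CARD('p)) * (?W n * (inverse (?s n) * inverse (?t n)))) (\<rho> - \<Lambda> 1 - \<Lambda> 1)"
    using less_imp_le[OF s0] less_imp_le[OF t0] by (intro rate_le_cmult le) auto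
  then have "rate_le ?tv (\<rho> - \<Lambda> 1 - \<Lambda> 1)"
    by (rule rate_le_mono) (auto intro!: always_eventually tv_dist_le_wedge s0 t0 simp del: of_nat_mult)
  moreover have "rate_ge ?tv (\<rho> - \<Lambda> 1 - \<Lambda> 1)"
  proof (rule rate_ge_mono)
    show "rate_ge (\<lambda>n. inverse (4 * real CARD('p)) * (?W n * (inverse (?s n) * inverse (?t n)))) (\<rho> - \<Lambda> 1 - \<Lambda> 1)"
      by (intro rate_ge_cmult ge) auto
    show "\<forall>\<^sub>F n in sequentially. inverse (4 * real CARD('p)) * (?W n * (inverse (?s n) * inverse (?t n))) \<le> ?tv n"
    proof (rule always_eventually, rule allI)
      fix n
      have "?W n * (inverse (?s n) * inverse (?t n)) \<le> 4 * real CARD('p) * ?tv n"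
        using forward_product_nonneg_nonzero[OF w, of n]
        by (intro wedge_le_tv_dist s0 t0) (simp add: nonneg_nonzero_def)
      then have "inverse (4 * real CARD('p)) * (?W n * (inverse (?s n) * inverse (?t n)))
          \<le> inverse (4 * real CARD('p)) * (4 * real CARD('p) * ?tv n)"
        by (intro mult_left_mono) auto
      then show "inverse (4 * real CARD('p)) * (?W n * (inverse (?s n) * inverse (?t n))) \<le> ?tv n"
        by (simp add: mult.assoc[symmetric])
    qed
  qed simp
  ultimately have "has_rate ?tv (\<rho> - \<Lambda> 1 - \<Lambda> 1)" by (simp add: has_rate_def)
  then show ?thesis unfolding has_rate_iff_tendsto tv_rate_def .
qed

lemma tv_rate_convergent:
  assumes "x \<in> nonneg_nonzero" "w \<in> nonneg_nonzero"
  shows "\<exists>l. tv_rate a x w \<longlonglongrightarrow> l \<and> l \<le> - (\<Lambda> 1 - (\<Lambda> 2 - \<Lambda> 1))"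
proof -
  obtain l where l: "\<Lambda> 1 = ereal l" using \<Lambda>_real \<Lambda>1 by blast
  obtain \<rho> where \<rho>: "has_rate (\<lambda>n. cnorm n (wedge x w)) \<rho>"
    using conj.has_rate_norm_F by blast
  then have le: "\<rho> \<le> \<Lambda> 2" using wedge_rate_le rate_ge_le unfolding has_rate_def by blast
  have "\<rho> - \<Lambda> 1 - \<Lambda> 1 \<le> - (\<Lambda> 1 - (\<Lambda> 2 - \<Lambda> 1))"
    using le l by (cases \<rho>; cases "\<Lambda> 2") auto
  then show ?thesis using tv_rate_tendsto[OF assms \<rho>] by blast
qed

end

section \<open>Generic pairs of vectors\<close>

lemma AE_lborel_notin_subspace:
  fixes S :: "'a::euclidean_space set"
  assumes "subspace S" "S \<noteq> UNIV"
  shows "AE x in lborel. x \<notin> S"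
proof -
  have "dim S < DIM('a)"
    using assms subspace_dim_equal[of S UNIV] dim_subset_UNIV[of S] by (force simp: dim_UNIV)
  then have "S \<in> null_sets lebesgue"
    unfolding negligible_iff_null_sets[symmetric] by (rule negligible_lowdim)
  moreover have "S \<in> sets lborel" using closed_subspace[OF assms(1)] by simp
  ultimately have "S \<in> null_sets lborel" by (simp add: null_sets_completion_iff)
  then show ?thesis by (rule AE_not_in)
qed

context primitive_cocycle
begin

text \<open>Each matrix gets its own strict bound \<open>c\<close>, so this is the union of a chain
  of subspaces and sums are handled by the larger bound. If \<open>\<Lambda> 2\<close> is
  \<open>-\<infinity>\<close>, not even \<open>0\<close> is slow.\<close>

definition slow :: "real^'p^'p \<Rightarrow> bool" where
  "slow X \<longleftrightarrow> (\<exists>c. c < \<Lambda> 2 \<and> rate_le (\<lambda>n. cnorm n X) c)"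

lemma slow_0:
  assumes "\<Lambda> 2 \<noteq> - \<infinity>"
  shows "slow 0"
proof -
  have "- \<infinity> < \<Lambda> 2" using assms by (cases "\<Lambda> 2") auto
  then show ?thesis
    unfolding slow_def by (auto intro!: exI[of _ "- \<infinity>"] simp: linear_0[OF linear_conjugation] rate_le_zero)
qed

lemma slow_add:
  assumes "slow X" "slow Y"
  shows "slow (X + Y)"
proof -
  obtain c d where c: "c < \<Lambda> 2" "rate_le (\<lambda>n. cnorm n X) c"
    and d: "d < \<Lambda> 2" "rate_le (\<lambda>n. cnorm n Y) d"
    using assms by (auto simp: slow_def)
  have "rate_le (\<lambda>n. cnorm n X + cnorm n Y) (max c d)"
    by (intro rate_le_add rate_le_weaken[OF c(2)] rate_le_weaken[OF d(2)]) auto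
  then have "rate_le (\<lambda>n. cnorm n (X + Y)) (max c d)"
    by (rule rate_le_mono)
      (auto intro!: always_eventually norm_triangle_ineq simp: linear_add[OF linear_conjugation])
  then show ?thesis using c(1) d(1) unfolding slow_def by (intro exI[of _ "max c d"]) auto
qed

lemma slow_scale:
  assumes "slow X"
  shows "slow (k *\<^sub>R X)"
proof -
  obtain c where c: "c < \<Lambda> 2" "rate_le (\<lambda>n. cnorm n X) c"
    using assms by (auto simp: slow_def)
  have "rate_le (\<lambda>n. \<bar>k\<bar> * cnorm n X) c"
    by (intro rate_le_cmult c) auto
  then have "rate_le (\<lambda>n. cnorm n (k *\<^sub>R X)) c"
    by (simp add: linear_scale[OF linear_conjugation])
  then show ?thesis using c(1) unfolding slow_def by blast
qed

lemma slow_wedge_swap: "slow (wedge x w) \<longleftrightarrow> slow (wedge w x)"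
proof -
  have "slow (wedge w x)" if "slow (wedge x w)" for x w
    unfolding wedge_swap[of w x] using slow_scale[OF that, of "-1"] by simp
  then show ?thesis by blast
qed

lemma subspace_slow_wedge:
  assumes "\<Lambda> 2 \<noteq> - \<infinity>"
  shows "subspace {w. slow (wedge x w)}"
  by (rule subspaceI)
    (auto simp: linear_0[OF linear_wedge] linear_add[OF linear_wedge] linear_scale[OF linear_wedge]
      intro: slow_0[OF assms] slow_add slow_scale)

text \<open>For fixed \<open>x\<close> the slow partners form a subspace, and the \<open>x\<close>
  for which it is everything again form a subspace. The latter is proper because one frame pair
  attains \<open>\<Lambda> 2\<close>; so null sets of proper subspaces are used twice.\<close>

lemma AE_not_slow: "AE x in lborel. AE w in lborel. \<not> slow (wedge x w)"
proof (cases "\<Lambda> 2 = - \<infinity>")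
  case True
  then show ?thesis by (simp add: slow_def)
next
  case False
  define S where "S = (\<Inter>w. {x. slow (wedge w x)})"
  have S: "subspace S" unfolding S_def by (intro subspace_Inter) (auto intro: subspace_slow_wedge[OF False])
  have D: "DIM(real^'p) \<ge> 2" using card by simp
  obtain x where "\<exists>y. has_rate (\<lambda>n. vol [fp n *v y, fp n *v x]) (\<Lambda> 2)"
    by (rule top_exponents[OF D \<Lambda>1])
  then obtain y where y: "has_rate (\<lambda>n. vol [fp n *v y, fp n *v x]) (\<Lambda> 2)" by blast
  have "\<not> slow (wedge y x)"
  proof
    assume "slow (wedge y x)"
    then obtain c where c: "c < \<Lambda> 2" "rate_le (\<lambda>n. cnorm n (wedge y x)) c"
      by (auto simp: slow_def)
    have "rate_ge (\<lambda>n. sqrt 2 * vol [fp n *v y, fp n *v x]) (\<Lambda> 2)"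
      using y by (intro rate_ge_cmult) (auto simp: has_rate_def simp del: vol.simps)
    then have "rate_ge (\<lambda>n. cnorm n (wedge y x)) (\<Lambda> 2)"
      by (simp add: conjugation_wedge norm_wedge del: vol.simps)
    then show False using c rate_ge_le by fastforce
  qed
  then have "S \<noteq> UNIV" by (auto simp: S_def)
  from AE_lborel_notin_subspace[OF S this] show ?thesis
  proof eventually_elim
    case (elim x)
    then obtain w where "\<not> slow (wedge x w)" by (auto simp: S_def slow_wedge_swap[of _ x])
    then have "{w. slow (wedge x w)} \<noteq> UNIV" by blast
    from AE_lborel_notin_subspace[OF subspace_slow_wedge[OF False] this] show ?case by simp
  qed
qed

lemma AE_tv_rate:
  "AE x in lborel. AE w in lborel. x \<in> nonneg_nonzero \<longrightarrow> w \<in> nonneg_nonzero \<longrightarrow>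
     tv_rate a x w \<longlonglongrightarrow> - (\<Lambda> 1 - (\<Lambda> 2 - \<Lambda> 1))"
  using AE_not_slow
proof eventually_elim
  case (elim x)
  then show ?case
  proof eventually_elim
    case (elim w)
    show ?case
    proof (intro impI)
      assume xw: "x \<in> nonneg_nonzero" "w \<in> nonneg_nonzero"
      obtain l where l: "\<Lambda> 1 = ereal l" using \<Lambda>_real \<Lambda>1 by blast
      obtain \<rho> where \<rho>: "has_rate (\<lambda>n. cnorm n (wedge x w)) \<rho>"
        using conj.has_rate_norm_F by blast
      have "\<rho> \<le> \<Lambda> 2" using \<rho> wedge_rate_le rate_ge_le unfolding has_rate_def by blast
      moreover have "\<not> \<rho> < \<Lambda> 2" using \<rho> elim unfolding slow_def has_rate_def by blast
      ultimately have "\<rho> = \<Lambda> 2" by simp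
      moreover have "\<Lambda> 2 - \<Lambda> 1 - \<Lambda> 1 = - (\<Lambda> 1 - (\<Lambda> 2 - \<Lambda> 1))"
        using l \<Lambda>_less[of 2] by (cases "\<Lambda> 2") auto
      ultimately show "tv_rate a x w \<longlonglongrightarrow> - (\<Lambda> 1 - (\<Lambda> 2 - \<Lambda> 1))"
        using tv_rate_tendsto[OF xw \<rho>] by simp
    qed
  qed
qed

end

section \<open>Return to the random process and exchange of null sets\<close>

lemma lyapunov_exponent_eq:
  assumes "prob_space M" "AE \<omega> in M. lyapunov_spectrum (\<lambda>n. A n \<omega>) ! (k - 1) = c"
  shows "lyapunov_exponent M A k = c"
  unfolding lyapunov_exponent_def
proof (rule the_equality)
  show "AE \<omega> in M. lyapunov_spectrum (\<lambda>n. A n \<omega>) ! (k - 1) = c" by (rule assms(2))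
  interpret prob_space M by fact
  fix c' assume "AE \<omega> in M. lyapunov_spectrum (\<lambda>n. A n \<omega>) ! (k - 1) = c'"
  \<comment> \<open>Total mass one forces two almost sure constants to agree.\<close>
  with assms(2) have "AE \<omega> in M. c' = c" by eventually_elim simp
  then show "c' = c" by (simp add: AE_const)
qed

lemma borel_measurable_tv_rate:
  fixes a :: "nat \<Rightarrow> 'z \<Rightarrow> real^'p^'p"
  assumes a: "\<And>n. n \<ge> 1 \<Longrightarrow> a n \<in> borel_measurable N"
    and x: "x \<in> borel_measurable N" and w: "w \<in> borel_measurable N"
  shows "(\<lambda>z. tv_rate (\<lambda>n. a n z) (x z) (w z) n) \<in> borel_measurable N"
proof -
  have fp: "(\<lambda>z. forward_product (\<lambda>n. a n z) n) \<in> borel_measurable N"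
  proof (induction n)
    case (Suc n)
    then show ?case using a[of "Suc n"] by (simp add: borel_measurable_matrix_mult)
  qed simp
  have comp: "(\<lambda>z. normalize_sum (forward_product (\<lambda>n. a n z) n *v y z) $ i) \<in> borel_measurable N"
    if "y \<in> borel_measurable N" for y :: "'z \<Rightarrow> real^'p" and i
  proof -
    have "(\<lambda>z. (forward_product (\<lambda>n. a n z) n *v y z) $ i) \<in> borel_measurable N" for i
      using borel_measurable_matrix_vector_mult[OF fp that] unfolding borel_measurable_vec_iff by blast
    note [measurable] = this
    show ?thesis unfolding normalize_sum_def by simp
  qed
  note [measurable] = comp[OF x] comp[OF w]
  have [measurable]: "elog \<in> borel_measurable borel" unfolding elog_def[abs_def] by measurable
  show ?thesis unfolding tv_rate_def tv_dist_def by measurable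
qed

text \<open>Fubini requires this set to be measurable, once in the pair of vectors for a fixed
  realization and once jointly with the realization; hence the general space \<open>N\<close>, on
  which all data may vary.\<close>

lemma sets_tv_rate_tendsto:
  fixes a :: "nat \<Rightarrow> 'z \<Rightarrow> real^'p^'p"
  assumes a: "\<And>n. n \<ge> 1 \<Longrightarrow> a n \<in> borel_measurable N"
    and x: "x \<in> borel_measurable N" and w: "w \<in> borel_measurable N"
  shows "{z \<in> space N. x z \<in> nonneg_nonzero \<longrightarrow> w z \<in> nonneg_nonzero \<longrightarrow>
    tv_rate (\<lambda>n. a n z) (x z) (w z) \<longlonglongrightarrow> c} \<in> sets N"
proof -
  define f where "f n z = tv_rate (\<lambda>n. a n z) (x z) (w z) n" for n z
  have f: "f n \<in> borel_measurable N" for n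
    unfolding f_def by (rule borel_measurable_tv_rate[OF a x w])
  define U L where "U z = limsup (\<lambda>n. f n z)" and "L z = liminf (\<lambda>n. f n z)" for z
  have [measurable]: "U \<in> borel_measurable N" "L \<in> borel_measurable N"
    unfolding U_def[abs_def] L_def[abs_def] using f by measurable
  have tends: "tv_rate (\<lambda>n. a n z) (x z) (w z) \<longlonglongrightarrow> c \<longleftrightarrow> L z = c \<and> U z = c" for z
    unfolding tendsto_iff_Liminf_eq_Limsup[OF sequentially_bot] U_def L_def f_def ..
  have [measurable]: "(\<lambda>z. x z $ i) \<in> borel_measurable N" "(\<lambda>z. w z $ i) \<in> borel_measurable N" for i
    using x w unfolding borel_measurable_vec_iff by blast+
  have nn: "y \<in> nonneg_nonzero \<longleftrightarrow> (\<forall>i. 0 \<le> y $ i) \<and> (\<exists>i. y $ i \<noteq> 0)" for y :: "real^'p"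
    by (auto simp: nonneg_nonzero_def vec_eq_iff)
  show ?thesis
    unfolding tends nn by measurable
qed

theorem theorem1p8:
  fixes M :: "'w measure" and A :: "nat \<Rightarrow> 'w \<Rightarrow> real^'p^'p"
  assumes "prob_space M"
    and "CARD('p) \<ge> 2"
    and "\<And>n. n \<ge> 1 \<Longrightarrow> A n \<in> borel_measurable M"
    and "\<And>n. n \<ge> 1 \<Longrightarrow> AE \<omega> in M. nonneg_matrix (A n \<omega>) \<and> column_allowable (A n \<omega>)"
    and "strictly_stationary M A"
    and "ergodic_process M A"
    and "weakly_sequentially_primitive M A"
    and "integrable M (\<lambda>\<omega>. log_plus (norm (A 1 \<omega>)))"
    and "lyapunov_exponent M A 1 \<noteq> - \<infinity>"
  shows "(AE (x, w) in lebesgue. x \<in> nonneg_nonzero \<and> w \<in> nonneg_nonzero \<longrightarrow>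
            (AE \<omega> in M. tv_rate (\<lambda>n. A n \<omega>) x w
               \<longlonglongrightarrow> - (lyapunov_exponent M A 1 - lyapunov_exponent M A 2)))
       \<and> (\<forall>x w. (\<forall>i. 0 < x $ i) \<and> (\<forall>i. 0 < w $ i) \<longrightarrow>
            (AE \<omega> in M. \<exists>l. tv_rate (\<lambda>n. A n \<omega>) x w \<longlonglongrightarrow> l \<and>
               l \<le> - (lyapunov_exponent M A 1 - lyapunov_exponent M A 2)))"
proof -
  interpret prob_space M by fact
  obtain \<Lambda> \<Gamma> where cocycle: "AE \<omega> in M. matrix_cocycle (\<lambda>n. A n \<omega>) \<Lambda>"
    and conj: "AE \<omega> in M. tempered_cocycle (\<lambda>n. conjugation (forward_product (\<lambda>n. A n \<omega>) n))
          (\<lambda>n. conjugation (A (Suc n) \<omega>)) \<Gamma>"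
    by (rule AE_tempered_process[OF assms(1,3,5,6,8)])
  have "AE \<omega> in M. lyapunov_spectrum (\<lambda>n. A n \<omega>) ! (1 - 1) = \<Lambda> 1"
    using cocycle by eventually_elim (simp add: matrix_cocycle.lyapunov_spectrum_0[OF _ assms(2)])
  then have exp1: "lyapunov_exponent M A 1 = \<Lambda> 1" by (rule lyapunov_exponent_eq[OF assms(1)])
  with assms(9) have \<Lambda>1: "\<Lambda> 1 \<noteq> - \<infinity>" by simp
  have "AE \<omega> in M. lyapunov_spectrum (\<lambda>n. A n \<omega>) ! (2 - 1) = \<Lambda> 2 - \<Lambda> 1"
    using cocycle
  proof eventually_elim
    case (elim \<omega>)
    show ?case using matrix_cocycle.lyapunov_spectrum_1[OF elim assms(2) \<Lambda>1] by simp
  qed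
  then have exp2: "lyapunov_exponent M A 2 = \<Lambda> 2 - \<Lambda> 1"
    by (rule lyapunov_exponent_eq[OF assms(1)])
  have nonneg: "AE \<omega> in M. \<forall>n\<ge>1. nonneg_matrix (A n \<omega>) \<and> column_allowable (A n \<omega>)"
    using assms(4) by (simp add: AE_all_countable)
  obtain \<tau> where "AE \<omega> in M. \<forall>i.
      (\<forall>j. 0 < forward_product (\<lambda>n. A n \<omega>) (the_enat (\<tau> \<omega>)) $ i $ j) \<or>
      (\<forall>j. forward_product (\<lambda>n. A n \<omega>) (the_enat (\<tau> \<omega>)) $ i $ j = 0)"
    using assms(7) unfolding weakly_sequentially_primitive_def by blast
  \<comment> \<open>For each \<open>\<omega>\<close> the number
    \<open>the_enat (\<tau> \<omega>)\<close> serves as the time at which every row is positive or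
    zero.\<close>
  with cocycle conj nonneg have good: "AE \<omega> in M. primitive_cocycle (\<lambda>n. A n \<omega>) \<Lambda> \<Gamma>"
  proof eventually_elim
    case (elim \<omega>)
    show ?case
      unfolding primitive_cocycle_def primitive_cocycle_axioms_def
      using elim \<Lambda>1 assms(2) by blast
  qed
  define c where "c = - (lyapunov_exponent M A 1 - lyapunov_exponent M A 2)"
  have c: "c = - (\<Lambda> 1 - (\<Lambda> 2 - \<Lambda> 1))" by (simp only: c_def exp1 exp2)
  define Q where "Q p \<omega> \<longleftrightarrow> (fst p \<in> nonneg_nonzero \<longrightarrow> snd p \<in> nonneg_nonzero \<longrightarrow>
      tv_rate (\<lambda>n. A n \<omega>) (fst p) (snd p) \<longlonglongrightarrow> c)" for p \<omega>
  interpret LM: pair_sigma_finite "lborel :: ((real^'p) \<times> (real^'p)) measure" M ..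
  have "AE \<omega> in M. AE p in lborel. Q p \<omega>"
    using good
  proof eventually_elim
    case (elim \<omega>)
    interpret primitive_cocycle "\<lambda>n. A n \<omega>" \<Lambda> \<Gamma> by fact
    have "{p \<in> space (lborel \<Otimes>\<^sub>M lborel). Q p \<omega>} \<in> sets (lborel \<Otimes>\<^sub>M (lborel :: (real^'p) measure))"
      unfolding Q_def by (rule sets_tv_rate_tendsto) auto
    moreover have "AE x in lborel. AE w in lborel. Q (x, w) \<omega>"
      using AE_tv_rate by (simp add: Q_def c)
    ultimately have "AE p in lborel \<Otimes>\<^sub>M lborel. Q p \<omega>"
      by (rule lborel_pair.AE_pair_measure)
    then show ?case unfolding lborel_prod .
  qed
  moreover have "{z \<in> space (lborel \<Otimes>\<^sub>M M). Q (fst z) (snd z)} \<in> sets ((lborel :: ((real^'p) \<times> (real^'p)) measure) \<Otimes>\<^sub>M M)"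
    unfolding Q_def
  proof (rule sets_tv_rate_tendsto)
    show "(\<lambda>z. A n (snd z)) \<in> borel_measurable (lborel \<Otimes>\<^sub>M M)" if "n \<ge> 1" for n
      by (rule measurable_compose[OF measurable_snd assms(3)[OF that]])
    have fst: "fst \<in> borel_measurable (lborel :: ((real^'p) \<times> (real^'p)) measure)"
      and snd: "snd \<in> borel_measurable (lborel :: ((real^'p) \<times> (real^'p)) measure)"
      by (auto intro!: borel_measurable_continuous_onI continuous_intros)
    show "(\<lambda>z. fst (fst z)) \<in> borel_measurable ((lborel :: ((real^'p) \<times> (real^'p)) measure) \<Otimes>\<^sub>M M)"
      by (rule measurable_compose[OF measurable_fst fst])
    show "(\<lambda>z. snd (fst z)) \<in> borel_measurable ((lborel :: ((real^'p) \<times> (real^'p)) measure) \<Otimes>\<^sub>M M)"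
      by (rule measurable_compose[OF measurable_fst snd])
  qed
  \<comment> \<open>The exceptional pairs found so far depend on the realization; joint
    measurability allows the two quantifiers to be exchanged, giving one null set of pairs.\<close>
  ultimately have "AE p in lborel. AE \<omega> in M. Q p \<omega>"
    by (subst LM.AE_commute)
  then have "AE p in lebesgue. AE \<omega> in M. Q p \<omega>" by (rule AE_completion)
  then have part1: "AE (x, w) in lebesgue. x \<in> nonneg_nonzero \<and> w \<in> nonneg_nonzero \<longrightarrow>
            (AE \<omega> in M. tv_rate (\<lambda>n. A n \<omega>) x w \<longlonglongrightarrow> c)"
    by eventually_elim (auto simp: Q_def)
  have part2: "AE \<omega> in M. \<exists>l. tv_rate (\<lambda>n. A n \<omega>) x w \<longlonglongrightarrow> l \<and> l \<le> c"
    if "(\<forall>i. 0 < x $ i) \<and> (\<forall>i. 0 < w $ i)" for x w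
  proof -
    have "y \<in> nonneg_nonzero" if "\<forall>i. 0 < y $ i" for y :: "real^'p"
    proof -
      have "y \<noteq> 0"
      proof
        assume "y = 0"
        then show False using that by simp
      qed
      then show ?thesis using that by (simp add: nonneg_nonzero_def less_imp_le)
    qed
    then have xw: "x \<in> nonneg_nonzero" "w \<in> nonneg_nonzero" using that by blast+
    from good show ?thesis
      unfolding c by eventually_elim (rule primitive_cocycle.tv_rate_convergent[OF _ xw])
  qed
  show ?thesis using part1 part2 unfolding c_def by blast
qed

end
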